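(* Let $\mathcal K$ be a simplicial complex on vertex set $\mathcal V$. Let $i\in\mathbb Z_{\ge2}$, let $\mathbf a,\mathbf b\in\mathbb Z_{\ge0}^{\mathcal V}$ have disjoint supports, and let $\mathbf c=\mathbf a-\mathbf b\in\mathbb Z^{\mathcal V}$. If $\mathbf b\notin\{0,\ldots,i-1\}^{\mathcal V}$, then $T^i_{\mathbf c}(\mathcal K)=0$.
   Context: $\Bbbk$ is a field of characteristic zero and $\mathcal V$ is a finite non-empty set. A simplicial complex on vertex set $\mathcal V$ is a collection $\mathcal K$ of subsets of $\mathcal V$ (its faces) closed under taking subsets; not every element of $\mathcal V$ need be a vertex of $\mathcal K$. Its Stanley-Reisner ideal is $I_{\mathcal K}=\langle \prod_{v\in f}x_v \mid f\subseteq\mathcal V,\ f\notin\mathcal K\rangle\subseteq \Bbbk[x_v\mid v\in\mathcal V]$ and $S_{\mathcal K}=\Bbbk[x_v\mid v\in\mathcal V]/I_{\mathcal K}$, which is $\mathbb Z^{\mathcal V}$-graded. For a finitely generated commutative $\Bbbk$-algebra $S$, a Koszul-Tate resolution of $S$ is a commutative differential graded algebra $P=P_\bullet$ ($P_i=0$ for $i<0$, differential lowering degree by one), free as a graded-commutative algebra after forgetting the differential, with a quasi-isomorphism $P\to S$. The cotangent cohomology is $T^i_{S/\Bbbk}=H^i(\operatorname{Der}^\bullet_{\Bbbk}(P,S))$, where $\operatorname{Der}^i_{\Bbbk}(P,S)$ consists of the $\Bbbk$-linear maps $\phi:P\to S$ vanishing on $P_j$ for $j\ne i$ and satisfying the graded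 Leibniz rule, with differential $\phi\mapsto(-1)^{\deg\phi+1}\phi\circ\partial$. If $S$ is $\mathbb Z^{\mathcal V}$-graded, $P$ is chosen compatibly graded, and $T^i_{S/\Bbbk}$ inherits a $\mathbb Z^{\mathcal V}$-grading. Put $T^i(\mathcal K)=T^i_{S_{\mathcal K}/\Bbbk}$, and let $T^i_{\mathbf c}(\mathcal K)$ be its weight $\mathbf c$ piece. The support of $\mathbf a\in\mathbb Z_{\ge0}^{\mathcal V}$ is $\{v\in\mathcal V\mid \mathbf a_v\ne0\}$. *)

theory Defs
  imports "HOL-Algebra.Algebra" "HOL-Algebra.Algebraic_Closure_Type" "HOL-Library.Poly_Mapping"
begin

section \<open>Commutative differential graded algebras\<close>

text \<open>The ground field is a type of class \<^class>\<open>field\<close>, viewed as a ring record by means of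
  \<^const>\<open>ring_of_type_algebra\<close>.\<close>

definition direct_sum_decomposition ::
  "('k::field, 'a, 'z) module_scheme \<Rightarrow> ('i \<Rightarrow> 'a set) \<Rightarrow> bool" where
  "direct_sum_decomposition M N \<longleftrightarrow>
     (\<forall>i. submodule (N i) (ring_of_type_algebra :: 'k ring) M) \<and>
     (\<forall>x\<in>carrier M. \<exists>!f. (\<forall>i. f i \<in> N i) \<and> finite {i. f i \<noteq> \<zero>\<^bsub>M\<^esub>} \<and>
                          x = (\<Oplus>\<^bsub>M\<^esub>i\<in>{i. f i \<noteq> \<zero>\<^bsub>M\<^esub>}. f i))"

record ('k, 'p) dga = "('k, 'p) module" +
  hpart :: "int \<Rightarrow> 'p set"
  bdry :: "'p \<Rightarrow> 'p"

locale cdga = module "ring_of_type_algebra :: 'k::field ring" P + ring P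
  for P :: "('k::field, 'p) dga" (structure) +
  assumes smult_mult_left:
      "\<lbrakk>x \<in> carrier P; y \<in> carrier P\<rbrakk> \<Longrightarrow> (c \<odot> x) \<otimes> y = c \<odot> (x \<otimes> y)"
    and smult_mult_right:
      "\<lbrakk>x \<in> carrier P; y \<in> carrier P\<rbrakk> \<Longrightarrow> x \<otimes> (c \<odot> y) = c \<odot> (x \<otimes> y)"
    and degree_decomposition: "direct_sum_decomposition P (hpart P)"
    and degree_neg: "n < 0 \<Longrightarrow> hpart P n = {\<zero>}"
    and degree_one: "\<one> \<in> hpart P 0"
    and degree_mult: "\<lbrakk>x \<in> hpart P m; y \<in> hpart P n\<rbrakk> \<Longrightarrow> x \<otimes> y \<in> hpart P (m + n)"
    and graded_commutative:
      "\<lbrakk>x \<in> hpart P m; y \<in> hpart P n\<rbrakk> \<Longrightarrow> x \<otimes> y = ((-1) powi (m * n)) \<odot> (y \<otimes> x)"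
    and bdry_add: "\<lbrakk>x \<in> carrier P; y \<in> carrier P\<rbrakk> \<Longrightarrow> bdry P (x \<oplus> y) = bdry P x \<oplus> bdry P y"
    and bdry_smult: "x \<in> carrier P \<Longrightarrow> bdry P (c \<odot> x) = c \<odot> bdry P x"
    and bdry_degree: "x \<in> hpart P n \<Longrightarrow> bdry P x \<in> hpart P (n - 1)"
    and bdry_bdry: "x \<in> carrier P \<Longrightarrow> bdry P (bdry P x) = \<zero>"
    and bdry_Leibniz:
      "\<lbrakk>x \<in> hpart P m; y \<in> hpart P n\<rbrakk> \<Longrightarrow>
         bdry P (x \<otimes> y) = bdry P x \<otimes> y \<oplus> ((-1) powi m) \<odot> (x \<otimes> bdry P y)"

definition concentrated_in_degree_0 :: "('k, 's) module \<Rightarrow> ('k::field, 's) dga" where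
  "concentrated_in_degree_0 S =
     \<lparr>carrier = carrier S, monoid.mult = monoid.mult S, one = one S,
      ring.zero = ring.zero S, ring.add = ring.add S, module.smult = module.smult S,
      hpart = (\<lambda>n. if n = 0 then carrier S else {\<zero>\<^bsub>S\<^esub>}), bdry = (\<lambda>_. \<zero>\<^bsub>S\<^esub>)\<rparr>"

definition dga_hom :: "('k::field, 'p) dga \<Rightarrow> ('k, 'q) dga \<Rightarrow> ('p \<Rightarrow> 'q) set" where
  "dga_hom A B =
     {f \<in> ring_hom A B.
        (\<forall>c. \<forall>x\<in>carrier A. f (c \<odot>\<^bsub>A\<^esub> x) = c \<odot>\<^bsub>B\<^esub> f x) \<and>
        (\<forall>n. f ` hpart A n \<subseteq> hpart B n) \<and>
        (\<forall>x\<in>carrier A. f (bdry A x) = bdry B (f x))}"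

definition cycles :: "('k::field, 'p) dga \<Rightarrow> int \<Rightarrow> 'p set" where
  "cycles A n = {x \<in> hpart A n. bdry A x = \<zero>\<^bsub>A\<^esub>}"

definition boundaries :: "('k::field, 'p) dga \<Rightarrow> int \<Rightarrow> 'p set" where
  "boundaries A n = bdry A ` hpart A (n + 1)"

definition homology :: "('k::field, 'p) dga \<Rightarrow> int \<Rightarrow> 'p set monoid" where
  "homology A n = (add_monoid A)\<lparr>carrier := cycles A n\<rparr> Mod boundaries A n"

definition induced_map ::
  "('k::field, 'q) dga \<Rightarrow> ('p \<Rightarrow> 'q) \<Rightarrow> int \<Rightarrow> 'p set \<Rightarrow> 'q set" where
  "induced_map B f n C = (\<Union>x\<in>C. boundaries B n +>\<^bsub>B\<^esub> f x)"

definition quasi_isomorphism ::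
  "('k::field, 'p) dga \<Rightarrow> ('k, 'q) dga \<Rightarrow> ('p \<Rightarrow> 'q) \<Rightarrow> bool" where
  "quasi_isomorphism A B f \<longleftrightarrow> f \<in> dga_hom A B \<and>
     (\<forall>n. bij_betw (induced_map B f n) (carrier (homology A n)) (carrier (homology B n)))"


section \<open>Free graded-commutative algebras\<close>

text \<open>Finitely supported functions on words are the elements of the tensor (free associative)
  algebra on the letters. The free graded-commutative algebra on a set \<open>E\<close> of homogeneous letters is
  the quotient of the tensor algebra on \<open>E\<close> by the two-sided ideal generated by the elements
  \<open>x y - (-1)\<^sup>|\<^sup>x\<^sup>|\<^sup>|\<^sup>y\<^sup>| y x\<close>. In characteristic different from 2 this also forces the odd
  letters to square to zero.\<close>

definition word_value :: "('k::field, 'p) dga \<Rightarrow> 'p list \<Rightarrow> 'p" where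
  "word_value P u = foldr (monoid.mult P) u \<one>\<^bsub>P\<^esub>"

definition tensor_value :: "('k::field, 'p) dga \<Rightarrow> ('p list \<Rightarrow>\<^sub>0 'k) \<Rightarrow> 'p" where
  "tensor_value P f = (\<Oplus>\<^bsub>P\<^esub>u\<in>Poly_Mapping.keys f. Poly_Mapping.lookup f u \<odot>\<^bsub>P\<^esub> word_value P u)"

definition commutation_relations :: "('k::field, 'p) dga \<Rightarrow> 'p set \<Rightarrow> ('p list \<Rightarrow>\<^sub>0 'k) set" where
  "commutation_relations P E =
     {Poly_Mapping.single (u @ [x, y] @ w) 1
        - Poly_Mapping.single (u @ [y, x] @ w) ((-1) powi (m * n)) | u w x y m n.
        u \<in> lists E \<and> w \<in> lists E \<and> x \<in> E \<inter> hpart P m \<and> y \<in> E \<inter> hpart P n}"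

definition freely_generated_by :: "('k::field, 'p) dga \<Rightarrow> 'p set \<Rightarrow> bool" where
  "freely_generated_by P E \<longleftrightarrow>
     E \<subseteq> (\<Union>n. hpart P n) \<and>
     tensor_value P ` {f. Poly_Mapping.keys f \<subseteq> lists E} = carrier P \<and>
     {f. Poly_Mapping.keys f \<subseteq> lists E \<and> tensor_value P f = \<zero>\<^bsub>P\<^esub>} =
       Modules.module.span (\<lambda>c. Poly_Mapping.map ((*) c)) (commutation_relations P E)"


section \<open>Koszul-Tate resolutions and cotangent cohomology\<close>

definition koszul_tate_resolution ::
  "('k::field_char_0, 'p) dga \<Rightarrow> ('k, 's) module \<Rightarrow> ('p \<Rightarrow> 's) \<Rightarrow> bool" where
  "koszul_tate_resolution P S \<epsilon> \<longleftrightarrow>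
     cdga P \<and> (\<exists>E. freely_generated_by P E) \<and>
     quasi_isomorphism P (concentrated_in_degree_0 S) \<epsilon>"

text \<open>Here \<open>S\<close> is a \<open>P\<close>-module through \<open>\<epsilon>\<close>. Derivations are extended by \<^const>\<open>undefined\<close> outside
  the carrier of \<open>P\<close>, so that equality of functions is equality of derivations.\<close>

definition derivations ::
  "('k::field, 'p) dga \<Rightarrow> ('k, 's) module \<Rightarrow> ('p \<Rightarrow> 's) \<Rightarrow> int \<Rightarrow> ('p \<Rightarrow> 's) set" where
  "derivations P S \<epsilon> i =
     {\<phi> \<in> carrier P \<rightarrow>\<^sub>E carrier S.
        (\<forall>x\<in>carrier P. \<forall>y\<in>carrier P. \<phi> (x \<oplus>\<^bsub>P\<^esub> y) = \<phi> x \<oplus>\<^bsub>S\<^esub> \<phi> y) \<and>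
        (\<forall>c. \<forall>x\<in>carrier P. \<phi> (c \<odot>\<^bsub>P\<^esub> x) = c \<odot>\<^bsub>S\<^esub> \<phi> x) \<and>
        (\<forall>j. j \<noteq> i \<longrightarrow> (\<forall>x\<in>hpart P j. \<phi> x = \<zero>\<^bsub>S\<^esub>)) \<and>
        (\<forall>m n. \<forall>x\<in>hpart P m. \<forall>y\<in>hpart P n.
           \<phi> (x \<otimes>\<^bsub>P\<^esub> y) =
             \<phi> x \<otimes>\<^bsub>S\<^esub> \<epsilon> y \<oplus>\<^bsub>S\<^esub> ((-1) powi (i * m)) \<odot>\<^bsub>S\<^esub> (\<epsilon> x \<otimes>\<^bsub>S\<^esub> \<phi> y))}"

definition derivation_group ::
  "('k::field, 'p) dga \<Rightarrow> ('k, 's) module \<Rightarrow> ('p \<Rightarrow> 's) \<Rightarrow> int \<Rightarrow> ('p \<Rightarrow> 's) monoid" where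
  "derivation_group P S \<epsilon> i =
     \<lparr>carrier = derivations P S \<epsilon> i,
      monoid.mult = (\<lambda>\<phi> \<psi>. \<lambda>x\<in>carrier P. \<phi> x \<oplus>\<^bsub>S\<^esub> \<psi> x),
      one = (\<lambda>x\<in>carrier P. \<zero>\<^bsub>S\<^esub>)\<rparr>"

definition derivation_differential ::
  "('k::field, 'p) dga \<Rightarrow> ('k, 's) module \<Rightarrow> int \<Rightarrow> ('p \<Rightarrow> 's) \<Rightarrow> ('p \<Rightarrow> 's)" where
  "derivation_differential P S i \<phi> =
     (\<lambda>x\<in>carrier P. ((-1) powi (i + 1)) \<odot>\<^bsub>S\<^esub> \<phi> (bdry P x))"

definition derivation_cocycles ::
  "('k::field, 'p) dga \<Rightarrow> ('k, 's) module \<Rightarrow> ('p \<Rightarrow> 's) \<Rightarrow> int \<Rightarrow> ('p \<Rightarrow> 's) set" where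
  "derivation_cocycles P S \<epsilon> i =
     {\<phi> \<in> derivations P S \<epsilon> i.
        derivation_differential P S i \<phi> = \<one>\<^bsub>derivation_group P S \<epsilon> (i + 1)\<^esub>}"

definition derivation_coboundaries ::
  "('k::field, 'p) dga \<Rightarrow> ('k, 's) module \<Rightarrow> ('p \<Rightarrow> 's) \<Rightarrow> int \<Rightarrow> ('p \<Rightarrow> 's) set" where
  "derivation_coboundaries P S \<epsilon> i =
     derivation_differential P S (i - 1) ` derivations P S \<epsilon> (i - 1)"

definition cotangent_cohomology ::
  "('k::field, 'p) dga \<Rightarrow> ('k, 's) module \<Rightarrow> ('p \<Rightarrow> 's) \<Rightarrow> int \<Rightarrow> ('p \<Rightarrow> 's) set monoid" where
  "cotangent_cohomology P S \<epsilon> i =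
     (derivation_group P S \<epsilon> i)\<lparr>carrier := derivation_cocycles P S \<epsilon> i\<rparr>
       Mod derivation_coboundaries P S \<epsilon> i"


section \<open>Gradings by weights\<close>

definition weight_grading ::
  "('k::field, 'a, 'z) module_scheme \<Rightarrow> (('v \<Rightarrow> int) \<Rightarrow> 'a set) \<Rightarrow> bool" where
  "weight_grading A W \<longleftrightarrow>
     direct_sum_decomposition A W \<and> \<one>\<^bsub>A\<^esub> \<in> W (\<lambda>_. 0) \<and>
     (\<forall>u w. \<forall>x\<in>W u. \<forall>y\<in>W w. x \<otimes>\<^bsub>A\<^esub> y \<in> W (\<lambda>v. u v + w v))"

text \<open>A Koszul-Tate resolution that is graded compatibly with the grading \<open>U\<close> of \<open>S\<close>. The
  generators are required to be homogeneous for both gradings.\<close>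

definition weighted_koszul_tate_resolution ::
  "('k::field_char_0, 'p) dga \<Rightarrow> (('v \<Rightarrow> int) \<Rightarrow> 'p set) \<Rightarrow>
   ('k, 's) module \<Rightarrow> (('v \<Rightarrow> int) \<Rightarrow> 's set) \<Rightarrow> ('p \<Rightarrow> 's) \<Rightarrow> bool" where
  "weighted_koszul_tate_resolution P W S U \<epsilon> \<longleftrightarrow>
     koszul_tate_resolution P S \<epsilon> \<and>
     weight_grading P W \<and>
     direct_sum_decomposition P (\<lambda>(n, w). hpart P n \<inter> W w) \<and>
     (\<exists>E. freely_generated_by P E \<and> E \<subseteq> (\<Union>w. W w)) \<and>
     (\<forall>w. bdry P ` W w \<subseteq> W w) \<and>
     (\<forall>w. \<epsilon> ` W w \<subseteq> U w)"

definition weight_derivations ::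
  "(('v \<Rightarrow> int) \<Rightarrow> 'p set) \<Rightarrow> (('v \<Rightarrow> int) \<Rightarrow> 's set) \<Rightarrow> ('v \<Rightarrow> int) \<Rightarrow> ('p \<Rightarrow> 's) set" where
  "weight_derivations W U c = {\<phi>. \<forall>w. \<phi> ` W w \<subseteq> U (\<lambda>v. w v + c v)}"

text \<open>The weight \<open>c\<close> piece of \<^const>\<open>cotangent_cohomology\<close>: the classes of the cocycles that shift
  weights by \<open>c\<close>.\<close>

definition cotangent_cohomology_weight ::
  "('k::field, 'p) dga \<Rightarrow> (('v \<Rightarrow> int) \<Rightarrow> 'p set) \<Rightarrow>
   ('k, 's) module \<Rightarrow> (('v \<Rightarrow> int) \<Rightarrow> 's set) \<Rightarrow> ('p \<Rightarrow> 's) \<Rightarrow> int \<Rightarrow> ('v \<Rightarrow> int) \<Rightarrow>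
   ('p \<Rightarrow> 's) set set" where
  "cotangent_cohomology_weight P W S U \<epsilon> i c =
     {derivation_coboundaries P S \<epsilon> i #>\<^bsub>derivation_group P S \<epsilon> i\<^esub> \<phi> | \<phi>.
        \<phi> \<in> derivation_cocycles P S \<epsilon> i \<inter> weight_derivations W U c}"


section \<open>Stanley-Reisner rings\<close>

definition simplicial_complex :: "'v set set \<Rightarrow> bool" where
  "simplicial_complex \<K> \<longleftrightarrow> (\<forall>f\<in>\<K>. \<forall>g. g \<subseteq> f \<longrightarrow> g \<in> \<K>)"

text \<open>Polynomials are finitely supported functions on exponents; exponents are finitely supported
  functions on variables.\<close>

type_synonym ('v, 'k) mvpoly = "('v \<Rightarrow>\<^sub>0 nat) \<Rightarrow>\<^sub>0 'k"

definition mvvar :: "'v \<Rightarrow> ('v, 'k::field) mvpoly" where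
  "mvvar v = Poly_Mapping.single (Poly_Mapping.single v 1) 1"

definition mvconst :: "'k \<Rightarrow> ('v, 'k::field) mvpoly" where
  "mvconst c = Poly_Mapping.single 0 c"

abbreviation mvpoly_ring :: "('v, 'k::field) mvpoly ring" where
  "mvpoly_ring \<equiv> ring_of_type_algebra"

definition stanley_reisner_ideal :: "'v::finite set set \<Rightarrow> ('v, 'k::field) mvpoly set" where
  "stanley_reisner_ideal \<K> = Idl\<^bsub>mvpoly_ring\<^esub> {\<Prod>v\<in>f. mvvar v | f. f \<notin> \<K>}"

definition stanley_reisner_ring ::
  "'v::finite set set \<Rightarrow> ('k::field, ('v, 'k) mvpoly set) module" where
  "stanley_reisner_ring \<K> =
     (let I = stanley_reisner_ideal \<K>; Q = mvpoly_ring Quot I in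
      \<lparr>carrier = carrier Q, monoid.mult = monoid.mult Q, one = one Q,
       ring.zero = ring.zero Q, ring.add = ring.add Q,
       module.smult = (\<lambda>c C. (I +>\<^bsub>mvpoly_ring\<^esub> mvconst c) \<otimes>\<^bsub>Q\<^esub> C)\<rparr>)"

definition stanley_reisner_weight ::
  "'v::finite set set \<Rightarrow> ('v \<Rightarrow> int) \<Rightarrow> ('v, 'k::field) mvpoly set set" where
  "stanley_reisner_weight \<K> w =
     {stanley_reisner_ideal \<K> +>\<^bsub>mvpoly_ring\<^esub> p | p.
        \<forall>m\<in>Poly_Mapping.keys p. \<forall>v. int (Poly_Mapping.lookup m v) = w v}"

definition weight_support :: "('v \<Rightarrow> nat) \<Rightarrow> 'v set" where
  "weight_support a = {v. a v \<noteq> 0}"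

text \<open>\<open>T\<^sup>i\<^sub>c(\<K>)\<close>, computed with a weighted Koszul-Tate resolution \<open>\<epsilon>\<close> from
  \<open>P\<close> to the Stanley-Reisner ring.\<close>

abbreviation is_resolution_of_complex ::
  "'v::finite set set \<Rightarrow> ('k::field_char_0, 'p) dga \<Rightarrow> (('v \<Rightarrow> int) \<Rightarrow> 'p set) \<Rightarrow>
   ('p \<Rightarrow> ('v, 'k) mvpoly set) \<Rightarrow> bool" where
  "is_resolution_of_complex \<K> P W \<epsilon> \<equiv>
     weighted_koszul_tate_resolution P W (stanley_reisner_ring \<K>) (stanley_reisner_weight \<K>) \<epsilon>"

abbreviation T_complex ::
  "'v::finite set set \<Rightarrow> ('k::field_char_0, 'p) dga \<Rightarrow> ('p \<Rightarrow> ('v, 'k) mvpoly set) \<Rightarrow> int \<Rightarrow>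
   ('p \<Rightarrow> ('v, 'k) mvpoly set) set monoid" where
  "T_complex \<K> P \<epsilon> i \<equiv> cotangent_cohomology P (stanley_reisner_ring \<K>) \<epsilon> i"

abbreviation T_complex_weight ::
  "'v::finite set set \<Rightarrow> ('k::field_char_0, 'p) dga \<Rightarrow> (('v \<Rightarrow> int) \<Rightarrow> 'p set) \<Rightarrow>
   ('p \<Rightarrow> ('v, 'k) mvpoly set) \<Rightarrow> int \<Rightarrow> ('v \<Rightarrow> int) \<Rightarrow>
   ('p \<Rightarrow> ('v, 'k) mvpoly set) set set" where
  "T_complex_weight \<K> P W \<epsilon> i c \<equiv>
     cotangent_cohomology_weight P W (stanley_reisner_ring \<K>) (stanley_reisner_weight \<K>) \<epsilon> i c"

end

theory Submission
  imports Defs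
begin

text \<open>A derivation of weight \<open>c\<close> lowers the \<open>v\<close>-weight by \<open>b v\<close>, so it kills every generator of degree
  \<open>i\<close> whose \<open>v\<close>-weight is below \<open>b v\<close>. A Tate resolution of the Stanley-Reisner ring can be chosen
  with generators of degree \<open>n \<ge> 1\<close> and \<open>v\<close>-weight at most \<open>max (n - 1) 1\<close>: the ideal is generated by
  squarefree monomials, and a word whose \<open>v\<close>-weight exceeds its degree contains the variable
  \<open>x\<^sub>v\<close>, so that a cycle of large \<open>v\<close>-weight is \<open>x\<^sub>v\<close> times a cycle. As the given resolution \<open>P\<close> is
  arbitrary, this Tate resolution is mapped to \<open>P\<close> and enlarged by contractible pairs until the map
  is surjective; since \<open>P\<close> is free, it is then a retract of the enlarged algebra. The pullback of a
  cocycle of degree \<open>i\<close> with \<open>b v \<ge> i \<ge> 2\<close> vanishes on the Tate generators, hence it is the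
  coboundary of its composite with the contraction of the pairs, and restricting along the section
  gives a primitive on \<open>P\<close>.\<close>

section \<open>Free associative algebras\<close>

text \<open>The argument concerns a single coordinate \<open>v0\<close>, one with
  \<open>b v0 \<ge> i\<close>. The bound \<open>max (n - 1) 1\<close> meets two demands. It is at
  most \<open>n\<close> for \<open>n \<ge> 1\<close>, so a word in Tate generators without the
  variable \<open>v0\<close> has \<open>v0\<close>-weight at most its degree; and for
  \<open>n = i \<ge> 2\<close> it equals \<open>i - 1\<close>, which is below \<open>b v0\<close>.
  The 1 serves degree 1, where squarefree monomials have weight up to 1; so \<open>i \<ge> 2\<close>
  is what makes both demands compatible. No quotient algebra is formed: all computation is with
  linear combinations of words, modulo the ideal of commutation relations. The heart is the
  acyclicity of the kernel of the evaluation into \<open>P\<close>; from it a section on the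
  generators of \<open>P\<close> of degree at most \<open>i\<close> is built by induction on the
  degree. The contractible pairs do no harm to the cocycle. Differential and contraction anticommute
  to the operator that counts the letters of pairs, while the pulled-back cocycle sees only words
  with exactly one such letter, where the count is 1.\<close>

instantiation list :: (type) monoid_add
begin
definition zero_list :: "'a list" where "zero_list = []"
definition plus_list :: "'a list \<Rightarrow> 'a list \<Rightarrow> 'a list" where "plus_list = (@)"
instance by standard (auto simp: zero_list_def plus_list_def)
end

text \<open>With concatenation as the addition of lists, the convolution product of finitely
  supported functions is the product of the tensor algebra on the letters.\<close>

type_synonym ('g, 'k) falg = "'g list \<Rightarrow>\<^sub>0 'k"

abbreviation word :: "'g list \<Rightarrow> ('g, 'k::comm_ring_1) falg" where
  "word u \<equiv> Poly_Mapping.single u 1"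

definition scal :: "'k::comm_ring_1 \<Rightarrow> ('g, 'k) falg \<Rightarrow> ('g, 'k) falg" where
  "scal c t = Poly_Mapping.single [] c * t"

text \<open>The sign \<open>(-1) powi n\<close> in an arbitrary ring, so that the same expression is
  a scalar of \<open>'k\<close> and an element of the free algebra.\<close>

definition sg :: "int \<Rightarrow> 'a::ring_1" where
  "sg n = (if even n then 1 else - 1)"

lemma sg_add: "sg (m + n) = sg m * sg n"
  by (auto simp: sg_def)

lemma sg_0 [simp]: "sg 0 = 1"
  and sg_sq [simp]: "sg n * sg n = 1"
  by (auto simp: sg_def)

lemma powi_minus_one: "(- 1 :: 'k::field) powi n = sg n"
  by (auto simp: sg_def power_int_minus_left)

lemma single_Nil_one [simp]: "Poly_Mapping.single [] 1 = (1 :: ('g, 'k::comm_ring_1) falg)"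
  by (metis single_one zero_list_def)

lemma single_times_single [simp]:
  "Poly_Mapping.single u a * Poly_Mapping.single w b =
     (Poly_Mapping.single (u @ w) (a * b) :: ('g, 'k::comm_ring_1) falg)"
  by (simp add: mult_single plus_list_def)

abbreviation (input) "keys \<equiv> Poly_Mapping.keys"
abbreviation (input) "lookup \<equiv> Poly_Mapping.lookup"
abbreviation (input) "single \<equiv> Poly_Mapping.single"

lemma falg_induct [consumes 1, case_names zero single add]:
  assumes "keys t \<subseteq> A" and "P 0"
    and "\<And>u c. u \<in> A \<Longrightarrow> P (single u c)"
    and "\<And>s t. keys s \<subseteq> A \<Longrightarrow> keys t \<subseteq> A \<Longrightarrow> P s \<Longrightarrow> P t \<Longrightarrow> P (s + t)"
  shows "P (t :: 'u \<Rightarrow>\<^sub>0 'k::comm_ring_1)"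
proof -
  define S where "S = keys t"
  have "finite S" by (simp add: S_def)
  moreover have "S \<supseteq> keys t" by (simp add: S_def)
  moreover have "S \<subseteq> A" using assms(1) by (simp add: S_def)
  ultimately show ?thesis
  proof (induction S arbitrary: t rule: finite_induct)
    case empty
    then show ?case using assms(2) by simp
  next
    case (insert u S)
    define s where "s = t - single u (lookup t u)"
    have "lookup s u = 0" by (simp add: s_def lookup_minus)
    then have "u \<notin> keys s" by (simp add: in_keys_iff)
    moreover have "keys s \<subseteq> insert u (keys t)"
      unfolding s_def by (rule order.trans[OF keys_diff]) auto
    ultimately have k: "keys s \<subseteq> S" using insert.prems by blast
    have "P (s + single u (lookup t u))"
    proof (rule assms(4))
      show "keys s \<subseteq> A" using k insert.prems by blast
      show "keys (single u (lookup t u)) \<subseteq> A"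
        using insert.prems by auto
      show "P s" using insert.IH[OF k] insert.prems by auto
      show "P (single u (lookup t u))"
        using insert.prems by (intro assms(3)) auto
    qed
    then show ?case by (simp add: s_def)
  qed
qed

lemma single_commute:
  "single [] c * t = t * single [] (c::'k::comm_ring_1)"
proof -
  have "keys t \<subseteq> UNIV" by simp
  then show ?thesis
    by (induction t rule: falg_induct) (auto simp: algebra_simps)
qed

lemma scal_add: "scal c (s + t) = scal c s + scal c t"
  and scal_diff: "scal c (s - t) = scal c s - scal c t"
  and scal_minus: "scal c (- t) = - scal c t"
  and scal_zero [simp]: "scal c 0 = 0"
  and scal_zero_left [simp]: "scal 0 t = 0"
  and scal_one [simp]: "scal 1 t = t"
  and scal_mult_left: "scal c s * t = scal c (s * t)"
  and scal_add_left: "scal (a + b) t = scal a t + scal b t"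
  by (simp_all add: scal_def algebra_simps single_add)

lemma scal_mult_right: "s * scal c t = scal c (s * t)"
  by (metis mult.assoc scal_def single_commute)

lemma scal_scal: "scal a (scal b t) = scal (a * b) t"
  by (simp add: scal_def flip: mult.assoc)

lemma scal_single [simp]: "scal c (single u a) = single u (c * a)"
  by (simp add: scal_def)

lemma scal_sg: "scal (sg n) t = sg n * t"
  by (simp add: sg_def scal_minus[symmetric] scal_def single_uminus)

lemma scal_sg_mult: "scal c (sg n * t) = sg n * scal c t"
  by (simp add: sg_def scal_minus)

lemma map_eq_scal: "Poly_Mapping.map ((*) c) t = scal c t"
  by (simp add: scal_def mult_map_scale_conv_mult zero_list_def)

lemma lookup_scal [simp]: "lookup (scal c t) u = c * lookup t u"
proof -
  have "keys t \<subseteq> UNIV" by simp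
  then show ?thesis
    by (induction t rule: falg_induct)
       (auto simp: algebra_simps lookup_add scal_add lookup_single when_def)
qed

lemma keys_scal: "keys (scal c t) \<subseteq> keys t"
  by (auto simp: in_keys_iff)

section \<open>Linear extension from words, and spans of words\<close>

definition lin :: "('g list \<Rightarrow> ('h, 'k::comm_ring_1) falg) \<Rightarrow> ('g, 'k) falg \<Rightarrow> ('h, 'k) falg" where
  "lin f t = (\<Sum>u\<in>keys t. scal (lookup t u) (f u))"

lemma lin_superset:
  assumes "finite A" "keys t \<subseteq> A"
  shows "lin f t = (\<Sum>u\<in>A. scal (lookup t u) (f u))"
  unfolding lin_def
  by (rule sum.mono_neutral_left) (use assms in \<open>auto simp: in_keys_iff\<close>)

lemma lin_zero [simp]: "lin f 0 = 0"
  by (simp add: lin_def)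

lemma lin_add: "lin f (s + t) = lin f s + lin f t"
proof -
  let ?A = "keys s \<union> keys t"
  have "lin f (s + t) = (\<Sum>u\<in>?A. scal (lookup (s + t) u) (f u))"
    by (rule lin_superset) (auto dest: keys_add[THEN subsetD])
  moreover have "lin f s = (\<Sum>u\<in>?A. scal (lookup s u) (f u))"
    "lin f t = (\<Sum>u\<in>?A. scal (lookup t u) (f u))"
    by (rule lin_superset; simp)+
  ultimately show ?thesis
    by (simp add: lookup_add scal_add_left sum.distrib)
qed

lemma lin_single [simp]: "lin f (single u c) = scal c (f u)"
  by (cases "c = 0") (auto simp: lin_def)

lemma lin_scal: "lin f (scal c t) = scal c (lin f t)"
proof -
  have "keys t \<subseteq> UNIV" by simp
  then show ?thesis
    by (induction t rule: falg_induct) (auto simp: scal_add lin_add scal_scal)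
qed

lemma lin_minus: "lin f (- t) = - lin f t"
  by (metis add_eq_0_iff lin_add lin_zero add.right_inverse)

lemma lin_diff: "lin f (s - t) = lin f s - lin f t"
  by (metis add_uminus_conv_diff lin_add lin_minus)

lemma lin_sg: "lin f (sg n * t) = sg n * lin f t"
  by (simp add: sg_def lin_minus)

lemma lin_cong:
  "(\<And>u. u \<in> keys t \<Longrightarrow> f u = f' u) \<Longrightarrow> lin f t = lin f' t"
  by (simp add: lin_def)

definition wdeg :: "('g \<Rightarrow> int) \<Rightarrow> 'g list \<Rightarrow> int" where
  "wdeg d u = sum_list (map d u)"

lemma wdeg_simps [simp]: "wdeg d [] = 0" "wdeg d (l # u) = d l + wdeg d u"
  "wdeg d (u @ w) = wdeg d u + wdeg d w"
  by (simp_all add: wdeg_def)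

text \<open>Every graded piece, of the free algebra as of the polynomial ring, is the span of a set
  of basis elements. Homogeneity thus becomes a condition on the support and is checked on single
  words or monomials.\<close>

definition supp_in :: "'u set \<Rightarrow> ('u \<Rightarrow>\<^sub>0 'k::comm_ring_1) set" where
  "supp_in A = {t. keys t \<subseteq> A}"

lemma supp_in_zero [simp, intro]: "0 \<in> supp_in A"
  by (simp add: supp_in_def)

lemma supp_in_add [intro]: "s \<in> supp_in A \<Longrightarrow> t \<in> supp_in A \<Longrightarrow> s + t \<in> supp_in A"
  unfolding supp_in_def by (auto dest: keys_add[THEN subsetD])

lemma supp_in_minus [intro]: "t \<in> supp_in A \<Longrightarrow> - t \<in> supp_in A"
  unfolding supp_in_def by (auto simp: in_keys_iff)

lemma supp_in_diff [intro]: "s \<in> supp_in A \<Longrightarrow> t \<in> supp_in A \<Longrightarrow> s - t \<in> supp_in A"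
  by (metis add_uminus_conv_diff supp_in_add supp_in_minus)

lemma supp_in_scal [intro]: "t \<in> supp_in A \<Longrightarrow> scal c t \<in> supp_in A"
  unfolding supp_in_def using keys_scal by blast

lemma supp_in_sg [intro]: "t \<in> supp_in (A :: 'g list set) \<Longrightarrow> sg n * t \<in> supp_in A"
  by (auto simp: sg_def)

lemma supp_in_single [intro]: "u \<in> A \<Longrightarrow> single u c \<in> supp_in A"
  by (auto simp: supp_in_def)

lemma supp_in_mono: "t \<in> supp_in A \<Longrightarrow> A \<subseteq> B \<Longrightarrow> t \<in> supp_in B"
  by (auto simp: supp_in_def)

lemma supp_in_mult:
  assumes "s \<in> supp_in A" "t \<in> supp_in B" "\<And>u w. u \<in> A \<Longrightarrow> w \<in> B \<Longrightarrow> u @ w \<in> C"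
  shows "s * t \<in> supp_in C"
  using assms keys_mult[of s t] unfolding supp_in_def by (fastforce simp: plus_list_def)

lemma supp_in_lin:
  assumes "t \<in> supp_in A" "\<And>u. u \<in> A \<Longrightarrow> f u \<in> supp_in B"
  shows "lin f t \<in> supp_in B"
proof -
  from assms(1) have "keys t \<subseteq> A" by (simp add: supp_in_def)
  then show ?thesis
    by (induction t rule: falg_induct) (auto simp: lin_add intro!: assms(2))
qed

lemma supp_in_induct [consumes 1, case_names zero single add]:
  assumes "t \<in> supp_in A" and "P 0"
    and "\<And>u c. u \<in> A \<Longrightarrow> P (single u c)"
    and "\<And>s t. s \<in> supp_in A \<Longrightarrow> t \<in> supp_in A \<Longrightarrow> P s \<Longrightarrow> P t \<Longrightarrow> P (s + t)"
  shows "P (t :: 'u \<Rightarrow>\<^sub>0 'k::comm_ring_1)"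
  using assms unfolding supp_in_def by (auto intro: falg_induct[of t A P])

text \<open>Built from multiples of relations placed between two words: closure under multiplication
  is then a consequence, and a linear map need be checked on these relations alone. As a monotone
  inductive set it can also occur in the inductive definition of \<open>valid\<close>.\<close>

inductive_set comm_ideal :: "('g \<Rightarrow> int) \<Rightarrow> 'g set \<Rightarrow> ('g, 'k::comm_ring_1) falg set"
  for d :: "'g \<Rightarrow> int" and G :: "'g set" where
  zero [intro]: "0 \<in> comm_ideal d G"
| rel: "t \<in> comm_ideal d G \<Longrightarrow> u \<in> lists G \<Longrightarrow> w \<in> lists G \<Longrightarrow> x \<in> G \<Longrightarrow> y \<in> G \<Longrightarrow>
    t + scal c (word (u @ [x, y] @ w) - sg (d x * d y) * word (u @ [y, x] @ w)) \<in> comm_ideal d G"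

lemma comm_ideal_mono:
  assumes "G \<subseteq> G'" shows "comm_ideal d G \<subseteq> comm_ideal d G'"
proof
  fix t :: "('a, 'b) falg" assume "t \<in> comm_ideal d G"
  then show "t \<in> comm_ideal d G'"
  proof induction
    case (rel t u w x y c)
    then show ?case using assms lists_mono[OF assms] by (intro comm_ideal.rel) blast+
  qed (rule comm_ideal.zero)
qed

lemma comm_ideal_add [intro]:
  assumes "s \<in> comm_ideal d G" "t \<in> comm_ideal d G" shows "s + t \<in> comm_ideal d G"
  using assms(2)
proof (induction t)
  case zero
  then show ?case using assms(1) by simp
next
  case (rel t u w x y c)
  then show ?case using comm_ideal.rel[OF rel.IH rel.hyps(2-5)] by (simp add: add.assoc)
qed

lemma comm_ideal_rel:
  assumes "u \<in> lists G" "w \<in> lists G" "x \<in> G" "y \<in> G"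
  shows "scal c (word (u @ [x, y] @ w) - sg (d x * d y) * word (u @ [y, x] @ w)) \<in> comm_ideal d G"
  using comm_ideal.rel[OF comm_ideal.zero assms] by simp

lemma comm_ideal_linear:
  assumes "t \<in> comm_ideal d G" "F 0 = 0" "\<And>s t. F (s + t) = F s + F t"
    and "\<And>u w x y c. u \<in> lists G \<Longrightarrow> w \<in> lists G \<Longrightarrow> x \<in> G \<Longrightarrow> y \<in> G \<Longrightarrow>
      F (scal c (word (u @ [x, y] @ w) - sg (d x * d y) * word (u @ [y, x] @ w))) \<in> comm_ideal d' G'"
  shows "F t \<in> comm_ideal d' G'"
  using assms(1)
proof induction
  case zero
  then show ?case using assms(2) by (auto intro: comm_ideal.zero)
next
  case (rel t u w x y c)
  then show ?case using assms(3) comm_ideal_add[OF rel.IH assms(4)[OF rel.hyps(2-5)]] by simp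
qed

lemma comm_ideal_scal [intro]: "t \<in> comm_ideal d G \<Longrightarrow> scal c t \<in> comm_ideal d G"
  by (erule comm_ideal_linear) (simp_all only: scal_zero scal_add scal_scal comm_ideal_rel)

lemma comm_ideal_minus [intro]: "t \<in> comm_ideal d G \<Longrightarrow> - t \<in> comm_ideal d G"
  using comm_ideal_scal[of t d G "-1"] by (simp add: scal_def single_uminus)

lemma comm_ideal_sg [intro]: "t \<in> comm_ideal d G \<Longrightarrow> sg n * t \<in> comm_ideal d G"
  by (auto simp: sg_def)

lemma comm_ideal_diff [intro]:
  "s \<in> comm_ideal d G \<Longrightarrow> t \<in> comm_ideal d G \<Longrightarrow> s - t \<in> comm_ideal d G"
  by (metis add_uminus_conv_diff comm_ideal_add comm_ideal_minus)

lemma comm_ideal_mult_left: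
  assumes "s \<in> supp_in (lists G)" "t \<in> comm_ideal d G" shows "s * t \<in> comm_ideal d G"
  using assms(1)
proof (induction s rule: supp_in_induct)
  case (single v a)
  show ?case using assms(2)
  proof (rule comm_ideal_linear)
    fix u w x y c assume *: "u \<in> lists G" "w \<in> lists G" "x \<in> G" "y \<in> G"
    have "single v a * scal c (word (u @ [x, y] @ w) - sg (d x * d y) * word (u @ [y, x] @ w))
      = scal (a * c) (word ((v @ u) @ [x, y] @ w) - sg (d x * d y) * word ((v @ u) @ [y, x] @ w))"
      by (cases "even (d x * d y)")
         (simp_all del: even_mult_iff add: sg_def scal_diff scal_add ring_distribs scal_minus mult.commute)
    also have "\<dots> \<in> comm_ideal d G" using single * by (intro comm_ideal_rel) auto
    finally show "single v a * scal c (word (u @ [x, y] @ w) - sg (d x * d y) * word (u @ [y, x] @ w))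
      \<in> comm_ideal d G" .
  qed (auto simp: algebra_simps)
qed (auto simp: algebra_simps intro: comm_ideal.zero)

lemma comm_ideal_mult_right:
  assumes "s \<in> supp_in (lists G)" "t \<in> comm_ideal d G" shows "t * s \<in> comm_ideal d G"
  using assms(1)
proof (induction s rule: supp_in_induct)
  case (single v a)
  show ?case using assms(2)
  proof (rule comm_ideal_linear)
    fix u w x y c assume *: "u \<in> lists G" "w \<in> lists G" "x \<in> G" "y \<in> G"
    have "scal c (word (u @ [x, y] @ w) - sg (d x * d y) * word (u @ [y, x] @ w)) * single v a
      = scal (a * c) (word (u @ [x, y] @ (w @ v)) - sg (d x * d y) * word (u @ [y, x] @ (w @ v)))"
      by (cases "even (d x * d y)")
         (simp_all del: even_mult_iff add: sg_def scal_diff scal_add ring_distribs scal_minus mult.commute)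
    also have "\<dots> \<in> comm_ideal d G" using single * by (intro comm_ideal_rel) auto
    finally show "scal c (word (u @ [x, y] @ w) - sg (d x * d y) * word (u @ [y, x] @ w)) * single v a
      \<in> comm_ideal d G" .
  qed (auto simp: algebra_simps)
qed (auto simp: algebra_simps intro: comm_ideal.zero)

section \<open>Graded derivations\<close>

definition hwords :: "('g \<Rightarrow> int) \<Rightarrow> 'g set \<Rightarrow> int \<Rightarrow> 'g list set" where
  "hwords d G n = {u \<in> lists G. wdeg d u = n}"

lemma hwords_Cons [simp]: "l # u \<in> hwords d G n \<longleftrightarrow> l \<in> G \<and> u \<in> hwords d G (n - d l)"
  and hwords_Nil [simp]: "[] \<in> hwords d G n \<longleftrightarrow> n = 0"
  and hwords_append: "u \<in> hwords d G m \<Longrightarrow> w \<in> hwords d G n \<Longrightarrow> u @ w \<in> hwords d G (m + n)"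
  by (auto simp: hwords_def)

lemma hwords_lists: "hwords d G n \<subseteq> lists G"
  by (auto simp: hwords_def)

lemma supp_in_hwords_lists: "t \<in> supp_in (hwords d G n) \<Longrightarrow> t \<in> supp_in (lists G)"
  by (rule supp_in_mono[OF _ hwords_lists])

lemma supp_in_hwords_mult:
  "s \<in> supp_in (hwords d G m) \<Longrightarrow> t \<in> supp_in (hwords d G n) \<Longrightarrow> s * t \<in> supp_in (hwords d G (m + n))"
  by (erule (1) supp_in_mult) (rule hwords_append)

lemma supp_in_lists_mult:
  "s \<in> supp_in (lists G) \<Longrightarrow> t \<in> supp_in (lists G) \<Longrightarrow> s * t \<in> supp_in (lists G)"
  by (erule (1) supp_in_mult) auto

section \<open>Graded commutativity of homogeneous elements modulo the ideal\<close>

lemma comm_ideal_trans: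
  assumes "r - s \<in> comm_ideal d G" "s - t \<in> comm_ideal d G" shows "r - t \<in> comm_ideal d G"
  using comm_ideal_add[OF assms] by simp

lemma comm_ideal_sym: "s - t \<in> comm_ideal d G \<Longrightarrow> t - s \<in> comm_ideal d G"
  using comm_ideal_minus by fastforce

text \<open>With \<open>m = |x||y|\<close> and \<open>n = |x||w|\<close> this is the Leibniz rule of
  the graded commutator in its second argument, [x, yw] = [x, y] w + (-1)^m y [x, w]; it drives the
  induction along a word.\<close>

lemma sg_commutator_mult_right:
  "x * (y * w) - sg (m + n) * (y * w * x) =
    (x * y - sg m * (y * x)) * w + sg m * (y * (x * w - sg n * (w * x :: 'a::ring_1)))"
  unfolding sg_add by (cases "even m"; cases "even n") (simp_all add: sg_def algebra_simps)

lemma sg_commutator_mult_left: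
  "x * u * w - sg (m + n) * (w * (x * u)) =
    x * (u * w - sg n * (w * u)) + sg n * ((x * w - sg m * (w * x)) * (u :: 'a::ring_1))"
  unfolding sg_add by (cases "even m"; cases "even n") (simp_all add: sg_def algebra_simps)

lemma letter_word_commute:
  fixes d :: "'g \<Rightarrow> int"
  assumes "x \<in> G" "w \<in> lists G"
  shows "word [x] * word w - sg (d x * wdeg d w) * (word w * word [x]) \<in> (comm_ideal d G :: ('g, 'k::comm_ring_1) falg set)"
  using assms(2)
proof induction
  case (Cons y w)
  have "word [x] * word [y] - sg (d x * d y) * (word [y] * word [x]) \<in> (comm_ideal d G :: ('g, 'k::comm_ring_1) falg set)"
    using comm_ideal_rel[of "[]" G "[]" x y 1 d] Cons assms by simp
  then have 1: "(word [x] * word [y] - sg (d x * d y) * (word [y] * word [x])) * word w \<in> (comm_ideal d G :: ('g, 'k::comm_ring_1) falg set)"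
    by (rule comm_ideal_mult_right[rotated]) (use Cons in auto)
  have 2: "sg (d x * d y) * (word [y] * (word [x] * word w - sg (d x * wdeg d w) * (word w * word [x])))
       \<in> (comm_ideal d G :: ('g, 'k::comm_ring_1) falg set)"
    by (intro comm_ideal_sg comm_ideal_mult_left Cons.IH) (use Cons in auto)
  from comm_ideal_add[OF 1 2] have "word [x] * (word [y] * word w) -
      sg (d x * (d y + wdeg d w)) * (word [y] * word w * word [x]) \<in> (comm_ideal d G :: ('g, 'k) falg set)"
    unfolding sg_commutator_mult_right[symmetric] distrib_left .
  then show ?case by simp
qed (auto intro: comm_ideal.zero)

lemma word_word_commute:
  fixes d :: "'g \<Rightarrow> int"
  assumes "u \<in> lists G" "w \<in> lists G"
  shows "word u * word w - sg (wdeg d u * wdeg d w) * (word w * word u) \<in> (comm_ideal d G :: ('g, 'k::comm_ring_1) falg set)"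
  using assms(1)
proof induction
  case (Cons x u)
  have 1: "word [x] * (word u * word w - sg (wdeg d u * wdeg d w) * (word w * word u)) \<in> (comm_ideal d G :: ('g, 'k::comm_ring_1) falg set)"
    by (intro comm_ideal_mult_left Cons.IH) (use Cons in auto)
  have 2: "sg (wdeg d u * wdeg d w) * ((word [x] * word w - sg (d x * wdeg d w) * (word w * word [x])) * word u)
       \<in> (comm_ideal d G :: ('g, 'k::comm_ring_1) falg set)"
    by (intro comm_ideal_sg comm_ideal_mult_right letter_word_commute) (use Cons assms in auto)
  from comm_ideal_add[OF 1 2] have "word [x] * word u * word w -
      sg ((d x + wdeg d u) * wdeg d w) * (word w * (word [x] * word u)) \<in> (comm_ideal d G :: ('g, 'k) falg set)"
    unfolding sg_commutator_mult_left[symmetric] distrib_right .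
  then show ?case by simp
qed (auto intro: comm_ideal.zero)

lemma hom_commute:
  assumes s: "s \<in> supp_in (hwords d G m)" and t: "t \<in> supp_in (hwords d G n)"
  shows "s * t - sg (m * n) * (t * s) \<in> comm_ideal d G"
  using s
proof (induction s rule: supp_in_induct)
  case zero
  then show ?case by (auto intro: comm_ideal.zero)
next
  case (add s s')
  then show ?case using comm_ideal_add[OF add.IH] by (simp add: algebra_simps)
next
  case (single u a)
  show ?case using t
  proof (induction t rule: supp_in_induct)
    case zero
    then show ?case by (auto intro: comm_ideal.zero)
  next
    case (add s s')
    then show ?case using comm_ideal_add[OF add.IH] by (simp add: algebra_simps)
  next
    case (single w b)
    have "scal (a * b) (word u * word w - sg (wdeg d u * wdeg d w) * (word w * word u)) \<in> comm_ideal d G"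
      by (intro comm_ideal_scal word_word_commute)
         (use single \<open>u \<in> hwords d G m\<close> in \<open>auto simp: hwords_def\<close>)
    then show ?case using single \<open>u \<in> hwords d G m\<close>
      by (simp add: hwords_def scal_diff scal_sg_mult mult.commute)
  qed
qed

text \<open>The sign before the tail is the Koszul sign of an operator of odd degree. The
  differential, of degree -1, and the contraction of the pairs, of degree 1, are both of this
  kind.\<close>

primrec derw :: "('g \<Rightarrow> int) \<Rightarrow> ('g \<Rightarrow> ('g, 'k::comm_ring_1) falg) \<Rightarrow> 'g list \<Rightarrow> ('g, 'k) falg" where
  "derw d D [] = 0"
| "derw d D (l # u) = D l * word u + sg (d l) * (word [l] * derw d D u)"

definition der :: "('g \<Rightarrow> int) \<Rightarrow> ('g \<Rightarrow> ('g, 'k::comm_ring_1) falg) \<Rightarrow> ('g, 'k) falg \<Rightarrow> ('g, 'k) falg" where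
  "der d D = lin (derw d D)"

lemma der_zero [simp]: "der d D 0 = 0"
  and der_add: "der d D (s + t) = der d D s + der d D t"
  and der_diff: "der d D (s - t) = der d D s - der d D t"
  and der_scal: "der d D (scal c t) = scal c (der d D t)"
  and der_sg: "der d D (sg n * t) = sg n * der d D t"
  and der_single: "der d D (single u c) = scal c (derw d D u)"
  by (simp_all add: der_def lin_add lin_diff lin_scal lin_sg)

lemma der_word [simp]: "der d D (word u) = derw d D u"
  by (simp add: der_single)

lemma derw_append:
  "derw d D (u @ w) = derw d D u * word w + sg (wdeg d u) * (word u * derw d D w)"
proof (induction u)
  case (Cons l u)
  have "derw d D ((l # u) @ w) = D l * (word u * word w) +
    sg (d l) * (word [l] * (derw d D u * word w + sg (wdeg d u) * (word u * derw d D w)))"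
    using Cons.IH by simp
  also have "\<dots> = derw d D (l # u) * word w + sg (wdeg d (l # u)) * (word [l] * word u * derw d D w)"
    unfolding derw.simps wdeg_simps sg_add
    by (simp del: single_times_single add: sg_def ring_distribs mult.assoc)
  finally show ?case by simp
qed simp

lemma der_mult:
  assumes "s \<in> supp_in {u. wdeg d u = n}"
  shows "der d D (s * t) = der d D s * t + sg n * (s * der d D t)"
  using assms
proof (induction s rule: supp_in_induct)
  case (add s s')
  then show ?case by (simp add: der_add algebra_simps)
next
  case (single u a)
  have "t \<in> supp_in UNIV" by (simp add: supp_in_def)
  then show ?case
  proof (induction t rule: supp_in_induct)
    case (single w b)
    have eq: "single u a = scal a (word u)" "single w b = scal b (word w)"
      by simp_all
    have n: "wdeg d u = n" using \<open>u \<in> {u. wdeg d u = n}\<close> by simp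
    have "der d D (word u * word w) = derw d D u * word w + sg n * (word u * derw d D w)"
      by (simp add: derw_append n)
    then show ?case
      unfolding eq
      by (simp only: scal_mult_left scal_mult_right der_scal scal_scal der_word mult.commute[of b a] scal_add
          flip: scal_sg_mult)
  next
    case (add t t')
    then show ?case by (simp add: der_add algebra_simps)
  qed simp
qed simp

lemma der_mult':
  assumes "s \<in> supp_in (hwords d G n)"
  shows "der d D (s * t) = der d D s * t + sg n * (s * der d D t)"
  by (rule der_mult, rule supp_in_mono[OF assms]) (auto simp: hwords_def)

lemma der_letter_mult: "der d D (word [l] * t) = D l * t + sg (d l) * (word [l] * der d D t)"
  by (subst der_mult[where n = "d l"]) auto

locale letter_derivation =
  fixes d :: "'g \<Rightarrow> int" and G :: "'g set" and e :: int and D :: "'g \<Rightarrow> ('g, 'k::comm_ring_1) falg"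
  assumes odd_shift: "odd e"
    and shift: "l \<in> G \<Longrightarrow> D l \<in> supp_in (hwords d G (d l + e))"
begin

lemma derw_in: "u \<in> hwords d G n \<Longrightarrow> derw d D u \<in> supp_in (hwords d G (n + e))"
proof (induction u arbitrary: n)
  case (Cons l u)
  have "word u \<in> supp_in (hwords d G (n - d l))" "D l \<in> supp_in (hwords d G (d l + e))"
    "word [l] \<in> supp_in (hwords d G (d l))" "derw d D u \<in> supp_in (hwords d G (n - d l + e))"
    using Cons shift by (auto intro!: supp_in_single)
  then have "D l * word u \<in> supp_in (hwords d G (d l + e + (n - d l)))"
    "word [l] * derw d D u \<in> supp_in (hwords d G (d l + (n - d l + e)))"
    by (blast intro: supp_in_hwords_mult)+
  then show ?case by (auto simp: add.commute)
qed simp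

lemma der_in: "t \<in> supp_in (hwords d G n) \<Longrightarrow> der d D t \<in> supp_in (hwords d G (n + e))"
  unfolding der_def by (erule supp_in_lin) (rule derw_in)

lemma der_in_lists: "t \<in> supp_in (lists G) \<Longrightarrow> der d D t \<in> supp_in (lists G)"
  unfolding der_def
proof (erule supp_in_lin)
  fix u assume "u \<in> lists G"
  then have "u \<in> hwords d G (wdeg d u)" by (simp add: hwords_def)
  from derw_in[OF this] show "derw d D u \<in> supp_in (lists G)" by (rule supp_in_hwords_lists)
qed

text \<open>The Leibniz rule reduces the claim to the bare relation \<open>q\<close> between two
  letters, whose image is a combination of graded commutators of homogeneous elements.\<close>

lemma der_relation:
  assumes "u \<in> lists G" "w \<in> lists G" "x \<in> G" "y \<in> G"
  shows "der d D (word (u @ [x, y] @ w) - sg (d x * d y) * word (u @ [y, x] @ w)) \<in> comm_ideal d G"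
proof -
  define q where "q = word [x] * word [y] - sg (d x * d y) * (word [y] * word [x] :: ('g, 'k) falg)"
  have q: "q \<in> comm_ideal d G"
    using comm_ideal_rel[of "[]" G "[]" x y 1 d] assms by (simp add: q_def)
  have qh: "q \<in> supp_in {u. wdeg d u = d x + d y}"
    unfolding q_def by (auto intro!: supp_in_single supp_in_diff supp_in_sg)
  \<comment> \<open>The commutators of \<open>x\<close> with \<open>D y\<close> and of
    \<open>D x\<close> with \<open>y\<close>, signed so that their sum is \<open>der d D q\<close>;
    the signs agree because \<open>e\<close> is odd.\<close>
  have "sg (d x) * (word [x] * D y - sg (d x * (d y + e)) * (D y * word [x])) +
    (D x * word [y] - sg ((d x + e) * d y) * (word [y] * D x)) \<in> comm_ideal d G" (is "?r \<in> _")
    by (intro comm_ideal_add comm_ideal_sg hom_commute shift supp_in_single assms) (use assms in auto)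
  also have "?r = der d D q"
    unfolding q_def der_diff der_sg der_letter_mult
    using odd_shift by (auto simp: sg_def algebra_simps)
  finally have dq: "der d D q \<in> comm_ideal d G" .
  have "word (u @ [x, y] @ w) - sg (d x * d y) * word (u @ [y, x] @ w) = word u * (q * word w)"
    by (simp add: q_def ring_distribs sg_def)
  also have "der d D \<dots> = derw d D u * (q * word w) +
     sg (wdeg d u) * (word u * (der d D q * word w + sg (d x + d y) * (q * derw d D w)))"
    by (subst der_mult[where n = "wdeg d u"]) (auto simp: der_mult[OF qh])
  also have "\<dots> \<in> comm_ideal d G"
    by (intro comm_ideal_add comm_ideal_sg comm_ideal_mult_left comm_ideal_mult_right dq q)
       (use assms der_in_lists[of "word u"] der_in_lists[of "word w"] in auto)
  finally show ?thesis .
qed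

lemma der_comm_ideal: "t \<in> comm_ideal d G \<Longrightarrow> der d D t \<in> comm_ideal d G"
  by (erule comm_ideal_linear)
     (simp_all only: der_zero der_add der_scal comm_ideal_scal der_relation)

text \<open>The two words of a relation differ by a transposition, so they receive the same
  coefficient and the relation goes to a multiple of its image under the plain derivation. With
  \<open>K = ncone\<close> this permits dividing the contraction by the number of cone
  letters.\<close>

lemma weighted_der_comm_ideal:
  fixes K :: "'g list \<Rightarrow> nat" and a :: "nat \<Rightarrow> 'k"
  assumes K: "\<And>u w x y. K (u @ [x, y] @ w) = K (u @ [y, x] @ w)" and t: "t \<in> comm_ideal d G"
  shows "lin (\<lambda>u. scal (a (K u)) (derw d D u)) t \<in> comm_ideal d G" (is "lin ?f t \<in> _")
  using t
proof (rule comm_ideal_linear)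
  fix u w x y c assume *: "u \<in> lists G" "w \<in> lists G" "x \<in> G" "y \<in> G"
  let ?r = "word (u @ [x, y] @ w) - sg (d x * d y) * word (u @ [y, x] @ w)"
  have "lin ?f (scal c ?r) = scal c (scal (a (K (u @ [x, y] @ w))) (der d D ?r))"
    unfolding lin_scal lin_diff lin_sg der_diff der_sg using K
    by (simp add: scal_diff scal_sg_mult)
  also have "\<dots> \<in> comm_ideal d G"
    using * by (intro comm_ideal_scal der_relation)
  finally show "lin ?f (scal c ?r) \<in> comm_ideal d G" .
qed (auto simp: lin_add)

end

text \<open>For odd derivations the anticommutator is again a derivation, an even one.\<close>

lemma anticommutator_Cons:
  assumes 1: "letter_derivation d G e1 D1" and 2: "letter_derivation d G e2 D2" and l: "l \<in> G"
  shows "der d D1 (derw d D2 (l # u)) + der d D2 (derw d D1 (l # u)) =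
    (der d D1 (D2 l) + der d D2 (D1 l)) * word u +
    word [l] * (der d D1 (derw d D2 u) + der d D2 (derw d D1 u))"
proof -
  note [simp] = letter_derivation.odd_shift[OF 1] letter_derivation.odd_shift[OF 2]
  show ?thesis
    unfolding derw.simps der_add der_sg der_letter_mult
      der_mult'[OF letter_derivation.shift[OF 1 l]] der_mult'[OF letter_derivation.shift[OF 2 l]]
    by (auto simp: sg_def algebra_simps)
qed

text \<open>The square of an odd derivation is half its anticommutator with itself, and that
  anticommutator is an even derivation, so it lies in the ideal as soon as it does on letters. The
  half exists in characteristic zero.\<close>

lemma der_der_comm_ideal:
  fixes D :: "'g \<Rightarrow> ('g, 'k::field_char_0) falg"
  assumes D: "letter_derivation d G e D" and sq: "\<And>l. l \<in> G \<Longrightarrow> der d D (D l) \<in> comm_ideal d G"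
    and t: "t \<in> supp_in (lists G)"
  shows "der d D (der d D t) \<in> comm_ideal d G"
  using t
proof (induction t rule: supp_in_induct)
  case (single u c)
  have "der d D (derw d D u) + der d D (derw d D u) \<in> comm_ideal d G" if "u \<in> lists G" for u
    using that
  proof induction
    case (Cons l u)
    show ?case unfolding anticommutator_Cons[OF D D Cons.hyps(1)]
      by (intro comm_ideal_add comm_ideal_mult_left comm_ideal_mult_right sq Cons)
         (use Cons.hyps in \<open>auto intro!: supp_in_single Cons.IH\<close>)
  qed (auto intro: comm_ideal.zero)
  from this[OF single] have "scal (1/2) (der d D (derw d D u) + der d D (derw d D u)) \<in> comm_ideal d G"
    by (rule comm_ideal_scal)
  also have "scal (1/2) (der d D (derw d D u) + der d D (derw d D u)) = der d D (derw d D u)"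
    by (simp add: scal_add flip: scal_add_left)
  finally show ?case by (auto simp: der_single der_scal)
qed (auto simp: der_add)

text \<open>Deleting one occurrence of \<open>x\<close> is a left inverse of multiplication by
  \<open>x\<close>. For \<open>x\<close> of degree 0 it respects the commutation relations, so
  \<open>x\<close> is a non-zero-divisor modulo them; this avoids normal forms of words.\<close>

definition split_off :: "'g \<Rightarrow> ('g, 'k::comm_ring_1) falg \<Rightarrow> ('g, 'k) falg" where
  "split_off x = lin (\<lambda>u. if x \<in> set u then word (remove1 x u) else 0)"

lemma split_off_mult: "split_off x (word [x] * t) = t"
proof -
  have "t \<in> supp_in UNIV" by (simp add: supp_in_def)
  then show ?thesis
    by (induction t rule: supp_in_induct) (auto simp: split_off_def lin_add ring_distribs)
qed

text \<open>A relation goes to a relation or to 0. The delicate case is a relation that exchanges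
  the first \<open>x\<close> with its neighbour: both words become equal, and they cancel because
  \<open>d x = 0\<close> makes the sign between them 1.\<close>

lemma split_off_comm_ideal:
  assumes dx: "d x = 0" and t: "t \<in> comm_ideal d G"
  shows "split_off x t \<in> comm_ideal d G"
  using t
proof (rule comm_ideal_linear)
  fix u w y z and c :: 'b assume *: "u \<in> lists G" "w \<in> lists G" "y \<in> G" "z \<in> G"
  have rem: "remove1 x v \<in> lists G" if "v \<in> lists G" for v
    using that set_remove1_subset[of x v] by auto
  let ?r = "word (u @ [y, z] @ w) - sg (d y * d z) * word (u @ [z, y] @ w) :: ('a, 'b) falg"
  have "split_off x ?r \<in> comm_ideal d G"
  proof (cases "x \<in> set u")
    case True
    then show ?thesis
      using comm_ideal_rel[OF rem[OF *(1)] *(2-4), of 1 d]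
      by (simp add: split_off_def lin_diff lin_sg remove1_append)
  next
    case False
    show ?thesis
    proof (cases "x = y \<or> x = z")
      case True
      then show ?thesis using False dx
        by (auto simp: split_off_def lin_diff lin_sg remove1_append comm_ideal.zero)
    next
      case F: False
      show ?thesis
      proof (cases "x \<in> set w")
        case True
        then show ?thesis using False F
          using comm_ideal_rel[OF *(1) rem[OF *(2)] *(3,4), of 1 d]
          by (auto simp: split_off_def lin_diff lin_sg remove1_append)
      next
        case False
        then show ?thesis using \<open>x \<notin> set u\<close> F
          by (auto simp: split_off_def lin_diff lin_sg comm_ideal.zero)
      qed
    qed
  qed
  then show "split_off x (scal c ?r) \<in> comm_ideal d G"
    unfolding split_off_def lin_scal by (rule comm_ideal_scal)
qed (auto simp: split_off_def lin_add)

lemma split_off_move: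
  assumes dx: "d x = 0" and t: "t \<in> supp_in {u \<in> lists G. x \<in> set u}"
  shows "t - word [x] * split_off x t \<in> comm_ideal d G"
  using t
proof (induction t rule: supp_in_induct)
  case (single u c)
  then obtain v w where u: "u = v @ x # w" "x \<notin> set v" using split_list_first[of x u] by auto
  have G: "x \<in> G" "v \<in> lists G" "w \<in> lists G" using single u by auto
  have "(word [x] * word v - sg (d x * wdeg d v) * (word v * word [x])) * scal c (word w) \<in> comm_ideal d G"
    using G by (intro comm_ideal_mult_right letter_word_commute) auto
  from comm_ideal_minus[OF this] show ?case using u dx
    by (simp add: split_off_def remove1_append ring_distribs)
next
  case (add s t)
  from comm_ideal_add[OF add.IH] show ?case
    by (simp add: split_off_def lin_add algebra_simps)
qed (auto simp: split_off_def comm_ideal.zero)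

lemma split_off_cancel:
  assumes "d x = 0" "word [x] * t \<in> comm_ideal d G" shows "t \<in> comm_ideal d G"
  using split_off_comm_ideal[OF assms] by (simp add: split_off_mult)

section \<open>Algebras over the ground field and their gradings\<close>

text \<open>Common ground of \<open>P\<close>, whose multiplication commutes only up to sign, and of
  the Stanley-Reisner ring.\<close>

locale kalgebra = module "ring_of_type_algebra :: 'k::field ring" A + ring A
  for A :: "('k::field, 'p, 'z) module_scheme" (structure) +
  assumes smult_times_left:
      "\<lbrakk>x \<in> carrier A; y \<in> carrier A\<rbrakk> \<Longrightarrow> (c \<odot> x) \<otimes> y = c \<odot> (x \<otimes> y)"
    and smult_times_right:
      "\<lbrakk>x \<in> carrier A; y \<in> carrier A\<rbrakk> \<Longrightarrow> x \<otimes> (c \<odot> y) = c \<odot> (x \<otimes> y)"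

sublocale cdga \<subseteq> kalgebra P
  by unfold_locales (rule smult_mult_left smult_mult_right; assumption)+

lemma ring_of_type_algebra_sel [simp]:
  "carrier ring_of_type_algebra = UNIV"
  "x \<otimes>\<^bsub>ring_of_type_algebra\<^esub> y = x * y"
  "x \<oplus>\<^bsub>ring_of_type_algebra\<^esub> y = x + y"
  "\<one>\<^bsub>ring_of_type_algebra\<^esub> = 1" "\<zero>\<^bsub>ring_of_type_algebra\<^esub> = 0"
  by (simp_all add: ring_of_type_algebra_def)

definition wordval :: "('k::field, 'p, 'z) module_scheme \<Rightarrow> ('g \<Rightarrow> 'p) \<Rightarrow> 'g list \<Rightarrow> 'p" where
  "wordval A \<gamma> u = foldr (monoid.mult A) (map \<gamma> u) \<one>\<^bsub>A\<^esub>"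

text \<open>The algebra map from the free algebra that extends \<open>\<gamma>\<close>. It is used
  for formal letters, with \<open>\<gamma> = lval\<close>, and for the generators of
  \<open>P\<close> standing for themselves, with \<open>\<gamma> = incl\<close>.\<close>

definition ev :: "('k::field, 'p, 'z) module_scheme \<Rightarrow> ('g \<Rightarrow> 'p) \<Rightarrow> ('g, 'k) falg \<Rightarrow> 'p" where
  "ev A \<gamma> t = (\<Oplus>\<^bsub>A\<^esub>u\<in>keys t. lookup t u \<odot>\<^bsub>A\<^esub> wordval A \<gamma> u)"

text \<open>Uniqueness of homogeneous components without their existence, which is what the target
  of a graded map has to provide.\<close>

definition graded_indep :: "('k::field, 'p, 'z) module_scheme \<Rightarrow> ('i \<Rightarrow> 'p set) \<Rightarrow> bool" where
  "graded_indep A N \<longleftrightarrow>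
     (\<forall>i. submodule (N i) (ring_of_type_algebra :: 'k ring) A) \<and>
     (\<forall>J f. finite J \<longrightarrow> (\<forall>i\<in>J. f i \<in> N i) \<longrightarrow> (\<Oplus>\<^bsub>A\<^esub>i\<in>J. f i) = \<zero>\<^bsub>A\<^esub> \<longrightarrow> (\<forall>i\<in>J. f i = \<zero>\<^bsub>A\<^esub>))"

lemma supp_in_sum:
  "(\<And>i. i \<in> K \<Longrightarrow> f i \<in> supp_in A) \<Longrightarrow> sum f K \<in> supp_in A"
  by (induction K rule: infinite_finite_induct) (simp_all add: supp_in_add)

lemma poly_mapping_sum_singles:
  "(\<Sum>u\<in>keys t. single u (lookup t u)) = t"
  by (rule poly_mapping_eqI) (auto simp: lookup_sum lookup_single when_def in_keys_iff)

lemma supp_in_components: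
  assumes "t \<in> supp_in B"
  obtains J f where "finite J" "j \<in> J" "\<And>i. f i \<in> supp_in {u \<in> B. \<kappa> u = i}"
    "t = (\<Sum>i\<in>J. f i)"
proof (rule that)
  let ?f = "\<lambda>i. \<Sum>u\<in>{u \<in> keys t. \<kappa> u = i}. single u (lookup t u)"
  let ?J = "insert j (\<kappa> ` keys t)"
  show "finite ?J" "j \<in> ?J" by simp_all
  show "?f i \<in> supp_in {u \<in> B. \<kappa> u = i}" for i
  proof (rule supp_in_sum)
    fix u assume "u \<in> {u \<in> keys t. \<kappa> u = i}"
    with assms have "u \<in> {u \<in> B. \<kappa> u = i}" by (auto simp: supp_in_def)
    then show "single u (lookup t u) \<in> supp_in {u \<in> B. \<kappa> u = i}"
      by (rule supp_in_single)
  qed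
  have "(\<Sum>i\<in>?J. ?f i) = t"
    by (subst sum.group) (auto simp: poly_mapping_sum_singles)
  then show "t = (\<Sum>i\<in>?J. ?f i)" by (rule sym)
qed

context kalgebra
begin

lemma k_closed [simp, intro]: "x \<in> carrier A \<Longrightarrow> c \<odot> x \<in> carrier A"
  by (rule smult_closed) simp_all

lemma k_add_left: "x \<in> carrier A \<Longrightarrow> (a + b) \<odot> x = a \<odot> x \<oplus> b \<odot> x"
  using smult_l_distr[of a b x] by simp

lemma k_add_right: "x \<in> carrier A \<Longrightarrow> y \<in> carrier A \<Longrightarrow> a \<odot> (x \<oplus> y) = a \<odot> x \<oplus> a \<odot> y"
  using smult_r_distr[of a x y] by simp

lemma k_assoc: "x \<in> carrier A \<Longrightarrow> a \<odot> (b \<odot> x) = (a * b) \<odot> x"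
  using smult_assoc1[of a b x] by simp

lemma k_one [simp]: "x \<in> carrier A \<Longrightarrow> 1 \<odot> x = x"
  using smult_one[of x] by simp

lemma k_zero_left [simp]: "x \<in> carrier A \<Longrightarrow> 0 \<odot> x = \<zero>"
  using smult_l_null[of x] by simp

lemma k_zero_right [simp]: "c \<odot> \<zero> = \<zero>"
  using smult_r_null[of c] by simp

lemma k_uminus: "x \<in> carrier A \<Longrightarrow> (- 1) \<odot> x = \<ominus> x"
proof -
  assume x: "x \<in> carrier A"
  have "x \<oplus> (- 1) \<odot> x = \<zero>" using k_add_left[OF x, of 1 "- 1"] x by simp
  then show ?thesis using x by (metis add.inv_equality k_closed a_comm)
qed

lemma submoduleD:
  assumes "submodule H (ring_of_type_algebra :: 'k ring) A"
  shows "H \<subseteq> carrier A" "\<zero> \<in> H" "x \<in> H \<Longrightarrow> y \<in> H \<Longrightarrow> x \<oplus> y \<in> H"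
    "x \<in> H \<Longrightarrow> c \<odot> x \<in> H" "x \<in> H \<Longrightarrow> \<ominus> x \<in> H" "x \<in> H \<Longrightarrow> x \<in> carrier A"
proof -
  show "H \<subseteq> carrier A" "x \<in> H \<Longrightarrow> x \<in> carrier A" using submoduleE(1)[OF assms] by auto
  show "x \<in> H \<Longrightarrow> y \<in> H \<Longrightarrow> x \<oplus> y \<in> H" using submoduleE(5)[OF assms] by blast
  show smul: "x \<in> H \<Longrightarrow> c \<odot> x \<in> H" for c x using submoduleE(4)[OF assms] by simp
  show "x \<in> H \<Longrightarrow> \<ominus> x \<in> H" using submoduleE(3)[OF assms] by blast
  obtain y where "y \<in> H" using submoduleE(2)[OF assms] by blast
  then show "\<zero> \<in> H" using smul[of y 0] submoduleE(1)[OF assms] by auto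
qed

lemma wordval_Nil [simp]: "wordval A \<gamma> [] = \<one>"
  and wordval_Cons [simp]: "wordval A \<gamma> (l # u) = \<gamma> l \<otimes> wordval A \<gamma> u"
  by (simp_all add: wordval_def)

lemma wordval_closed [simp]:
  assumes "\<gamma> \<in> G \<rightarrow> carrier A" "u \<in> lists G" shows "wordval A \<gamma> u \<in> carrier A"
  using assms(2) by induction (use assms(1) in auto)

lemma wordval_append:
  assumes "\<gamma> \<in> G \<rightarrow> carrier A" "u \<in> lists G" "w \<in> lists G"
  shows "wordval A \<gamma> (u @ w) = wordval A \<gamma> u \<otimes> wordval A \<gamma> w"
  using assms(2)
proof induction
  case (Cons l u)
  then have "\<gamma> l \<in> carrier A" using assms(1) by auto
  then show ?case using Cons assms(1,3) by (simp add: m_assoc)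
qed (use assms in simp)

lemma ev_zero [simp]: "ev A \<gamma> 0 = \<zero>"
  by (simp add: ev_def)

lemma ev_single:
  assumes "wordval A \<gamma> u \<in> carrier A"
  shows "ev A \<gamma> (single u c) = c \<odot> wordval A \<gamma> u"
  using assms by (cases "c = 0") (auto simp: ev_def)

context
  fixes \<gamma> :: "'g \<Rightarrow> 'p" and G :: "'g set"
  assumes \<gamma>: "\<gamma> \<in> G \<rightarrow> carrier A"
begin

lemma ev_superset:
  assumes "finite B" "keys t \<subseteq> B" "B \<subseteq> lists G"
  shows "ev A \<gamma> t = (\<Oplus>u\<in>B. lookup t u \<odot> wordval A \<gamma> u)"
  unfolding ev_def using assms \<gamma>
  by (intro add.finprod_mono_neutral_cong_left) (auto simp: in_keys_iff subset_iff)

lemma ev_closed [simp, intro]: "t \<in> supp_in (lists G) \<Longrightarrow> ev A \<gamma> t \<in> carrier A"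
  unfolding ev_def supp_in_def using wordval_closed[OF \<gamma>] by (intro finsum_closed) blast

lemma ev_add:
  assumes "s \<in> supp_in (lists G)" "t \<in> supp_in (lists G)"
  shows "ev A \<gamma> (s + t) = ev A \<gamma> s \<oplus> ev A \<gamma> t"
proof -
  let ?B = "keys s \<union> keys t"
  have B: "?B \<subseteq> lists G" using assms by (auto simp: supp_in_def)
  have cl: "wordval A \<gamma> u \<in> carrier A" if "u \<in> ?B" for u
    using that B wordval_closed[OF \<gamma>] by blast
  have "ev A \<gamma> (s + t) = (\<Oplus>u\<in>?B. lookup (s + t) u \<odot> wordval A \<gamma> u)"
    by (rule ev_superset[OF _ _ B]) (auto dest: keys_add[THEN subsetD])
  also have "\<dots> = (\<Oplus>u\<in>?B. lookup s u \<odot> wordval A \<gamma> u \<oplus> lookup t u \<odot> wordval A \<gamma> u)"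
    by (rule finsum_cong') (use cl in \<open>auto simp: lookup_add k_add_left\<close>)
  also have "\<dots> = (\<Oplus>u\<in>?B. lookup s u \<odot> wordval A \<gamma> u) \<oplus>
      (\<Oplus>u\<in>?B. lookup t u \<odot> wordval A \<gamma> u)"
    by (rule finsum_addf) (use cl in auto)
  also have "\<dots> = ev A \<gamma> s \<oplus> ev A \<gamma> t"
    by (subst (1 2) ev_superset[OF _ _ B]) auto
  finally show ?thesis .
qed

lemma ev_single' [simp]:
  "u \<in> lists G \<Longrightarrow> ev A \<gamma> (single u c) = c \<odot> wordval A \<gamma> u"
  using \<gamma> by (intro ev_single) simp

lemma ev_scal:
  assumes "t \<in> supp_in (lists G)" shows "ev A \<gamma> (scal c t) = c \<odot> ev A \<gamma> t"
  using assms
proof (induction t rule: supp_in_induct)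
  case (single u a)
  then show ?case using \<gamma> by (simp add: k_assoc)
next
  case (add s t)
  then show ?case by (simp add: scal_add ev_add supp_in_scal k_add_right)
qed simp

lemma ev_minus:
  assumes "t \<in> supp_in (lists G)" shows "ev A \<gamma> (- t) = \<ominus> ev A \<gamma> t"
proof -
  have "- t = scal (- 1) t" by (simp add: scal_def single_uminus)
  then show ?thesis using ev_scal[OF assms, of "- 1"] ev_closed[OF assms] by (simp add: k_uminus)
qed

lemma ev_diff:
  assumes "s \<in> supp_in (lists G)" "t \<in> supp_in (lists G)"
  shows "ev A \<gamma> (s - t) = ev A \<gamma> s \<ominus> ev A \<gamma> t"
  using ev_add[OF assms(1) supp_in_minus[OF assms(2)]] ev_minus[OF assms(2)]
  by (simp add: a_minus_def)

lemma ev_sg: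
  assumes "t \<in> supp_in (lists G)" shows "ev A \<gamma> (sg n * t) = sg n \<odot> ev A \<gamma> t"
  using ev_scal[OF assms, of "sg n"] by (simp add: scal_sg)

lemma ev_mult:
  assumes "s \<in> supp_in (lists G)" "t \<in> supp_in (lists G)"
  shows "ev A \<gamma> (s * t) = ev A \<gamma> s \<otimes> ev A \<gamma> t"
  using assms(1)
proof (induction s rule: supp_in_induct)
  case zero
  show ?case using assms(2) by simp
next
  case (add s s')
  then show ?case using assms(2)
    by (simp add: ring_distribs ev_add supp_in_lists_mult l_distr)
next
  case (single u a)
  show ?case using assms(2)
  proof (induction t rule: supp_in_induct)
    case zero
    show ?case using single \<gamma> by simp
  next
    case (add s s')
    then show ?case using single \<gamma>
      by (simp add: ring_distribs ev_add supp_in_lists_mult r_distr supp_in_single del: single_times_single)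
  next
    case (single w b)
    then show ?case using \<open>u \<in> lists G\<close> \<gamma> wordval_append[OF \<gamma>, of u w]
      by (simp add: smult_times_left smult_times_right k_assoc mult.commute[of a b])
  qed
qed

end

section \<open>Extraction of homogeneous components\<close>

lemma finsum_minus:
  assumes "finite J" "f \<in> J \<rightarrow> carrier A" "g \<in> J \<rightarrow> carrier A"
  shows "(\<Oplus>i\<in>J. f i \<ominus> g i) = (\<Oplus>i\<in>J. f i) \<ominus> (\<Oplus>i\<in>J. g i)"
  using assms
proof (induction J rule: finite_induct)
  case (insert j J)
  have j: "f j \<in> carrier A" "g j \<in> carrier A" and J: "f \<in> J \<rightarrow> carrier A" "g \<in> J \<rightarrow> carrier A"
    using insert.prems by auto
  have "(\<lambda>i. f i \<ominus> g i) \<in> J \<rightarrow> carrier A" using J by auto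
  moreover have "finsum A f J \<in> carrier A" "finsum A g J \<in> carrier A" using J by auto
  ultimately show ?case using insert J j
    by (simp add: a_minus_def minus_add a_ac)
qed (simp add: a_minus_def)

lemma graded_indepD:
  assumes "graded_indep A N"
  shows "submodule (N i) (ring_of_type_algebra :: 'k ring) A"
    and "finite J \<Longrightarrow> (\<And>i. i \<in> J \<Longrightarrow> f i \<in> N i) \<Longrightarrow> (\<Oplus>i\<in>J. f i) = \<zero> \<Longrightarrow> i \<in> J \<Longrightarrow> f i = \<zero>"
  using assms unfolding graded_indep_def by simp_all

text \<open>The index map \<open>\<tau>\<close> lets the summands come from the grading of another
  algebra, for instance with degrees shifted by a differential.\<close>

lemma graded_indep_component:
  assumes N: "graded_indep A N" and J: "finite J" and \<tau>: "inj_on \<tau> J"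
    and f: "\<And>i. i \<in> J \<Longrightarrow> f i \<in> N (\<tau> i)" and j: "j \<in> J" and y: "y \<in> N (\<tau> j)"
    and sum: "(\<Oplus>i\<in>J. f i) = y"
  shows "f j = y"
proof -
  have sub: "submodule (N i) (ring_of_type_algebra :: 'k ring) A" for i
    using N by (simp add: graded_indep_def)
  note D = submoduleD[OF sub]
  \<comment> \<open>Subtracting \<open>y\<close> from the summand at \<open>j\<close> makes the
    total zero, so independence forces every \<open>g i\<close> to vanish.\<close>
  define g where "g = (\<lambda>i. f i \<ominus> (if j = i then y else \<zero>))"
  have fc: "f \<in> J \<rightarrow> carrier A" and yc: "y \<in> carrier A"
    using f y D(6) by blast+
  have gN: "g i \<in> N (\<tau> i)" if "i \<in> J" for i
    unfolding g_def a_minus_def using f[OF that] y D by auto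
  have gc: "g i \<in> carrier A" if "i \<in> J" for i
    using D(6)[OF gN[OF that]] .
  have "(\<Oplus>i\<in>J. g i) = (\<Oplus>i\<in>J. f i) \<ominus> (\<Oplus>i\<in>J. if j = i then y else \<zero>)"
    unfolding g_def using J fc yc by (intro finsum_minus) auto
  also have "(\<Oplus>i\<in>J. if j = i then y else \<zero>) = y"
    using finsum_singleton[of j J "\<lambda>_. y"] j J yc by simp
  finally have "(\<Oplus>i\<in>J. g i) = \<zero>" using sum yc by simp
  also have "(\<Oplus>i\<in>J. g i) = (\<Oplus>i\<in>\<tau> ` J. g (the_inv_into J \<tau> i))"
  proof (subst finsum_reindex[OF _ \<tau>])
    show "(\<lambda>i. g (the_inv_into J \<tau> i)) \<in> \<tau> ` J \<rightarrow> carrier A"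
      using gc the_inv_into_f_f[OF \<tau>] by auto
    show "finsum A g J = (\<Oplus>x\<in>J. g (the_inv_into J \<tau> (\<tau> x)))"
      by (rule finsum_cong') (use gc the_inv_into_f_f[OF \<tau>] in auto)
  qed
  finally have 0: "(\<Oplus>i\<in>\<tau> ` J. g (the_inv_into J \<tau> i)) = \<zero>" .
  have fin: "finite (\<tau> ` J)" using J by simp
  have m: "\<forall>i\<in>\<tau> ` J. g (the_inv_into J \<tau> i) \<in> N i"
    using gN the_inv_into_f_f[OF \<tau>] by auto
  have "g (the_inv_into J \<tau> (\<tau> j)) = \<zero>"
    by (rule graded_indepD(2)[OF N fin _ 0]) (use m j in auto)
  then have "g j = \<zero>" using j the_inv_into_f_f[OF \<tau>] by auto
  moreover have "f j \<in> carrier A" using fc j by auto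
  ultimately show ?thesis using yc by (simp add: g_def)
qed

lemma direct_sum_decomposition_indep:
  assumes "direct_sum_decomposition A N" shows "graded_indep A N"
  unfolding graded_indep_def
proof (intro conjI allI impI ballI)
  show sub: "submodule (N i) (ring_of_type_algebra :: 'k ring) A" for i
    using assms by (simp add: direct_sum_decomposition_def)
  fix J f i
  assume J: "finite J" and f: "\<forall>i\<in>J. f i \<in> N i" and 0: "(\<Oplus>i\<in>J. f i) = \<zero>" and i: "i \<in> J"
  define g where "g = (\<lambda>i. if i \<in> J then f i else \<zero>)"
  let ?Q = "\<lambda>h. (\<forall>i. h i \<in> N i) \<and> finite {i. h i \<noteq> \<zero>} \<and> \<zero> = (\<Oplus>i\<in>{i. h i \<noteq> \<zero>}. h i)"
  have "(\<Oplus>i\<in>{i. g i \<noteq> \<zero>}. g i) = (\<Oplus>i\<in>J. f i)"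
    using J f submoduleD(6)[OF sub]
    by (intro add.finprod_mono_neutral_cong_left) (auto simp: g_def)
  moreover have "finite {i. g i \<noteq> \<zero>}"
    by (rule finite_subset[OF _ J]) (auto simp: g_def)
  ultimately have Qg: "?Q g" using f 0 submoduleD(2)[OF sub] by (auto simp: g_def)
  have Q0: "?Q (\<lambda>_. \<zero>)" using submoduleD(2)[OF sub] by auto
  have "\<exists>!h. ?Q h"
    using assms[unfolded direct_sum_decomposition_def, THEN conjunct2, THEN bspec, OF zero_closed] .
  from trans[OF the1_equality[where P = ?Q, OF this Qg, symmetric] the1_equality[where P = ?Q, OF this Q0]]
  have "g = (\<lambda>_. \<zero>)" .
  then have "g i = \<zero>" by simp
  then show "f i = \<zero>" using i by (simp add: g_def)
qed

lemma direct_sum_decomposition_obtain: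
  assumes "direct_sum_decomposition A N" "x \<in> carrier A"
  obtains J f where "finite J" "\<And>i. f i \<in> N i" "x = (\<Oplus>i\<in>J. f i)" "j \<in> J"
proof -
  obtain f where f: "\<And>i. f i \<in> N i" "finite {i. f i \<noteq> \<zero>}" "x = (\<Oplus>i\<in>{i. f i \<noteq> \<zero>}. f i)"
    using ex1_implies_ex[OF assms(1)[unfolded direct_sum_decomposition_def, THEN conjunct2, THEN bspec, OF assms(2)]]
    by (elim exE conjE) (rule that; simp)
  have sub: "submodule (N i) (ring_of_type_algebra :: 'k ring) A" for i
    using assms by (simp add: direct_sum_decomposition_def)
  have "x = (\<Oplus>i\<in>insert j {i. f i \<noteq> \<zero>}. f i)"
    unfolding f(3) using f submoduleD(6)[OF sub]
    by (intro add.finprod_mono_neutral_cong_left) auto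
  then show thesis
    by (rule that[of "insert j {i. f i \<noteq> \<zero>}" f, rotated 2]) (use f(1,2) in auto)
qed

lemma graded_indep_disjoint:
  assumes N: "graded_indep A N" and x: "x \<in> N i" "x \<in> N j" "i \<noteq> j" shows "x = \<zero>"
proof -
  have sub: "submodule (N i) (ring_of_type_algebra :: 'k ring) A" for i
    using N by (simp add: graded_indep_def)
  have xc: "x \<in> carrier A" using submoduleD(6)[OF sub x(1)] .
  have "(\<Oplus>k\<in>{i, j}. if i = k then x else \<zero>) = x"
    by (rule finsum_singleton) (simp_all add: xc)
  then have "(if i = j then x else \<zero>) = x"
  proof (rule graded_indep_component[OF N, where J = "{i, j}" and \<tau> = "\<lambda>x. x" and j = j, rotated -1])
    show "(if i = k then x else \<zero>) \<in> N k" for k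
      using submoduleD(2)[OF sub, of k] x(1) by (cases "i = k") simp_all
  qed (simp_all add: x(2))
  then show ?thesis using x(3) by simp
qed

lemma linear_finsum:
  assumes B: "kalgebra (B :: ('k, 'q, 'y) module_scheme)" and J: "finite J"
    and f: "f \<in> J \<rightarrow> carrier A" and F: "F \<in> carrier A \<rightarrow> carrier B"
    and add: "\<And>x y. x \<in> carrier A \<Longrightarrow> y \<in> carrier A \<Longrightarrow> F (x \<oplus> y) = F x \<oplus>\<^bsub>B\<^esub> F y"
    and zero: "F \<zero> = \<zero>\<^bsub>B\<^esub>"
  shows "F (\<Oplus>i\<in>J. f i) = (\<Oplus>\<^bsub>B\<^esub>i\<in>J. F (f i))"
proof -
  interpret B: kalgebra B by (rule B)
  show ?thesis using J f
  proof (induction J rule: finite_induct)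
    case (insert j J)
    then have "f j \<in> carrier A" "f \<in> J \<rightarrow> carrier A" by auto
    moreover have "(\<lambda>i. F (f i)) \<in> J \<rightarrow> carrier B" "F (f j) \<in> carrier B"
      using calculation F by auto
    ultimately show ?case using insert by (simp add: add)
  qed (simp add: zero)
qed

text \<open>The components of \<open>x\<close> at indices other than \<open>j\<close> go to 0 or to
  components other than \<open>\<tau> j\<close>, so the component at \<open>j\<close> alone has the
  image \<open>F x\<close>. Thus preimages of homogeneous elements can be chosen homogeneous, for
  the boundary as well as for \<open>\<epsilon>\<close>.\<close>

lemma linear_component:
  assumes B: "kalgebra (B :: ('k, 'q, 'y) module_scheme)"
    and N: "direct_sum_decomposition A N" and M: "graded_indep B M"
    and F: "F \<in> carrier A \<rightarrow> carrier B"
    and add: "\<And>x y. x \<in> carrier A \<Longrightarrow> y \<in> carrier A \<Longrightarrow> F (x \<oplus> y) = F x \<oplus>\<^bsub>B\<^esub> F y"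
    and \<tau>: "inj_on \<tau> I"
    and FI: "\<And>i y. i \<in> I \<Longrightarrow> y \<in> N i \<Longrightarrow> F y \<in> M (\<tau> i)"
    and F0: "\<And>i y. i \<notin> I \<Longrightarrow> y \<in> N i \<Longrightarrow> F y = \<zero>\<^bsub>B\<^esub>"
    and x: "x \<in> carrier A" "F x \<in> M (\<tau> j)" and j: "j \<in> I"
  shows "\<exists>x'\<in>N j. F x' = F x"
proof -
  interpret B: kalgebra B by (rule B)
  have sub: "submodule (N i) (ring_of_type_algebra :: 'k ring) A" for i
    using N by (simp add: direct_sum_decomposition_def)
  have zero: "F \<zero> = \<zero>\<^bsub>B\<^esub>"
  proof -
    have c: "F \<zero> \<in> carrier B" by (rule funcset_mem[OF F zero_closed])
    have "F \<zero> \<oplus>\<^bsub>B\<^esub> F \<zero> = F \<zero>" 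
      unfolding add[OF zero_closed zero_closed, symmetric] by (simp only: r_zero[OF zero_closed])
    then show ?thesis using B.add.r_cancel_one[OF c c] by (simp only:)
  qed
  obtain J f where J: "finite J" and f: "\<And>i. f i \<in> N i" and xs: "x = (\<Oplus>i\<in>J. f i)" and jJ: "j \<in> J"
    by (rule direct_sum_decomposition_obtain[OF N x(1), where j = j]) (rule that)
  have fc: "f i \<in> carrier A" for i by (rule submoduleD(6)[OF sub f])
  have "F x = (\<Oplus>\<^bsub>B\<^esub>i\<in>J. F (f i))"
    unfolding xs by (rule linear_finsum[OF B J _ F add zero]) (simp_all add: fc)
  also have "\<dots> = (\<Oplus>\<^bsub>B\<^esub>i\<in>J \<inter> I. F (f i))"
  proof (rule B.add.finprod_mono_neutral_cong_right)
    show "(\<lambda>i. F (f i)) \<in> J \<rightarrow> carrier B" using funcset_mem[OF F fc] by blast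
    show "F (f i) = \<zero>\<^bsub>B\<^esub>" if "i \<in> J - J \<inter> I" for i using that by (intro F0[OF _ f]) blast
  qed (use J in simp_all)
  finally have "(\<Oplus>\<^bsub>B\<^esub>i\<in>J \<inter> I. F (f i)) = F x" by (rule sym)
  then have "F (f j) = F x"
  proof (rule B.graded_indep_component[where N = M and \<tau> = \<tau> and J = "J \<inter> I" and j = j and f = "\<lambda>i. F (f i)", OF M, rotated -1])
    show "inj_on \<tau> (J \<inter> I)" by (rule inj_on_subset[OF \<tau>]) simp
    show "F (f i) \<in> M (\<tau> i)" if "i \<in> J \<inter> I" for i using that by (intro FI f) blast
    show "finite (J \<inter> I)" "j \<in> J \<inter> I" using J jJ j by blast+
  qed (rule x(2))
  then show ?thesis using f[of j] by (rule bexI)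
qed

text \<open>Words with another value of \<open>\<kappa>\<close> evaluate into other components, so
  discarding them does not change a homogeneous value.\<close>

lemma ev_component:
  assumes \<gamma>: "\<gamma> \<in> G \<rightarrow> carrier A" and N: "graded_indep A N" and B: "B \<subseteq> lists G"
    and \<kappa>: "\<And>u. u \<in> B \<Longrightarrow> wordval A \<gamma> u \<in> N (\<kappa> u)"
    and t: "t \<in> supp_in B" "ev A \<gamma> t \<in> N j"
  shows "\<exists>t'\<in>supp_in {u \<in> B. \<kappa> u = j}. ev A \<gamma> t' = ev A \<gamma> t"
proof -
  have sub: "submodule (N i) (ring_of_type_algebra :: 'k ring) A" for i
    using N by (simp add: graded_indep_def)
  obtain J f where J: "finite J" "j \<in> J"
    and f: "\<And>i. f i \<in> supp_in {u \<in> B. \<kappa> u = i}" and ts: "t = (\<Sum>i\<in>J. f i)"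
    by (rule supp_in_components[OF t(1), of j \<kappa>]) (rule that)
  have fG: "f i \<in> supp_in (lists G)" if "i \<in> J" for i
    by (rule supp_in_mono[OF f]) (use B in auto)
  have evc: "ev A \<gamma> (f i) \<in> carrier A" if "i \<in> J" for i
    using fG[OF that] by (rule ev_closed[OF \<gamma>])
  have evf: "ev A \<gamma> (\<Sum>i\<in>K. f i) = (\<Oplus>i\<in>K. ev A \<gamma> (f i))" if "finite K" "K \<subseteq> J" for K
    using that
  proof (induction K rule: finite_induct)
    case (insert i K)
    have K: "(\<Sum>i\<in>K. f i) \<in> supp_in (lists G)"
      using insert(1,4) by (induction K rule: finite_induct) (simp_all add: fG supp_in_add)
    have "(\<lambda>i. ev A \<gamma> (f i)) \<in> K \<rightarrow> carrier A" "ev A \<gamma> (f i) \<in> carrier A" "f i \<in> supp_in (lists G)"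
      using insert(4) evc fG by blast+
    then show ?case using insert(1-4) K by (simp add: ev_add[OF \<gamma>])
  qed simp
  have evN: "ev A \<gamma> s \<in> N i" if "s \<in> supp_in {u \<in> B. \<kappa> u = i}" for s i
    using that
  proof (induction s rule: supp_in_induct)
    case (single u c)
    then have "u \<in> lists G" "wordval A \<gamma> u \<in> N i" using \<kappa>[of u] B by blast+
    then show ?case by (simp only: ev_single'[OF \<gamma>] submoduleD(4)[OF sub])
  next
    case (add s t)
    have "{u \<in> B. \<kappa> u = i} \<subseteq> lists G" using B by auto
    from supp_in_mono[OF add(1) this] supp_in_mono[OF add(2) this] add(3,4) show ?case
      by (simp only: ev_add[OF \<gamma>] submoduleD(3)[OF sub])
  qed (simp add: submoduleD(2)[OF sub])
  have "ev A \<gamma> (f j) = ev A \<gamma> t"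
    by (rule graded_indep_component[where N = N and \<tau> = "\<lambda>i. i" and j = j and f = "\<lambda>i. ev A \<gamma> (f i)",
          OF N J(1) _ _ J(2) t(2)])
       (simp_all only: ts evf[OF J(1) order.refl] evN[OF f] inj_on_id2)
  then show ?thesis using f[of j] by (intro bexI)
qed

end

context cdga
begin

lemmas hpartD = submoduleD[OF conjunct1[OF degree_decomposition[unfolded direct_sum_decomposition_def], THEN spec]]

lemma bdry_of_degree_0:
  assumes "x \<in> hpart P 0" shows "bdry P x = \<zero>"
  using bdry_degree[OF assms] degree_neg[of "- 1"] by simp

lemma bdry_zero: "bdry P \<zero> = \<zero>"
  by (rule bdry_of_degree_0[OF hpartD(2)])

end

section \<open>A partial Tate resolution with contractible pairs\<close>

text \<open>\<open>Kill n w L p\<close> is a generator of degree \<open>n\<close> and weight \<open>w\<close> that is sent to \<open>p\<close> in the given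
  resolution and whose boundary is the linear combination of words listed in \<open>L\<close>. Storing the boundary
  in the letter turns the successive adjunction of generators into a single datatype.\<close>

datatype ('v, 'k, 'p) letter =
    Var 'v
  | Kill int "'v \<Rightarrow> int" "('k \<times> ('v, 'k, 'p) letter list) list" 'p
  | Cone int "'v \<Rightarrow> int" 'p
  | Base int "'v \<Rightarrow> int" 'p

primrec core :: "('v, 'k, 'p) letter \<Rightarrow> bool" where
  "core (Var u) = True"
| "core (Kill n w L p) = True"
| "core (Cone n w p) = False"
| "core (Base n w p) = False"

text \<open>\<open>Base n w p\<close> is labelled with the degree of its partner
  \<open>Cone n w p\<close>, whose boundary it is; its own degree is therefore one less.\<close>

primrec ldeg :: "('v, 'k, 'p) letter \<Rightarrow> int" where
  "ldeg (Var u) = 0"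
| "ldeg (Kill n w L p) = n"
| "ldeg (Cone n w p) = n"
| "ldeg (Base n w p) = n - 1"

primrec lwt :: "('v, 'k, 'p) letter \<Rightarrow> 'v \<Rightarrow> int" where
  "lwt (Var u) = (\<lambda>v. if v = u then 1 else 0)"
| "lwt (Kill n w L p) = w"
| "lwt (Cone n w p) = w"
| "lwt (Base n w p) = w"

text \<open>Letters store polynomials as lists of coefficients and words because the datatype
  recursion passes through lists. Several lists may name one polynomial, which merely yields more
  letters.\<close>

definition listpoly :: "('k \<times> 'g list) list \<Rightarrow> ('g, 'k::comm_ring_1) falg" where
  "listpoly L = sum_list (map (\<lambda>q. single (snd q) (fst q)) L)"

type_synonym ('v, 'k, 'p) lalg = "(('v, 'k, 'p) letter, 'k) falg"

primrec lbd :: "('v, 'k, 'p) letter \<Rightarrow> ('v, 'k::comm_ring_1, 'p) lalg" where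
  "lbd (Var u) = 0"
| "lbd (Kill n w L p) = listpoly L"
| "lbd (Cone n w p) = word [Base n w p]"
| "lbd (Base n w p) = 0"

text \<open>Inverts the boundary inside each pair and is zero on core letters. Extended as an odd
  derivation it contracts the pairs up to a counting factor.\<close>

primrec lcone :: "('v, 'k, 'p) letter \<Rightarrow> ('v, 'k::comm_ring_1, 'p) lalg" where
  "lcone (Var u) = 0"
| "lcone (Kill n w L p) = 0"
| "lcone (Cone n w p) = 0"
| "lcone (Base n w p) = word [Cone n w p]"

lemma listpoly_exists:
  assumes "t \<in> supp_in A"
  obtains L where "listpoly L = t" "\<And>q. q \<in> set L \<Longrightarrow> snd q \<in> A"
proof -
  have "\<exists>L. listpoly L = t \<and> (\<forall>q\<in>set L. snd q \<in> A)"
    using assms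
  proof (induction t rule: supp_in_induct)
    case zero
    show ?case by (rule exI[of _ "[]"]) (simp add: listpoly_def)
  next
    case (single u c)
    then show ?case by (intro exI[of _ "[(c, u)]"]) (simp add: listpoly_def)
  next
    case (add s t)
    then obtain L L' where "listpoly L = s" "\<forall>q\<in>set L. snd q \<in> A" "listpoly L' = t" "\<forall>q\<in>set L'. snd q \<in> A"
      by blast
    then show ?case by (intro exI[of _ "L @ L'"]) (auto simp: listpoly_def)
  qed
  then show thesis using that by blast
qed

lemma listpoly_in:
  assumes "\<And>q. q \<in> set L \<Longrightarrow> snd q \<in> A" shows "listpoly L \<in> supp_in A"
  using assms unfolding listpoly_def
  by (induction L) (auto intro!: supp_in_add supp_in_single)

lemma comm_ideal_Collect_mono [mono]:
  "(\<And>l. A l \<longrightarrow> B l) \<Longrightarrow> t \<in> comm_ideal d (Collect A) \<longrightarrow> t \<in> comm_ideal d (Collect B)"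
  using comm_ideal_mono[of "Collect A" "Collect B" d] by auto

definition bwords :: "('v, 'k, 'p) letter set \<Rightarrow> int \<Rightarrow> ('v \<Rightarrow> int) \<Rightarrow> ('v, 'k, 'p) letter list set" where
  "bwords G n w = {u \<in> lists G. wdeg ldeg u = n \<and> (\<forall>v. wdeg (\<lambda>l. lwt l v) u = w v)}"

lemma bwords_hwords: "bwords G n w \<subseteq> hwords ldeg G n"
  by (auto simp: bwords_def hwords_def)

lemma bwords_lists: "bwords G n w \<subseteq> lists G"
  by (auto simp: bwords_def)

lemma bwords_mono: "G \<subseteq> G' \<Longrightarrow> bwords G n w \<subseteq> bwords G' n w"
  using lists_mono[of G G'] by (auto simp: bwords_def)

lemmas supp_in_bwords_lists = supp_in_mono[OF _ bwords_lists]
lemmas supp_in_bwords_hwords = supp_in_mono[OF _ bwords_hwords]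

lemma supp_in_bwords_mult:
  assumes "s \<in> supp_in (bwords G m w)" "t \<in> supp_in (bwords G n w')"
  shows "s * t \<in> supp_in (bwords G (m + n) (\<lambda>v. w v + w' v))"
  using assms by (rule supp_in_mult) (auto simp: bwords_def)

lemma bwords_letter: "l \<in> G \<Longrightarrow> word [l] \<in> supp_in (bwords G (ldeg l) (lwt l))"
  by (auto simp: bwords_def intro!: supp_in_single)

lemma derw_bwords:
  assumes D: "\<And>l. l \<in> G \<Longrightarrow> D l \<in> supp_in (bwords G (ldeg l + e) (lwt l))"
    and u: "u \<in> bwords G n w"
  shows "derw d D u \<in> supp_in (bwords G (n + e) w)"
  using u
proof (induction u arbitrary: n w)
  case (Cons l u)
  have l: "l \<in> G" and u: "u \<in> bwords G (n - ldeg l) (\<lambda>v. w v - lwt l v)"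
    using Cons.prems by (auto simp: bwords_def algebra_simps)
  have "D l * word u \<in> supp_in (bwords G (ldeg l + e + (n - ldeg l)) (\<lambda>v. lwt l v + (w v - lwt l v)))"
    by (rule supp_in_bwords_mult[OF D[OF l] supp_in_single[OF u]])
  moreover have "word [l] * derw d D u \<in>
      supp_in (bwords G (ldeg l + (n - ldeg l + e)) (\<lambda>v. lwt l v + (w v - lwt l v)))"
    by (rule supp_in_bwords_mult[OF bwords_letter[OF l] Cons.IH[OF u]])
  ultimately show ?case by (auto simp: add.commute)
qed simp

text \<open>\<open>Cone\<close> and \<open>Base\<close> count alike, so the differential preserves
  this number. It is the eigenvalue of the anticommutator of differential and contraction on a
  word.\<close>

definition ncone :: "('v, 'k, 'p) letter list \<Rightarrow> nat" where
  "ncone u = length (filter (\<lambda>l. \<not> core l) u)"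

lemma ncone_simps [simp]: "ncone [] = 0" "ncone (l # u) = (if core l then 0 else 1) + ncone u"
  "ncone (u @ w) = ncone u + ncone w"
  by (simp_all add: ncone_def)

lemma ncone_eq_0_iff: "ncone u = 0 \<longleftrightarrow> (\<forall>l\<in>set u. core l)"
  by (induction u) auto

text \<open>The facts about \<open>P\<close> on which the construction rests, stated without the
  Stanley-Reisner ring, which is replaced by degree 0 homology. \<open>exact\<close> is acyclicity
  in positive degrees. \<open>xx_cancel\<close> says that the variable \<open>v0\<close> is a
  non-zero-divisor on classes of \<open>v0\<close>-weight at least 1; this is where the
  squarefreeness of the ideal is encoded.\<close>

locale weighted_cdga = cdga P for P :: "('k::field_char_0, 'p) dga" (structure) +
  fixes W :: "('v \<Rightarrow> int) \<Rightarrow> 'p set" and v0 :: 'v and xx :: "'v \<Rightarrow> 'p"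
  assumes W_submodule: "submodule (W w) (ring_of_type_algebra :: 'k ring) P"
    and W_one: "\<one> \<in> W (\<lambda>_. 0)"
    and W_mult: "x \<in> W w \<Longrightarrow> y \<in> W w' \<Longrightarrow> x \<otimes> y \<in> W (\<lambda>v. w v + w' v)"
    and W_bdry: "x \<in> W w \<Longrightarrow> bdry P x \<in> W w"
    and xx: "xx u \<in> hpart P 0 \<inter> W (\<lambda>v. if v = u then 1 else 0)"
    and exact: "1 \<le> n \<Longrightarrow> z \<in> hpart P n \<inter> W w \<Longrightarrow> bdry P z = \<zero> \<Longrightarrow>
      \<exists>p\<in>hpart P (n + 1) \<inter> W w. bdry P p = z"
    and xx_cancel: "z \<in> hpart P 0 \<inter> W w \<Longrightarrow> 1 \<le> w v0 \<Longrightarrow>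
      xx v0 \<otimes> z \<in> bdry P ` hpart P 1 \<Longrightarrow>
      z \<in> bdry P ` (hpart P 1 \<inter> W w)"
begin

lemmas WD = submoduleD[OF W_submodule]

primrec lval :: "('v, 'k, 'p) letter \<Rightarrow> 'p" where
  "lval (Var u) = xx u"
| "lval (Kill n w L p) = p"
| "lval (Cone n w p) = p"
| "lval (Base n w p) = bdry P p"

text \<open>The letters \<open>Var\<close> and \<open>Kill\<close> generate a Tate resolution in which cycles are only killed while
  their \<open>v0\<close>-weight is small; \<open>Cone\<close> and \<open>Base\<close> are contractible pairs that make the evaluation
  into \<open>P\<close> surjective.\<close>

inductive valid :: "('v, 'k, 'p) letter \<Rightarrow> bool" where
  Var: "valid (Var u)"
| Kill: "1 \<le> n \<Longrightarrow> w v0 \<le> max (n - 1) 1 \<Longrightarrow> p \<in> hpart P n \<Longrightarrow> p \<in> W w \<Longrightarrow>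
    (\<forall>q\<in>set L. (\<forall>l\<in>set (snd q). valid l) \<and> (\<forall>l\<in>set (snd q). core l) \<and> wdeg ldeg (snd q) = n - 1 \<and>
      (\<forall>v. wdeg (\<lambda>l. lwt l v) (snd q) = w v)) \<Longrightarrow>
    der ldeg lbd (listpoly L) \<in> comm_ideal ldeg (Collect valid) \<Longrightarrow>
    ev P lval (listpoly L) = bdry P p \<Longrightarrow> valid (Kill n w L p)"
| Cone: "1 \<le> n \<Longrightarrow> p \<in> hpart P n \<Longrightarrow> p \<in> W w \<Longrightarrow> valid (Cone n w p)"
| Base: "1 \<le> n \<Longrightarrow> p \<in> hpart P n \<Longrightarrow> p \<in> W w \<Longrightarrow> valid (Base n w p)"

abbreviation \<Gamma> :: "('v, 'k, 'p) letter set" where "\<Gamma> \<equiv> Collect valid"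
abbreviation \<Gamma>0 :: "('v, 'k, 'p) letter set" where "\<Gamma>0 \<equiv> {l. valid l \<and> core l}"
abbreviation \<T> :: "('v, 'k, 'p) lalg set" where "\<T> \<equiv> supp_in (lists \<Gamma>)"
abbreviation \<C> :: "('v, 'k, 'p) lalg set" where "\<C> \<equiv> comm_ideal ldeg \<Gamma>"
abbreviation \<d> :: "('v, 'k, 'p) lalg \<Rightarrow> ('v, 'k, 'p) lalg" where
  "\<d> \<equiv> der ldeg lbd"
abbreviation \<g> :: "('v, 'k, 'p) lalg \<Rightarrow> 'p" where "\<g> \<equiv> ev P lval"

section \<open>Differential, contraction and evaluation on valid letters\<close>

lemma Kill_listpoly: "valid (Kill n w L p) \<Longrightarrow> listpoly L \<in> supp_in (bwords \<Gamma>0 (n - 1) w)"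
  by (erule valid.cases) (auto simp: bwords_def intro!: listpoly_in)

lemma lbd_core:
  assumes "valid l" "core l" shows "lbd l \<in> supp_in (bwords \<Gamma>0 (ldeg l - 1) (lwt l))"
  by (cases l) (use assms Kill_listpoly in auto)

lemma lbd_bwords: "l \<in> \<Gamma> \<Longrightarrow> lbd l \<in> supp_in (bwords \<Gamma> (ldeg l + - 1) (lwt l))"
proof -
  assume l: "l \<in> \<Gamma>"
  show ?thesis
  proof (cases "core l")
    case True
    then have "lbd l \<in> supp_in (bwords \<Gamma>0 (ldeg l - 1) (lwt l))" using l by (intro lbd_core) auto
    then have "lbd l \<in> supp_in (bwords \<Gamma> (ldeg l - 1) (lwt l))"
      by (rule supp_in_mono) (rule bwords_mono, auto)
    then show ?thesis by simp
  next
    case False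
    then show ?thesis using l
      by (cases l) (auto elim: valid.cases intro!: supp_in_single valid.Base simp: bwords_def)
  qed
qed

lemma lcone_bwords: "l \<in> \<Gamma> \<Longrightarrow> lcone l \<in> supp_in (bwords \<Gamma> (ldeg l + 1) (lwt l))"
  by (cases l) (auto elim: valid.cases intro!: supp_in_single valid.Cone simp: bwords_def)

sublocale bd: letter_derivation ldeg \<Gamma> "- 1" "lbd :: _ \<Rightarrow> (_, 'k) falg"
  by unfold_locales (auto intro: supp_in_bwords_hwords[OF lbd_bwords, simplified])

sublocale cone: letter_derivation ldeg \<Gamma> 1 "lcone :: _ \<Rightarrow> (_, 'k) falg"
  by unfold_locales (auto intro: supp_in_bwords_hwords[OF lcone_bwords])

lemma der_lbd: "l \<in> \<Gamma> \<Longrightarrow> \<d> (lbd l) \<in> \<C>"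
  by (cases l) (auto elim: valid.cases intro: comm_ideal.zero)

lemma der_der: "t \<in> \<T> \<Longrightarrow> \<d> (\<d> t) \<in> \<C>"
  by (rule der_der_comm_ideal[OF bd.letter_derivation_axioms der_lbd])

lemma lval_bi:
  assumes "valid l" shows "lval l \<in> hpart P (ldeg l) \<inter> W (lwt l)"
  using assms by cases (use xx in \<open>simp_all add: bdry_degree W_bdry\<close>)

lemma lval_closed: "lval \<in> \<Gamma> \<rightarrow> carrier P"
  using lval_bi hpartD(6) by blast

lemmas g_add = ev_add[OF lval_closed]
  and g_diff = ev_diff[OF lval_closed]
  and g_scal = ev_scal[OF lval_closed]
  and g_sg = ev_sg[OF lval_closed]
  and g_mult = ev_mult[OF lval_closed]
  and g_single = ev_single'[OF lval_closed]
  and g_closed = ev_closed[OF lval_closed]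

lemma wordval_bi:
  assumes "u \<in> lists \<Gamma>"
  shows "wordval P lval u \<in> hpart P (wdeg ldeg u) \<inter> W (\<lambda>v. wdeg (\<lambda>l. lwt l v) u)"
  using assms
proof induction
  case Nil
  show ?case using degree_one W_one by simp
next
  case (Cons l u)
  then have "lval l \<in> hpart P (ldeg l) \<inter> W (lwt l)" using lval_bi by blast
  with Cons show ?case by (simp add: degree_mult W_mult)
qed

lemma g_hpart: "t \<in> supp_in (hwords ldeg \<Gamma> n) \<Longrightarrow> \<g> t \<in> hpart P n"
proof (induction t rule: supp_in_induct)
  case (single u c)
  then have u: "u \<in> lists \<Gamma>" and n: "wdeg ldeg u = n" by (simp_all add: hwords_def)
  show ?case using wordval_bi[OF u] hpartD(4) n by (simp add: g_single[OF u])
next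
  case (add s t)
  then show ?case using hpartD(3) by (simp add: g_add supp_in_hwords_lists)
qed (simp add: hpartD(2))

lemma g_W: "t \<in> supp_in (bwords \<Gamma> n w) \<Longrightarrow> \<g> t \<in> W w"
proof (induction t rule: supp_in_induct)
  case (single u c)
  then have u: "u \<in> lists \<Gamma>" and n: "(\<lambda>v. wdeg (\<lambda>l. lwt l v) u) = w" by (auto simp: bwords_def)
  show ?case using wordval_bi[OF u] WD(4) n by (simp add: g_single[OF u])
next
  case (add s t)
  then show ?case using WD(3) by (simp add: g_add supp_in_bwords_lists)
qed (simp add: WD(2))

lemma g_bi: "t \<in> supp_in (bwords \<Gamma> n w) \<Longrightarrow> \<g> t \<in> hpart P n \<inter> W w"
  using g_W g_hpart[OF supp_in_bwords_hwords] by blast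

text \<open>\<open>P\<close> is graded-commutative and \<open>lval\<close> respects degrees, so each
  relation evaluates to zero. Congruences modulo \<open>\<C>\<close> therefore become equations in
  \<open>P\<close>.\<close>

lemma g_comm_ideal: "t \<in> \<C> \<Longrightarrow> t \<in> \<T> \<and> \<g> t = \<zero>"
proof (induction rule: comm_ideal.induct)
  case (rel t u w x y c)
  define q where "q = word [x] * word [y] - sg (ldeg x * ldeg y) * (word [y] * word [x] :: ('v, 'k, 'p) lalg)"
  have xy: "word [x] \<in> \<T>" "word [y] \<in> \<T>"
    "word u \<in> \<T>" "word w \<in> \<T>"
    using rel by (auto intro!: supp_in_single)
  have lx: "lval x \<in> hpart P (ldeg x)" "lval y \<in> hpart P (ldeg y)" using lval_bi rel by auto
  have c: "lval x \<in> carrier P" "lval y \<in> carrier P" using hpartD(6) lx by blast+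
  have q: "q \<in> \<T>" unfolding q_def
    by (intro supp_in_diff supp_in_sg supp_in_lists_mult xy)
  have "\<g> q = lval x \<otimes> lval y \<ominus> sg (ldeg x * ldeg y) \<odot> (lval y \<otimes> lval x)"
  proof -
    have "\<g> (word [x]) = lval x" "\<g> (word [y]) = lval y"
      using rel c by (simp_all add: g_single)
    then show ?thesis
      unfolding q_def by (simp only: g_diff g_sg g_mult supp_in_lists_mult supp_in_sg xy)
  qed
  also have "\<dots> = \<zero>"
    using graded_commutative[OF lx] c by (simp add: powi_minus_one)
  finally have q0: "\<g> q = \<zero>" .
  have e: "word (u @ [x, y] @ w) - sg (ldeg x * ldeg y) * word (u @ [y, x] @ w) = word u * (q * word w)"
    by (simp add: q_def ring_distribs sg_def)
  have qw: "word u * (q * word w) \<in> \<T>" by (intro supp_in_lists_mult xy q)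
  have "\<g> (word u * (q * word w)) = \<zero>"
  proof -
    have "\<g> (word u * (q * word w)) = \<g> (word u) \<otimes> (\<g> q \<otimes> \<g> (word w))"
      by (simp only: g_mult supp_in_lists_mult xy q)
    then show ?thesis using q0 g_closed[OF xy(3)] g_closed[OF xy(4)] by simp
  qed
  then show ?case unfolding e using rel qw by (simp add: g_add g_scal supp_in_scal supp_in_add)
qed simp

lemma g_lbd:
  assumes "valid l" shows "\<g> (lbd l) = bdry P (lval l)"
  using assms
proof cases
  case (Var u)
  have "bdry P (xx u) = \<zero>" using xx by (intro bdry_of_degree_0) blast
  with Var show ?thesis by simp
next
  case (Cone n p w)
  then have "valid (Base n w p)" by (intro valid.Base)
  moreover have "bdry P p \<in> carrier P" using Cone bdry_degree hpartD(6) by blast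
  ultimately show ?thesis using Cone by (simp add: g_single)
next
  case (Base n p w)
  then show ?thesis using bdry_bdry hpartD(6) by simp
qed simp


lemma lbd_lists: "valid l \<Longrightarrow> lbd l \<in> \<T>"
  using lbd_bwords supp_in_bwords_lists by blast

lemma derw_lists: "u \<in> lists \<Gamma> \<Longrightarrow> derw ldeg lbd u \<in> \<T>"
  using bd.der_in_lists[of "word u"] by (simp add: supp_in_single)

lemma g_derw: "u \<in> lists \<Gamma> \<Longrightarrow> \<g> (derw ldeg lbd u) = bdry P (wordval P lval u)"
proof (induction u rule: lists.induct)
  case Nil
  show ?case by (simp add: bdry_of_degree_0[OF degree_one])
next
  case (Cons l u)
  have l: "valid l" "word [l] \<in> \<T>" and u: "word u \<in> \<T>"
    using Cons.hyps by (auto intro!: supp_in_single)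
  have h: "lval l \<in> hpart P (ldeg l)" "wordval P lval u \<in> hpart P (wdeg ldeg u)"
    using lval_bi[OF l(1)] wordval_bi[OF Cons.hyps(2)] by blast+
  have c: "lval l \<in> carrier P" "wordval P lval u \<in> carrier P" using h hpartD(6) by blast+
  note in_lists = lbd_lists[OF l(1)] derw_lists[OF Cons.hyps(2)] l(2) u
  have "\<g> (derw ldeg lbd (l # u)) =
      \<g> (lbd l) \<otimes> \<g> (word u) \<oplus> sg (ldeg l) \<odot> (\<g> (word [l]) \<otimes> \<g> (derw ldeg lbd u))"
    unfolding derw.simps by (simp only: g_add g_sg g_mult supp_in_lists_mult supp_in_sg in_lists)
  also have "\<g> (word u) = wordval P lval u" using g_single[OF Cons.hyps(2), of 1] c by simp
  also have "\<g> (word [l]) = lval l" using g_single[of "[l]" 1] l c by simp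
  finally show ?case
    using bdry_Leibniz[OF h] by (simp add: g_lbd[OF l(1)] Cons.IH powi_minus_one)
qed

lemma g_bd: "t \<in> \<T> \<Longrightarrow> \<g> (\<d> t) = bdry P (\<g> t)"
proof (induction t rule: supp_in_induct)
  case zero
  show ?case by (simp add: bdry_zero)
next
  case (single u c)
  then have "wordval P lval u \<in> carrier P" by (rule wordval_closed[OF lval_closed])
  then show ?case using single
    by (simp add: der_single g_scal[OF derw_lists] g_derw g_single bdry_smult)
next
  case (add s t)
  then show ?case
    by (simp add: der_add g_add bd.der_in_lists bdry_add g_closed)
qed

section \<open>The homotopy that contracts the pairs\<close>

lemma derw_lcone_core: "u \<in> lists {l. core l} \<Longrightarrow> derw ldeg lcone u = 0"
proof (induction u rule: lists.induct)
  case (Cons l u)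
  then show ?case by (cases l) auto
qed simp

lemma der_lcone_core: "t \<in> supp_in (lists {l. core l}) \<Longrightarrow> der ldeg lcone t = 0"
  by (induction t rule: supp_in_induct) (simp_all add: der_single der_add derw_lcone_core)

text \<open>The boundary of a \<open>Kill\<close> letter involves core letters only, and these are
  annihilated by the contraction. On a letter of a pair one of the two composites is the identity
  and the other is 0.\<close>

lemma anticommutator_letter:
  "valid l \<Longrightarrow> \<d> (lcone l) + der ldeg lcone (lbd l) = (if core l then 0 else word [l])"
proof (cases l)
  case (Kill n w L p)
  assume "valid l"
  with Kill have "listpoly L \<in> supp_in (bwords \<Gamma>0 (n - 1) w)" by (auto intro: Kill_listpoly)
  then have "listpoly L \<in> supp_in (lists {l. core l})"
    by (rule supp_in_mono) (auto simp: bwords_def)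
  with Kill show ?thesis by (simp add: der_lcone_core)
qed simp_all

text \<open>The anticommutator of two odd derivations is an even derivation; being the identity on
  letters of pairs and zero on core letters, it counts the former.\<close>

lemma anticommutator_word:
  "u \<in> lists \<Gamma> \<Longrightarrow> \<d> (derw ldeg lcone u) + der ldeg lcone (derw ldeg lbd u) =
    (scal (of_nat (ncone u)) (word u) :: ('v, 'k, 'p) lalg)"
proof (induction u rule: lists.induct)
  case (Cons l u)
  have "\<d> (derw ldeg lcone (l # u)) + der ldeg lcone (derw ldeg lbd (l # u)) =
      (if core l then 0 else word [l]) * word u + word [l] * scal (of_nat (ncone u)) (word u :: ('v, 'k, 'p) lalg)"
    unfolding anticommutator_Cons[OF bd.letter_derivation_axioms cone.letter_derivation_axioms Cons.hyps(1)]
    using anticommutator_letter Cons by simp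
  then show ?case by (simp add: single_add)
qed simp

lemma lbd_ncone: "valid l \<Longrightarrow> lbd l \<in> supp_in {u. ncone u = ncone [l]}"
proof (cases "core l")
  case True
  assume "valid l"
  from lbd_core[OF this True] show ?thesis
    by (rule supp_in_mono) (use True in \<open>auto simp: bwords_def ncone_eq_0_iff\<close>)
next
  case False
  then show ?thesis by (cases l) (auto intro!: supp_in_single)
qed

lemma derw_lbd_ncone: "u \<in> lists \<Gamma> \<Longrightarrow> derw ldeg lbd u \<in> supp_in {u'. ncone u' = ncone u}"
proof (induction u rule: lists.induct)
  case (Cons l u)
  have "lbd l * word u \<in> supp_in {u'. ncone u' = ncone (l # u)}"
    by (rule supp_in_mult[OF lbd_ncone supp_in_single[of u "{u}"]]) (use Cons.hyps in auto)
  moreover have "word [l] * derw ldeg lbd u \<in> supp_in {u'. ncone u' = ncone (l # u)}"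
    by (rule supp_in_mult[OF supp_in_single[of "[l]" "{[l]}"] Cons.IH]) auto
  ultimately show ?case unfolding derw.simps by (intro supp_in_add supp_in_sg)
qed simp

text \<open>Dividing by the number of cone letters uses characteristic zero.\<close>

definition homotopy :: "('v, 'k, 'p) lalg \<Rightarrow> ('v, 'k, 'p) lalg" where
  "homotopy = lin (\<lambda>u. scal (1 / of_nat (ncone u)) (derw ldeg lcone u))"

definition core_part :: "('v, 'k, 'p) lalg \<Rightarrow> ('v, 'k, 'p) lalg" where
  "core_part = lin (\<lambda>u. if ncone u = 0 then word u else 0)"

lemma homotopy_comm_ideal: "t \<in> \<C> \<Longrightarrow> homotopy t \<in> \<C>"
  unfolding homotopy_def
  by (rule cone.weighted_der_comm_ideal[where K = ncone and a = "\<lambda>k. 1 / of_nat k"]) auto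

lemma homotopy_bwords: "t \<in> supp_in (bwords \<Gamma> n w) \<Longrightarrow> homotopy t \<in> supp_in (bwords \<Gamma> (n + 1) w)"
  unfolding homotopy_def
  by (erule supp_in_lin, rule supp_in_scal, rule derw_bwords[OF lcone_bwords])

lemma homotopy_ncone:
  "t \<in> supp_in {u. ncone u = k} \<Longrightarrow> homotopy t = scal (1 / of_nat k) (der ldeg lcone t)"
  by (induction t rule: supp_in_induct)
     (simp_all add: homotopy_def lin_add der_add scal_add der_single scal_scal mult.commute)

text \<open>Division by \<open>ncone\<close> is compatible with the anticommutator because
  \<open>\<d>\<close> preserves \<open>ncone\<close>: both composites carry the same factor.\<close>

lemma homotopy_formula:
  "t \<in> \<T> \<Longrightarrow> \<d> (homotopy t) + homotopy (\<d> t) = t - core_part t"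
proof (induction t rule: supp_in_induct)
  case (single u c)
  let ?a = "1 / of_nat (ncone u) :: 'k"
  have "\<d> (homotopy (word u)) + homotopy (\<d> (word u)) =
      scal ?a (\<d> (derw ldeg lcone u) + der ldeg lcone (derw ldeg lbd u))"
    by (simp add: homotopy_ncone[OF derw_lbd_ncone[OF single]])
       (simp add: homotopy_def der_scal scal_add)
  \<comment> \<open>For a core word \<open>?a\<close> is 1/0 = 0 and both sides vanish; otherwise
    \<open>?a\<close> cancels the eigenvalue.\<close>
  also have "\<dots> = word u - core_part (word u)"
    unfolding anticommutator_word[OF single] by (simp add: core_part_def)
  finally have "scal c (\<d> (homotopy (word u)) + homotopy (\<d> (word u))) = scal c (word u - core_part (word u))"
    by simp
  then show ?case
    unfolding scal_add scal_diff homotopy_def core_part_def lin_scal[symmetric] der_scal[symmetric]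
    by simp
next
  case (add s t)
  have "\<d> (homotopy (s + t)) + homotopy (\<d> (s + t)) =
      (\<d> (homotopy s) + homotopy (\<d> s)) + (\<d> (homotopy t) + homotopy (\<d> t))"
    by (simp add: homotopy_def lin_add der_add algebra_simps)
  also have "\<dots> = s + t - core_part (s + t)"
    unfolding add.IH by (simp add: core_part_def lin_add)
  finally show ?case .
qed (simp add: homotopy_def core_part_def)

lemma core_part_bwords:
  "t \<in> supp_in (bwords \<Gamma> n w) \<Longrightarrow> core_part t \<in> supp_in (bwords \<Gamma>0 n w)"
  unfolding core_part_def
  by (erule supp_in_lin) (auto simp: bwords_def ncone_eq_0_iff subset_iff intro!: supp_in_single)

end

section \<open>Acyclicity\<close>

context weighted_cdga
begin

text \<open>The bound in \<open>Kill\<close> is at most the degree, since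
  \<open>max (n - 1) 1 \<le> n\<close> for \<open>n \<ge> 1\<close>; the remaining variables have
  \<open>v0\<close>-weight 0.\<close>

lemma core_weight_le_degree:
  assumes "valid l" "core l" "l \<noteq> Var v0" shows "lwt l v0 \<le> ldeg l"
  using assms by (cases rule: valid.cases; simp)

lemma core_word_weight:
  "u \<in> lists \<Gamma>0 \<Longrightarrow> Var v0 \<notin> set u \<Longrightarrow> wdeg (\<lambda>l. lwt l v0) u \<le> wdeg ldeg u"
proof (induction u rule: lists.induct)
  case (Cons l u)
  then have "lwt l v0 \<le> ldeg l" by (intro core_weight_le_degree) auto
  with Cons show ?case by auto
qed simp

lemma comm_ideal_cong:
  "t - s \<in> comm_ideal d G \<Longrightarrow> s \<in> comm_ideal d G \<Longrightarrow> t \<in> comm_ideal d G"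
  using comm_ideal_add by fastforce

text \<open>A core word of \<open>v0\<close>-weight exceeding both its degree and 1 contains \<open>Var v0\<close>; dividing a
  cycle by this non-zero-divisor lowers its weight until a \<open>Kill\<close> letter is available.\<close>

lemma core_acyclic:
  assumes "z \<in> supp_in (bwords \<Gamma>0 n w)" "0 \<le> n" "\<d> z \<in> \<C>"
    and "n = 0 \<Longrightarrow> \<g> z \<in> bdry P ` (hpart P 1 \<inter> W w)"
  shows "\<exists>k\<in>supp_in (bwords \<Gamma> (n + 1) w). \<d> k - z \<in> \<C>"
  using assms
proof (induction "nat (w v0 - max n 1)" arbitrary: z w rule: less_induct)
  case less
  have sub: "bwords \<Gamma>0 n w \<subseteq> bwords \<Gamma> n w" for n w by (rule bwords_mono) auto
  have zG: "z \<in> supp_in (bwords \<Gamma> n w)" using less.prems(1) sub by (rule supp_in_mono)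
  have zl: "z \<in> \<T>" using zG by (rule supp_in_bwords_lists)
  have dz: "bdry P (\<g> z) = \<zero>" using g_comm_ideal[OF less.prems(3)] g_bd[OF zl] by simp
  show ?case
  proof (cases "w v0 \<le> max n 1")
    case True
    obtain L where L: "listpoly L = z" "\<And>q. q \<in> set L \<Longrightarrow> snd q \<in> bwords \<Gamma>0 n w"
      by (rule listpoly_exists[OF less.prems(1)]) blast
    obtain p where p: "p \<in> hpart P (n + 1)" "p \<in> W w" "bdry P p = \<g> z"
    proof (cases "n = 0")
      case True
      then show thesis using less.prems(4) that by auto
    next
      case False
      then have "1 \<le> n" using less.prems(2) by simp
      from exact[OF this g_bi[OF zG] dz] show thesis using that by blast
    qed
    \<comment> \<open>A letter of degree \<open>n + 1\<close> may have \<open>v0\<close>-weight up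
      to \<open>max n 1\<close>, which is the case assumption.\<close>
    have "valid (Kill (n + 1) w L p)"
    proof (rule valid.Kill)
      show "\<forall>q\<in>set L. (\<forall>l\<in>set (snd q). valid l) \<and> (\<forall>l\<in>set (snd q). core l) \<and>
          wdeg ldeg (snd q) = n + 1 - 1 \<and> (\<forall>v. wdeg (\<lambda>l. lwt l v) (snd q) = w v)"
        using L(2) by (fastforce simp: bwords_def)
    qed (use True L(1) p less.prems in simp_all)
    then have "word [Kill (n + 1) w L p] \<in> supp_in (bwords \<Gamma> (n + 1) w)"
      using bwords_letter[of "Kill (n + 1) w L p" \<Gamma>] by simp
    moreover have "\<d> (word [Kill (n + 1) w L p]) - z = 0" using L(1) by simp
    ultimately show ?thesis using comm_ideal.zero by metis
  next
    case False
    let ?e = "\<lambda>v. if v = v0 then 1 else 0 :: int"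
    define w' where "w' = (\<lambda>v. w v - ?e v)"
    define z' where "z' = split_off (Var v0) z"
    have ww': "w = (\<lambda>v. ?e v + w' v)" by (auto simp: w'_def)
    \<comment> \<open>A core word without \<open>Var v0\<close> has \<open>v0\<close>-weight at most
      its degree \<open>n\<close>, and here the weight is larger.\<close>
    have contains: "z \<in> supp_in {u \<in> bwords \<Gamma>0 n w. Var v0 \<in> set u}"
      using less.prems(1) core_word_weight False less.prems(2) unfolding supp_in_def
      by (fastforce simp: bwords_def)
    have z': "z' \<in> supp_in (bwords \<Gamma>0 n w')"
      unfolding z'_def split_off_def using contains
    proof (rule supp_in_lin)
      fix u assume u: "u \<in> {u \<in> bwords \<Gamma>0 n w. Var v0 \<in> set u}"
      then obtain a b where ab: "u = a @ Var v0 # b" "Var v0 \<notin> set a" by (auto dest: split_list_first)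
      have "a @ b \<in> bwords \<Gamma>0 n w'"
        using u unfolding ab by (auto simp: bwords_def w'_def algebra_simps)
      then show "(if Var v0 \<in> set u then word (remove1 (Var v0) u) else 0) \<in> supp_in (bwords \<Gamma>0 n w')"
        using ab by (auto simp: remove1_append intro!: supp_in_single)
    qed
    have z'G: "z' \<in> supp_in (bwords \<Gamma> n w')" using z' sub by (rule supp_in_mono)
    have z'l: "z' \<in> \<T>" using z'G by (rule supp_in_bwords_lists)
    have X: "word [Var v0] \<in> supp_in (bwords \<Gamma> 0 ?e)" "word [Var v0] \<in> \<T>"
      using bwords_letter[of "Var v0" \<Gamma>] by (simp_all add: valid.Var supp_in_single)
    have move: "z - word [Var v0] * z' \<in> \<C>"
      unfolding z'_def
    proof (rule split_off_move)
      show "z \<in> supp_in {u \<in> lists \<Gamma>. Var v0 \<in> set u}"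
        using contains by (rule supp_in_mono) (auto simp: bwords_def)
    qed simp
    have dX: "\<d> (word [Var v0] * t) = word [Var v0] * \<d> t" for t
      by (simp add: der_letter_mult)
    \<comment> \<open>\<open>\<d>\<close> commutes with multiplication by \<open>Var v0\<close>, so
      cancelling this letter shows that the quotient \<open>z'\<close> is again a cycle modulo the
      relations.\<close>
    have "\<d> (z - word [Var v0] * z') \<in> \<C>" using move by (rule bd.der_comm_ideal)
    then have "word [Var v0] * \<d> z' - \<d> z \<in> \<C>"
      by (simp add: der_diff dX comm_ideal_sym)
    then have "word [Var v0] * \<d> z' \<in> \<C>" using less.prems(3) by (rule comm_ideal_cong)
    then have dz': "\<d> z' \<in> \<C>" by (rule split_off_cancel[rotated]) simp
    have small: "nat (w' v0 - max n 1) < nat (w v0 - max n 1)"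
      using False by (auto simp: w'_def)
    have "\<exists>k\<in>supp_in (bwords \<Gamma> (n + 1) w'). \<d> k - z' \<in> \<C>"
    proof (rule less.hyps[OF small z' less.prems(2) dz'])
      assume n: "n = 0"
      have "\<g> (z - word [Var v0] * z') = \<zero>" using g_comm_ideal[OF move] by blast
      have Xz: "word [Var v0] * z' \<in> \<T>" using X(2) z'l by (rule supp_in_lists_mult)
      from \<open>\<g> (z - word [Var v0] * z') = \<zero>\<close> have "\<g> z = \<g> (word [Var v0] * z')"
        using g_closed[OF zl] g_closed[OF Xz] by (simp add: g_diff[OF zl Xz])
      also have "\<dots> = xx v0 \<otimes> \<g> z'"
        using X(2) z'l xx[of v0] hpartD(6)[of "xx v0" 0] g_single[of "[Var v0]" 1]
        by (simp add: g_mult[OF X(2) z'l] valid.Var)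
      finally have "xx v0 \<otimes> \<g> z' \<in> bdry P ` hpart P 1" using less.prems(4)[OF n] by auto
      \<comment> \<open>Here the maximum with 1 matters: in degree 0 the weight exceeds 1, so after
        division \<open>w' v0\<close> is still at least 1, as \<open>xx_cancel\<close>
        requires.\<close>
      with g_bi[OF z'G] n False show "\<g> z' \<in> bdry P ` (hpart P 1 \<inter> W w')"
        by (intro xx_cancel) (simp_all add: w'_def)
    qed
    then obtain k where k: "k \<in> supp_in (bwords \<Gamma> (n + 1) w')" "\<d> k - z' \<in> \<C>" by blast
    have "word [Var v0] * k \<in> supp_in (bwords \<Gamma> (n + 1) w)"
      using supp_in_bwords_mult[OF X(1) k(1)] by (simp flip: ww')
    moreover have "\<d> (word [Var v0] * k) - z \<in> \<C>"
    proof -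
      have "word [Var v0] * (\<d> k - z') - (z - word [Var v0] * z') \<in> \<C>"
        by (intro comm_ideal_diff comm_ideal_mult_left X k move)
      then show ?thesis by (simp add: dX algebra_simps)
    qed
    ultimately show ?thesis by blast
  qed
qed

text \<open>By \<open>homotopy_formula\<close> a cycle agrees with its core part up to a boundary
  and an element of the ideal, which reduces the claim to \<open>core_acyclic\<close>.\<close>

lemma acyclic:
  assumes z: "z \<in> supp_in (bwords \<Gamma> n w)" and n: "0 \<le> n" and dz: "\<d> z \<in> \<C>"
    and z0: "n = 0 \<Longrightarrow> \<g> z \<in> bdry P ` (hpart P 1 \<inter> W w)"
  shows "\<exists>k\<in>supp_in (bwords \<Gamma> (n + 1) w). \<d> k - z \<in> \<C>"
proof -
  have zl: "z \<in> \<T>" using z by (rule supp_in_bwords_lists)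
  have hz: "homotopy z \<in> supp_in (bwords \<Gamma> (n + 1) w)" using z by (rule homotopy_bwords)
  have hl: "homotopy z \<in> \<T>" using hz by (rule supp_in_bwords_lists)
  have hd: "homotopy (\<d> z) \<in> \<C>" using dz by (rule homotopy_comm_ideal)
  have eq: "core_part z = z - \<d> (homotopy z) - homotopy (\<d> z)"
    using homotopy_formula[OF zl] by (simp add: algebra_simps)
  have cz: "core_part z \<in> supp_in (bwords \<Gamma>0 n w)" using z by (rule core_part_bwords)
  have dc: "\<d> (core_part z) \<in> \<C>"
    unfolding eq der_diff
    by (intro comm_ideal_diff dz der_der hl bd.der_comm_ideal hd)
  \<comment> \<open>The values of \<open>z\<close> and of its core part differ by the boundary of
    \<open>\<g> (homotopy z)\<close>, and \<open>homotopy\<close> preserves weights.\<close>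
  have c0: "\<g> (core_part z) \<in> bdry P ` (hpart P 1 \<inter> W w)" if n0: "n = 0"
  proof -
    obtain p where p: "p \<in> hpart P 1" "p \<in> W w" "\<g> z = bdry P p" using z0[OF n0] by blast
    have h1: "\<g> (homotopy z) \<in> hpart P 1" "\<g> (homotopy z) \<in> W w" using g_bi[OF hz] n0 by simp_all
    have c: "p \<in> carrier P" "\<g> (homotopy z) \<in> carrier P" using hpartD(6) p(1) h1(1) by blast+
    have bc: "bdry P (\<g> (homotopy z)) \<in> carrier P" using hpartD(6)[OF bdry_degree[OF h1(1)]] .
    have "\<g> (core_part z) = \<g> z \<ominus> bdry P (\<g> (homotopy z))"
      unfolding eq using zl hl bd.der_in_lists[OF hl] g_comm_ideal[OF hd] bc g_closed[OF zl]
      by (simp add: g_diff supp_in_diff g_bd) (simp add: a_minus_def)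
    also have "\<dots> = bdry P (p \<oplus> (- 1) \<odot> \<g> (homotopy z))"
      unfolding p(3) a_minus_def k_uminus[OF bc, symmetric]
      using c by (simp only: bdry_add bdry_smult k_closed)
    finally show ?thesis
      using p h1 hpartD(3,4) WD(3,4) by blast
  qed
  obtain k where k: "k \<in> supp_in (bwords \<Gamma> (n + 1) w)" "\<d> k - core_part z \<in> \<C>"
    using core_acyclic[OF cz n dc c0] by blast
  have "\<d> (homotopy z + k) - z \<in> \<C>"
  proof -
    have "(\<d> k - core_part z) - homotopy (\<d> z) \<in> \<C>" by (intro comm_ideal_diff k hd)
    then show ?thesis by (simp add: der_add eq algebra_simps)
  qed
  then show ?thesis using supp_in_add[OF hz k(1)] by blast
qed

text \<open>A primitive \<open>k\<close> of \<open>z\<close> need not lie in the kernel, but its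
  value is a cycle of positive degree, hence the boundary of some \<open>p\<close>. The
  corresponding \<open>Base\<close> letter has the same value and boundary 0, so subtracting it from
  \<open>k\<close> repairs the value and keeps the boundary.\<close>

lemma kernel_acyclic:
  assumes z: "z \<in> supp_in (bwords \<Gamma> n w)" and n: "0 \<le> n" and dz: "\<d> z \<in> \<C>" and gz: "\<g> z = \<zero>"
  shows "\<exists>k\<in>supp_in (bwords \<Gamma> (n + 1) w). \<g> k = \<zero> \<and> \<d> k - z \<in> \<C>"
proof -
  have "\<zero> \<in> hpart P 1 \<inter> W w" using hpartD(2) WD(2) by blast
  then have "\<g> z \<in> bdry P ` (hpart P 1 \<inter> W w)" unfolding gz using bdry_zero by force
  then obtain k where k: "k \<in> supp_in (bwords \<Gamma> (n + 1) w)" "\<d> k - z \<in> \<C>"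
    using acyclic[OF z n dz] by blast
  have kl: "k \<in> \<T>" and zl: "z \<in> \<T>"
    using k z supp_in_bwords_lists by blast+
  have dkl: "\<d> k \<in> \<T>" using kl by (rule bd.der_in_lists)
  have "\<g> (\<d> k - z) = \<zero>" using g_comm_ideal[OF k(2)] by blast
  then have "bdry P (\<g> k) = \<zero>"
    using gz dkl zl g_closed[OF dkl] by (simp add: g_diff g_bd[OF kl])
  moreover have "\<g> k \<in> hpart P (n + 1) \<inter> W w" using k(1) by (rule g_bi)
  moreover have "1 \<le> n + 1" using n by simp
  ultimately obtain p where p: "p \<in> hpart P (n + 1 + 1)" "p \<in> W w" "bdry P p = \<g> k"
    using exact by blast
  let ?b = "word [Base (n + 1 + 1) w p] :: ('v, 'k, 'p) lalg"
  have v: "Base (n + 1 + 1) w p \<in> \<Gamma>" using p n by (auto intro: valid.Base)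
  have b: "?b \<in> supp_in (bwords \<Gamma> (n + 1) w)" using bwords_letter[OF v] by (simp add: algebra_simps)
  have bl: "?b \<in> \<T>" using b by (rule supp_in_bwords_lists)
  have "\<g> ?b = \<g> k" using v p(3) g_closed[OF kl] by (simp add: g_single)
  then have "\<g> (k - ?b) = \<zero>" using kl bl g_closed[OF kl] by (simp add: g_diff)
  moreover have "\<d> (k - ?b) - z \<in> \<C>" using k(2) by (simp add: der_diff)
  ultimately show ?thesis using supp_in_diff[OF k(1) b] by blast
qed

text \<open>The lifting step for a free algebra against a surjection with acyclic kernel. The
  \<open>Cone\<close> letter of \<open>e\<close> has the right value but boundary
  \<open>Base\<close>; the difference of \<open>z\<close> and this \<open>Base\<close> letter is a
  cycle in the kernel, and a primitive of it inside the kernel is the correction.\<close>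

lemma lift:
  assumes e: "e \<in> hpart P n" "e \<in> W w" and n: "1 \<le> n"
    and z: "z \<in> supp_in (bwords \<Gamma> (n - 1) w)" and dz: "\<d> z \<in> \<C>" and gz: "\<g> z = bdry P e"
  shows "\<exists>q\<in>supp_in (bwords \<Gamma> n w). \<g> q = e \<and> \<d> q - z \<in> \<C>"
proof -
  let ?b = "word [Base n w e] :: ('v, 'k, 'p) lalg"
  let ?c = "word [Cone n w e] :: ('v, 'k, 'p) lalg"
  have v: "Base n w e \<in> \<Gamma>" "Cone n w e \<in> \<Gamma>" using e n by (auto intro: valid.Base valid.Cone)
  have b: "?b \<in> supp_in (bwords \<Gamma> (n - 1) w)" using bwords_letter[OF v(1)] by simp
  have c: "?c \<in> supp_in (bwords \<Gamma> n w)" using bwords_letter[OF v(2)] by simp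
  have ec: "e \<in> carrier P" "bdry P e \<in> carrier P" using hpartD(6) e bdry_degree by blast+
  have "\<g> (z - ?b) = \<zero>"
    using z b v ec gz by (simp add: g_diff supp_in_bwords_lists g_single)
  moreover have "\<d> (z - ?b) \<in> \<C>" using dz by (simp add: der_diff)
  ultimately obtain k where k: "k \<in> supp_in (bwords \<Gamma> n w)" "\<g> k = \<zero>" "\<d> k - (z - ?b) \<in> \<C>"
    using kernel_acyclic[OF supp_in_diff[OF z b]] n by auto
  have "\<g> (?c + k) = e"
    using c k v ec by (simp add: g_add supp_in_bwords_lists g_single)
  moreover have "\<d> (?c + k) - z \<in> \<C>" using k(3) by (simp add: der_add algebra_simps)
  ultimately show ?thesis using supp_in_add[OF c k(1)] by blast
qed

end

section \<open>A section over a free algebra\<close>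

lemma falg_module: "Modules.module (\<lambda>c. Poly_Mapping.map ((*) c) :: ('g, 'k::field) falg \<Rightarrow> _)"
  unfolding map_eq_scal by unfold_locales (simp_all add: scal_add scal_add_left scal_scal)

definition subst :: "('g \<Rightarrow> ('h, 'k::comm_ring_1) falg) \<Rightarrow> ('g, 'k) falg \<Rightarrow> ('h, 'k) falg" where
  "subst s = lin (\<lambda>u. prod_list (map s u))"

lemma subst_zero [simp]: "subst s 0 = 0"
  and subst_add: "subst s (a + b) = subst s a + subst s b"
  and subst_diff: "subst s (a - b) = subst s a - subst s b"
  and subst_scal: "subst s (scal c a) = scal c (subst s a)"
  and subst_sg: "subst s (sg n * a) = sg n * subst s a"
  and subst_single: "subst s (single u c) = scal c (prod_list (map s u))"
  by (simp_all add: subst_def lin_add lin_diff lin_scal lin_sg)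

lemma subst_mult: "subst s (a * b) = subst s a * subst s b"
proof -
  have "a \<in> supp_in UNIV" "b \<in> supp_in UNIV" by (simp_all add: supp_in_def)
  from this(1) show ?thesis
  proof (induction a rule: supp_in_induct)
    case (single u c)
    from \<open>b \<in> supp_in UNIV\<close> show ?case
    proof (induction b rule: supp_in_induct)
      case (single w r)
      show ?case
        by (simp add: subst_single scal_mult_left scal_mult_right scal_scal mult.commute[of c r])
    qed (simp_all add: ring_distribs subst_add)
  qed (simp_all add: ring_distribs subst_add)
qed

lemma subst_in:
  assumes "\<And>u. u \<in> A \<Longrightarrow> prod_list (map s u) \<in> supp_in B" "t \<in> supp_in A"
  shows "subst s t \<in> supp_in B"
  unfolding subst_def using assms(2) by (rule supp_in_lin) (rule assms(1))

lemma subst_cong: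
  assumes "t \<in> supp_in (lists A)" "\<And>e. e \<in> A \<Longrightarrow> s e = s' e"
  shows "subst s t = subst s' t"
  unfolding subst_def
proof (rule lin_cong)
  fix u assume "u \<in> keys t"
  then have "u \<in> lists A" using assms(1) by (auto simp: supp_in_def)
  then have "map s u = map s' u" using assms(2) by auto
  then show "prod_list (map s u) = prod_list (map s' u)" by (rule arg_cong)
qed

text \<open>The identity under another name, protected from the simplifier.\<close>

definition incl :: "'a \<Rightarrow> 'a" where "incl x = x"

lemma (in kalgebra) wordval_incl_Cons [simp]: "wordval A incl (x # u) = x \<otimes> wordval A incl u"
  by (simp add: incl_def)

lemma tensor_value_eq_ev: "tensor_value P t = ev P incl t"
  by (simp add: tensor_value_def ev_def wordval_def word_value_def incl_def[abs_def])

text \<open>\<open>degree_0_generated\<close> describes degree 0 homology: up to boundaries each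
  weight is spanned by at most one monomial in the lifted variables. The alternative
  \<open>c = 0\<close> covers weights that belong to no monomial. It is used to lift generators of
  \<open>P\<close> of degree 0, which may be other than the \<open>xx u\<close>.\<close>

locale free_weighted_cdga = weighted_cdga P W v0 xx
  for P :: "('k::field_char_0, 'p) dga" (structure) and W :: "('v \<Rightarrow> int) \<Rightarrow> 'p set"
    and v0 :: 'v and xx :: "'v \<Rightarrow> 'p" +
  fixes E :: "'p set"
  assumes free: "freely_generated_by P E"
    and E_W: "E \<subseteq> (\<Union>w. W w)"
    and bigraded: "direct_sum_decomposition P (\<lambda>(n, w). hpart P n \<inter> W w)"
    and degree_0_generated: "e \<in> hpart P 0 \<inter> W w \<Longrightarrow>
      \<exists>c us p. p \<in> hpart P 1 \<inter> W w \<and> e = c \<odot> foldr (\<otimes>) (map xx us) \<one> \<oplus> bdry P p \<and>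
        (c = 0 \<or> (\<forall>v. w v = (\<Sum>u\<leftarrow>us. if v = u then 1 else 0)))"
begin

section \<open>Words in the generators of the given resolution\<close>

abbreviation \<E> :: "('p, 'k) falg set" where "\<E> \<equiv> supp_in (lists E)"

lemma E_carrier: "incl \<in> E \<rightarrow> carrier P"
proof
  fix e assume "e \<in> E"
  then obtain n where "e \<in> hpart P n" using free unfolding freely_generated_by_def by blast
  then show "incl e \<in> carrier P" using hpartD(6) by (simp add: incl_def)
qed

definition edeg :: "'p \<Rightarrow> int" where "edeg e = (SOME n. e \<in> hpart P n)"
definition ewt :: "'p \<Rightarrow> 'v \<Rightarrow> int" where "ewt e = (SOME w. e \<in> W w)"

lemma E_bi: "e \<in> E \<Longrightarrow> e \<in> hpart P (edeg e)" "e \<in> E \<Longrightarrow> e \<in> W (ewt e)"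
proof -
  assume e: "e \<in> E"
  have "\<exists>n. e \<in> hpart P n" using e free by (auto simp: freely_generated_by_def)
  then show "e \<in> hpart P (edeg e)" unfolding edeg_def by (rule someI_ex)
  have "\<exists>w. e \<in> W w" using e E_W by blast
  then show "e \<in> W (ewt e)" unfolding ewt_def by (rule someI_ex)
qed

lemma tv_kernel:
  "t \<in> \<E> \<Longrightarrow> ev P incl t = \<zero> \<Longrightarrow>
    t \<in> Modules.module.span (\<lambda>c. Poly_Mapping.map ((*) c)) (commutation_relations P E)"
  using free[unfolded freely_generated_by_def, THEN conjunct2, THEN conjunct2, THEN equalityD1, THEN subsetD, of t]
  by (simp only: supp_in_def mem_Collect_eq tensor_value_eq_ev simp_thms)

lemma tv_surj:
  "x \<in> carrier P \<Longrightarrow> \<exists>t\<in>\<E>. ev P incl t = x"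
proof -
  assume "x \<in> carrier P"
  then have "x \<in> tensor_value P ` {f. keys f \<subseteq> lists E}"
    by (rule free[unfolded freely_generated_by_def, THEN conjunct2, THEN conjunct1, THEN equalityD2, THEN subsetD])
  then show ?thesis
  proof (rule imageE)
    fix t assume t: "x = tensor_value P t" "t \<in> {f. keys f \<subseteq> lists E}"
    show ?thesis
    proof (rule bexI)
      show "ev P incl t = x" unfolding t(1) by (rule tensor_value_eq_ev[symmetric])
      show "t \<in> \<E>" unfolding supp_in_def by (rule t(2))
    qed
  qed
qed

lemma tv_kernel_induct [consumes 2, case_names zero rel add]:
  assumes t: "t \<in> \<E>" "ev P incl t = \<zero>"
    and zero: "Q 0"
    and rel: "\<And>r c. r \<in> commutation_relations P E \<Longrightarrow> Q (scal c r)"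
    and add: "\<And>a b. Q a \<Longrightarrow> Q b \<Longrightarrow> Q (a + b)"
  shows "Q t"
proof -
  interpret M: Modules.module "\<lambda>c. Poly_Mapping.map ((*) c) :: ('p, 'k) falg \<Rightarrow> _" by (rule falg_module)
  from tv_kernel[OF t] show ?thesis
    by (induction t rule: M.span_induct_alt) (use zero rel add in \<open>simp_all add: map_eq_scal\<close>)
qed

text \<open>Commutation relations consist of words of length at least 2, so a single letter never
  lies in their span. This gives each generator a unique degree.\<close>

lemma zero_notin_E: "\<zero> \<notin> E"
proof
  assume E: "\<zero> \<in> E"
  have t: "word [\<zero>] \<in> \<E>" using E by (auto intro!: supp_in_single)
  have 0: "ev P incl (word [\<zero>]) = \<zero>" using E by (subst ev_single'[OF E_carrier]) (simp_all del: wordval_Cons)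
  have long: "t \<in> supp_in {u. 2 \<le> length u}"
    if "t \<in> \<E>" "ev P incl t = \<zero>" for t :: "('p, 'k) falg"
    using that
  proof (induction t rule: tv_kernel_induct)
    case (rel r c)
    then show ?case unfolding commutation_relations_def
      by (auto intro!: supp_in_scal supp_in_diff supp_in_single)
  qed (simp_all add: supp_in_add)
  from long[OF t 0] show False by (simp add: supp_in_def)
qed

lemma hpart_indep: "graded_indep P (hpart P)"
  by (rule direct_sum_decomposition_indep[OF degree_decomposition])

lemma edeg_unique: "e \<in> E \<Longrightarrow> e \<in> hpart P n \<Longrightarrow> n = edeg e"
proof (rule ccontr)
  assume e: "e \<in> E" "e \<in> hpart P n" and "n \<noteq> edeg e"
  then have "e = \<zero>" using graded_indep_disjoint[OF hpart_indep e(2) E_bi(1)] by blast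
  then show False using e(1) zero_notin_E by blast
qed

lemma edeg_nonneg: "e \<in> E \<Longrightarrow> 0 \<le> edeg e"
proof (rule ccontr)
  assume e: "e \<in> E" and "\<not> 0 \<le> edeg e"
  then have "e \<in> {\<zero>}" using E_bi(1)[OF e] degree_neg[of "edeg e"] by simp
  then show False using e zero_notin_E by blast
qed

lemma e_word_bi:
  "u \<in> lists E \<Longrightarrow> wordval P incl u \<in> hpart P (wdeg edeg u) \<inter> W (\<lambda>v. wdeg (\<lambda>e. ewt e v) u)"
proof (induction u rule: lists.induct)
  case Nil
  show ?case using degree_one W_one by simp
next
  case (Cons e u)
  then show ?case using E_bi[of e] by (simp del: wordval_Cons add: degree_mult W_mult)
qed

lemma represent_degree:
  assumes "x \<in> hpart P n" shows "\<exists>t\<in>supp_in (hwords edeg E n). ev P incl t = x"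
proof -
  obtain t where t: "t \<in> \<E>" "ev P incl t = x" using tv_surj hpartD(6) assms by blast
  have "\<exists>t'\<in>supp_in {u \<in> lists E. wdeg edeg u = n}. ev P incl t' = ev P incl t"
    by (rule ev_component[OF E_carrier hpart_indep order.refl _ t(1)])
       (use e_word_bi t assms in auto)
  then show ?thesis unfolding t(2) hwords_def .
qed

definition ewords :: "int \<Rightarrow> ('v \<Rightarrow> int) \<Rightarrow> 'p list set" where
  "ewords n w = {u \<in> lists E. wdeg edeg u = n \<and> (\<lambda>v. wdeg (\<lambda>e. ewt e v) u) = w}"

lemma represent:
  assumes "x \<in> hpart P n" "x \<in> W w" shows "\<exists>t\<in>supp_in (ewords n w). ev P incl t = x"
proof -
  obtain t where t: "t \<in> \<E>" "ev P incl t = x" using tv_surj hpartD(6) assms by blast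
  let ?N = "\<lambda>(n, w). hpart P n \<inter> W w"
  have "\<exists>t'\<in>supp_in {u \<in> lists E. (wdeg edeg u, \<lambda>v. wdeg (\<lambda>e. ewt e v) u) = (n, w)}. ev P incl t' = ev P incl t"
    by (rule ev_component[OF E_carrier direct_sum_decomposition_indep[OF bigraded] order.refl _ t(1)])
       (use e_word_bi t assms in auto)
  then show ?thesis unfolding t(2) ewords_def prod.inject .
qed

lemma ewords_lists: "ewords n w \<subseteq> lists E" by (auto simp: ewords_def)

lemma wdeg_edeg_nonneg: "u \<in> lists E \<Longrightarrow> 0 \<le> wdeg edeg u"
proof (induction u rule: lists.induct)
  case (Cons e u)
  then show ?case using edeg_nonneg[of e] by simp
qed simp

lemma letter_le_wdeg: "u \<in> lists E \<Longrightarrow> e \<in> set u \<Longrightarrow> edeg e \<le> wdeg edeg u"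
proof (induction u rule: lists.induct)
  case (Cons a u)
  have "0 \<le> edeg a" "0 \<le> wdeg edeg u" using Cons edeg_nonneg wdeg_edeg_nonneg by simp_all
  with Cons show ?case by (cases "e = a") simp_all
qed simp

text \<open>Degrees of generators are non-negative, so no letter exceeds the degree of its word.
  Hence the boundary of a generator is a polynomial in generators of smaller degree, and induction
  on the degree is possible.\<close>

lemma ewords_low: "ewords n w \<subseteq> lists {e \<in> E. edeg e \<le> n}"
proof
  fix u assume "u \<in> ewords n w"
  then have u: "u \<in> lists E" "wdeg edeg u = n" by (simp_all add: ewords_def)
  then show "u \<in> lists {e \<in> E. edeg e \<le> n}" using letter_le_wdeg[OF u(1)] by (simp add: in_lists_conv_set)
qed

lemma prod_list_hwords:
  assumes s: "\<And>e. e \<in> E \<Longrightarrow> s e \<in> supp_in (bwords \<Gamma> (edeg e) (ewt e))" and u: "u \<in> lists E"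
  shows "prod_list (map s u) \<in> supp_in (bwords \<Gamma> (wdeg edeg u) (\<lambda>v. wdeg (\<lambda>e. ewt e v) u))"
  using u
proof (induction u rule: lists.induct)
  case Nil
  show ?case by (simp add: bwords_def supp_in_def zero_list_def)
next
  case (Cons e u)
  then show ?case using supp_in_bwords_mult[OF s Cons.IH] by simp
qed

text \<open>Freeness of \<open>P\<close> enters here: the kernel is spanned by the relations, and a
  substitution that preserves degrees sends them to graded commutators. So a choice of values on
  generators is a map out of \<open>P\<close> modulo \<open>\<C>\<close>.\<close>

lemma subst_kernel:
  assumes s: "\<And>e. e \<in> E \<Longrightarrow> s e \<in> supp_in (bwords \<Gamma> (edeg e) (ewt e))"
    and t: "t \<in> \<E>" "ev P incl t = \<zero>"
  shows "subst s t \<in> \<C>"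
  using t
proof (induction t rule: tv_kernel_induct)
  case (rel r c)
  then obtain u w x y m n where r:
    "r = word (u @ [x, y] @ w) - single (u @ [y, x] @ w) ((- 1) powi (m * n))"
    and *: "u \<in> lists E" "w \<in> lists E" "x \<in> E" "y \<in> E" "x \<in> hpart P m" "y \<in> hpart P n"
    unfolding commutation_relations_def by blast
  have mn: "m = edeg x" "n = edeg y" using * edeg_unique by blast+
  have "subst s r = prod_list (map s u) *
      ((s x * s y - sg (edeg x * edeg y) * (s y * s x)) * prod_list (map s w))"
    unfolding r mn powi_minus_one subst_diff subst_single scal_sg by (simp add: sg_def algebra_simps)
  also have "\<dots> \<in> \<C>"
    by (intro comm_ideal_mult_left comm_ideal_mult_right hom_commute supp_in_bwords_hwords[OF s]
        supp_in_bwords_lists[OF prod_list_hwords[OF s]] *)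
  finally show ?case unfolding subst_scal by (rule comm_ideal_scal)
qed (simp_all add: subst_add comm_ideal.zero comm_ideal_add)

lemma subst_kernel_diff:
  assumes s: "\<And>e. e \<in> E \<Longrightarrow> s e \<in> supp_in (bwords \<Gamma> (edeg e) (ewt e))"
    and t: "t \<in> \<E>" "t' \<in> \<E>" "ev P incl t = ev P incl t'"
  shows "subst s t - subst s t' \<in> \<C>"
proof -
  have "ev P incl (t - t') = \<zero>"
    using t ev_closed[OF E_carrier t(2)] by (simp add: ev_diff[OF E_carrier])
  from subst_kernel[OF s supp_in_diff[OF t(1,2)] this] show ?thesis by (simp add: subst_diff)
qed

text \<open>A section over the generators of degree at most \<open>N\<close>, continued by 0. The
  boundary of \<open>e\<close> is an element of \<open>P\<close> while \<open>subst s\<close> acts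
  on words, so compatibility is demanded for every word representative \<open>f\<close>; by
  \<open>subst_kernel_diff\<close> one representative would decide.\<close>

definition good :: "int \<Rightarrow> ('p \<Rightarrow> ('v, 'k, 'p) lalg) \<Rightarrow> bool" where
  "good N s \<longleftrightarrow> (\<forall>e\<in>E. s e \<in> supp_in (bwords \<Gamma> (edeg e) (ewt e)) \<and>
     (edeg e \<le> N \<longrightarrow> \<g> (s e) = e \<and>
        (\<forall>f\<in>supp_in (ewords (edeg e - 1) (ewt e)). ev P incl f = bdry P e \<longrightarrow> \<d> (s e) - subst s f \<in> \<C>)) \<and>
     (N < edeg e \<longrightarrow> s e = 0))"

lemma goodD:
  assumes "good N s" "e \<in> E"
  shows "s e \<in> supp_in (bwords \<Gamma> (edeg e) (ewt e))"
    and "edeg e \<le> N \<Longrightarrow> \<g> (s e) = e"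
    and "edeg e \<le> N \<Longrightarrow> f \<in> supp_in (ewords (edeg e - 1) (ewt e)) \<Longrightarrow> ev P incl f = bdry P e \<Longrightarrow>
      \<d> (s e) - subst s f \<in> \<C>"
    and "N < edeg e \<Longrightarrow> s e = 0"
  using assms unfolding good_def by simp_all

lemma good_prod_list_lists:
  assumes "good N s" "u \<in> lists E" shows "prod_list (map s u) \<in> \<T>"
  by (rule supp_in_bwords_lists[OF prod_list_hwords[OF goodD(1)[OF assms(1)] assms(2)]])

lemma good_subst_lists:
  assumes "good N s" "t \<in> \<E>" shows "subst s t \<in> \<T>"
  by (rule subst_in[OF good_prod_list_lists[OF assms(1)] assms(2)])

lemma good_subst_hwords:
  assumes "good N s" "t \<in> supp_in (hwords edeg E n)" shows "subst s t \<in> supp_in (hwords ldeg \<Gamma> n)"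
proof (rule subst_in[OF _ assms(2)])
  fix u assume u: "u \<in> hwords edeg E n"
  then have "u \<in> lists E" "wdeg edeg u = n" by (auto simp: hwords_def)
  from supp_in_bwords_hwords[OF prod_list_hwords[OF goodD(1)[OF assms(1)] this(1)]] this(2)
  show "prod_list (map s u) \<in> supp_in (hwords ldeg \<Gamma> n)" by simp
qed

lemma good_subst_bwords:
  assumes "good N s" "t \<in> supp_in (ewords n w)" shows "subst s t \<in> supp_in (bwords \<Gamma> n w)"
proof (rule subst_in[OF _ assms(2)])
  fix u assume u: "u \<in> ewords n w"
  then have "u \<in> lists E" "wdeg edeg u = n" "(\<lambda>v. wdeg (\<lambda>e. ewt e v) u) = w" by (auto simp: ewords_def)
  from prod_list_hwords[OF goodD(1)[OF assms(1)] this(1)] this(2,3)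
  show "prod_list (map s u) \<in> supp_in (bwords \<Gamma> n w)" by simp
qed

lemma good_g_word:
  assumes s: "good N s"
  shows "u \<in> lists {e \<in> E. edeg e \<le> N} \<Longrightarrow> \<g> (prod_list (map s u)) = wordval P incl u"
proof (induction u rule: lists.induct)
  case Nil
  show ?case using g_single[of "[]" 1] by simp
next
  case (Cons e u)
  then have e: "e \<in> E" "edeg e \<le> N" and u: "u \<in> lists E" by auto
  show ?case
    using g_mult[OF supp_in_bwords_lists[OF goodD(1)[OF s e(1)]] good_prod_list_lists[OF s u]]
      goodD(2)[OF s e] Cons.IH by (simp del: wordval_Cons)
qed

lemma low_lists: "t \<in> supp_in (lists {e \<in> E. edeg e \<le> N}) \<Longrightarrow> t \<in> \<E>"
  by (erule supp_in_mono) (use lists_mono[of "{e \<in> E. edeg e \<le> N}" E] in auto)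

lemma good_g:
  assumes s: "good N s"
  shows "t \<in> supp_in (lists {e \<in> E. edeg e \<le> N}) \<Longrightarrow> \<g> (subst s t) = ev P incl t"
proof (induction t rule: supp_in_induct)
  case (single u c)
  then have u: "u \<in> lists E" using low_lists[OF supp_in_single[OF single, of 1]] by (simp add: supp_in_def)
  show ?case using good_g_word[OF s single] good_prod_list_lists[OF s u]
    by (simp add: subst_single g_scal ev_single'[OF E_carrier u])
next
  case (add a b)
  then show ?case using low_lists[of a] low_lists[of b]
    by (simp add: subst_add g_add good_subst_lists[OF s] ev_add[OF E_carrier])
qed simp

text \<open>The section commutes with differentials by the Leibniz rule on both sides. The statement
  passes through a representative \<open>f\<close> of the boundary because substitution is defined
  on words.\<close>

lemma good_d_word:
  assumes s: "good N s"
  shows "u \<in> lists {e \<in> E. edeg e \<le> N} \<Longrightarrow>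
    \<exists>f\<in>\<E>. ev P incl f = bdry P (wordval P incl u) \<and> \<d> (prod_list (map s u)) - subst s f \<in> \<C>"
proof (induction u rule: lists.induct)
  case Nil
  have "bdry P \<one> = \<zero>" by (rule bdry_of_degree_0[OF degree_one])
  then show ?case by (intro bexI[of _ 0]) (auto simp: der_word[of _ _ "[]", simplified] intro: comm_ideal.zero)
next
  case (Cons e u)
  then have e: "e \<in> E" "edeg e \<le> N" and u: "u \<in> lists E" using lists_mono[of "{e \<in> E. edeg e \<le> N}" E] by auto
  obtain f where f: "f \<in> \<E>" "ev P incl f = bdry P (wordval P incl u)"
    "\<d> (prod_list (map s u)) - subst s f \<in> \<C>" using Cons.IH by blast
  obtain r where r: "r \<in> supp_in (ewords (edeg e - 1) (ewt e))" "ev P incl r = bdry P e"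
    using represent[OF bdry_degree[OF E_bi(1)[OF e(1)]] W_bdry[OF E_bi(2)[OF e(1)]]] by blast
  have rl: "r \<in> \<E>" using r(1) ewords_lists by (rule supp_in_mono)
  have el: "word [e] \<in> \<E>" and ul: "word u \<in> \<E>"
    using e u by (auto intro!: supp_in_single)
  \<comment> \<open>The Leibniz expansion of the boundary of \<open>e # u\<close>, with
    \<open>r\<close> and \<open>f\<close> representing the boundaries of \<open>e\<close> and of
    \<open>u\<close>.\<close>
  let ?f = "r * word u + sg (edeg e) * (word [e] * f)"
  have in_E: "?f \<in> \<E>"
    by (intro supp_in_add supp_in_sg supp_in_lists_mult rl ul el f)
  have h: "e \<in> hpart P (edeg e)" "wordval P incl u \<in> hpart P (wdeg edeg u)"
    using E_bi(1)[OF e(1)] e_word_bi[OF u] by blast+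
  have c: "e \<in> carrier P" "wordval P incl u \<in> carrier P" using h hpartD(6) by blast+
  have "ev P incl ?f = ev P incl r \<otimes> ev P incl (word u) \<oplus> sg (edeg e) \<odot> (ev P incl (word [e]) \<otimes> ev P incl f)"
    by (simp only: ev_add[OF E_carrier] ev_sg[OF E_carrier] ev_mult[OF E_carrier]
        supp_in_lists_mult supp_in_sg rl ul el f)
  also have "ev P incl (word u) = wordval P incl u" using ev_single'[OF E_carrier u, of 1] c by simp
  also have "ev P incl (word [e]) = e" using ev_single'[OF E_carrier, of "[e]" 1] e c by (simp del: wordval_Cons)
  finally have "ev P incl ?f = bdry P (wordval P incl (e # u))"
    using bdry_Leibniz[OF h] by (simp del: wordval_Cons add: r(2) f(2) powi_minus_one)
  moreover have "\<d> (prod_list (map s (e # u))) - subst s ?f \<in> \<C>"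
  proof -
    have "\<d> (s e * prod_list (map s u)) = \<d> (s e) * prod_list (map s u) + sg (edeg e) * (s e * \<d> (prod_list (map s u)))"
      by (rule der_mult'[OF supp_in_bwords_hwords[OF goodD(1)[OF s e(1)]]])
    moreover have "subst s ?f = subst s r * prod_list (map s u) + sg (edeg e) * (s e * subst s f)"
      unfolding subst_add subst_sg by (simp add: subst_mult subst_single)
    ultimately have "\<d> (prod_list (map s (e # u))) - subst s ?f =
        (\<d> (s e) - subst s r) * prod_list (map s u) + sg (edeg e) * (s e * (\<d> (prod_list (map s u)) - subst s f))"
      by (simp add: algebra_simps)
    also have "\<dots> \<in> \<C>"
      by (intro comm_ideal_add comm_ideal_sg comm_ideal_mult_left comm_ideal_mult_right f
          goodD(3)[OF s e r] good_prod_list_lists[OF s u] supp_in_bwords_lists[OF goodD(1)[OF s e(1)]])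
    finally show ?thesis .
  qed
  ultimately show ?case using in_E by blast
qed

lemma good_d:
  assumes s: "good N s"
  shows "t \<in> supp_in (lists {e \<in> E. edeg e \<le> N}) \<Longrightarrow>
    \<exists>f\<in>\<E>. ev P incl f = bdry P (ev P incl t) \<and> \<d> (subst s t) - subst s f \<in> \<C>"
proof (induction t rule: supp_in_induct)
  case zero
  show ?case by (rule bexI[of _ 0]) (auto simp: bdry_zero intro: comm_ideal.zero)
next
  case (single u c)
  have u: "u \<in> lists E" using low_lists[OF supp_in_single[OF single, of 1]] by (simp add: supp_in_def)
  have uc: "wordval P incl u \<in> carrier P" using u by (rule wordval_closed[OF E_carrier])
  obtain f where f: "f \<in> \<E>" "ev P incl f = bdry P (wordval P incl u)"
    "\<d> (prod_list (map s u)) - subst s f \<in> \<C>" using good_d_word[OF s single] by blast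
  have "ev P incl (scal c f) = bdry P (ev P incl (single u c))"
    using f uc by (simp add: ev_scal[OF E_carrier] ev_single'[OF E_carrier u] bdry_smult)
  moreover have "\<d> (subst s (single u c)) - subst s (scal c f) \<in> \<C>"
    using comm_ideal_scal[OF f(3), of c] by (simp add: subst_single der_scal subst_scal scal_diff)
  ultimately show ?case using supp_in_scal[OF f(1)] by blast
next
  case (add a b)
  obtain f f' where f: "f \<in> \<E>" "ev P incl f = bdry P (ev P incl a)" "\<d> (subst s a) - subst s f \<in> \<C>"
    and f': "f' \<in> \<E>" "ev P incl f' = bdry P (ev P incl b)" "\<d> (subst s b) - subst s f' \<in> \<C>"
    using add.IH by blast
  have l: "a \<in> \<E>" "b \<in> \<E>" using add.hyps low_lists by blast+
  have "ev P incl (f + f') = bdry P (ev P incl (a + b))"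
    using f f' l by (simp add: ev_add[OF E_carrier] bdry_add ev_closed[OF E_carrier])
  moreover have "\<d> (subst s (a + b)) - subst s (f + f') \<in> \<C>"
    using comm_ideal_add[OF f(3) f'(3)] by (simp add: subst_add der_add algebra_simps)
  ultimately show ?case using supp_in_add[OF f(1) f'(1)] by blast
qed

lemma good_cycle:
  assumes s: "good N s" and t: "t \<in> supp_in (lists {e \<in> E. edeg e \<le> N})" "bdry P (ev P incl t) = \<zero>"
  shows "\<d> (subst s t) \<in> \<C>"
proof -
  obtain f where f: "f \<in> \<E>" "ev P incl f = \<zero>" "\<d> (subst s t) - subst s f \<in> \<C>"
    using good_d[OF s t(1)] t(2) by auto
  from f(3) subst_kernel[OF goodD(1)[OF s] f(1,2)] show ?thesis by (rule comm_ideal_cong)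
qed

lemma ldeg_nonneg: "valid l \<Longrightarrow> 0 \<le> ldeg l"
  by (cases rule: valid.cases) auto

lemma wdeg_ldeg_nonneg: "u \<in> lists \<Gamma> \<Longrightarrow> 0 \<le> wdeg ldeg u"
proof (induction u rule: lists.induct)
  case (Cons l u)
  then show ?case using ldeg_nonneg[of l] by simp
qed simp

text \<open>In positive degree the substituted boundary of \<open>e\<close> is a cycle with the
  right value, and \<open>lift\<close> applies. In degree 0 there is no boundary to match; there
  \<open>e\<close> is a monomial in the variables plus a boundary, both of which are values of
  words.\<close>

lemma section_step:
  assumes s: "good N s" and e: "e \<in> E" "edeg e = N + 1"
  shows "\<exists>q\<in>supp_in (bwords \<Gamma> (edeg e) (ewt e)). \<g> q = e \<and>
    (\<forall>f\<in>supp_in (ewords (edeg e - 1) (ewt e)). ev P incl f = bdry P e \<longrightarrow> \<d> q - subst s f \<in> \<C>)"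
proof (cases "edeg e = 0")
  case True
  have "e \<in> hpart P 0 \<inter> W (ewt e)" using E_bi[OF e(1)] True by simp
  from degree_0_generated[OF this] obtain c us p where p: "p \<in> hpart P 1" "p \<in> W (ewt e)"
    and ep: "e = c \<odot> foldr (\<otimes>) (map xx us) \<one> \<oplus> bdry P p"
    and c: "c = 0 \<or> (\<forall>v. ewt e v = (\<Sum>u\<leftarrow>us. if v = u then 1 else 0))" by blast
  let ?u = "map Var us :: ('v, 'k, 'p) letter list"
  \<comment> \<open>\<open>Base 1\<close> is a letter of degree 0 with value
    \<open>bdry P p\<close>, so it supplies the boundary term.\<close>
  let ?b = "word [Base 1 (ewt e) p] :: ('v, 'k, 'p) lalg"
  let ?q = "single ?u c + ?b"
  have v: "Base 1 (ewt e) p \<in> \<Gamma>" using p by (auto intro: valid.Base)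
  have b: "?b \<in> supp_in (bwords \<Gamma> 0 (ewt e))" using bwords_letter[OF v] by simp
  have ul: "?u \<in> lists \<Gamma>" by (auto intro: valid.Var)
  have wu: "wdeg ldeg ?u = 0" "wdeg (\<lambda>l. lwt l v) ?u = (\<Sum>u\<leftarrow>us. if v = u then 1 else 0)" for v
    by (induction us) auto
  have u: "single ?u c \<in> supp_in (bwords \<Gamma> 0 (ewt e))"
  proof (cases "c = 0")
    case False
    then show ?thesis using c ul wu by (intro supp_in_single) (simp add: bwords_def)
  qed simp
  have wv: "wordval P lval ?u = foldr (\<otimes>) (map xx us) \<one>"
    by (induction us) simp_all
  have bc: "bdry P p \<in> carrier P" using hpartD(6)[OF bdry_degree[OF p(1)]] .
  have "\<g> ?q = \<g> (single ?u c) \<oplus> \<g> ?b"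
    by (rule g_add[OF supp_in_bwords_lists[OF u] supp_in_bwords_lists[OF b]])
  also have "\<dots> = c \<odot> foldr (\<otimes>) (map xx us) \<one> \<oplus> bdry P p" using g_single[OF ul] g_single[of "[Base 1 (ewt e) p]" 1] v bc
    by (simp add: wv)
  also have "\<dots> = e" by (rule ep[symmetric])
  finally have g: "\<g> ?q = e" .
  have q: "?q \<in> supp_in (bwords \<Gamma> 0 (ewt e))" using u b by (rule supp_in_add)
  have "\<d> ?q \<in> supp_in (hwords ldeg \<Gamma> (0 + - 1))"
    by (rule bd.der_in[OF supp_in_bwords_hwords[OF q]])
  \<comment> \<open>Letters have non-negative degree, so degree -1 has no words and the boundary of
    \<open>?q\<close> is literally 0.\<close>
  moreover have "hwords ldeg \<Gamma> (0 + - 1) = {}"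
    using wdeg_ldeg_nonneg unfolding hwords_def by force
  ultimately have dq: "\<d> ?q = 0" by (simp add: supp_in_def)
  have "ewords (- 1) (ewt e) = {}" using wdeg_edeg_nonneg unfolding ewords_def by force
  then have f0: "f = 0" if "f \<in> supp_in (ewords (edeg e - 1) (ewt e))" for f :: "('p, 'k) falg"
    using that True by (simp add: supp_in_def)
  have "\<d> ?q - subst s f \<in> \<C>" if "f \<in> supp_in (ewords (edeg e - 1) (ewt e))" for f
    using f0[OF that] dq by (simp add: comm_ideal.zero)
  then show ?thesis using q g True by (intro bexI[of _ ?q]) simp_all
next
  case False
  then have n: "1 \<le> edeg e" using edeg_nonneg[OF e(1)] by simp
  obtain f where f: "f \<in> supp_in (ewords (edeg e - 1) (ewt e))" "ev P incl f = bdry P e"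
    using represent[OF bdry_degree[OF E_bi(1)[OF e(1)]] W_bdry[OF E_bi(2)[OF e(1)]]] by blast
  have flow: "f \<in> supp_in (lists {e \<in> E. edeg e \<le> N})"
    using f(1) by (rule supp_in_mono) (use ewords_low[of "edeg e - 1"] e(2) in simp)
  have "bdry P (bdry P e) = \<zero>" using bdry_bdry hpartD(6) E_bi[OF e(1)] by blast
  then have "\<d> (subst s f) \<in> \<C>" using good_cycle[OF s flow] f(2) by simp
  moreover have "\<g> (subst s f) = bdry P e" using good_g[OF s flow] f(2) by simp
  ultimately obtain q where q: "q \<in> supp_in (bwords \<Gamma> (edeg e) (ewt e))" "\<g> q = e" "\<d> q - subst s f \<in> \<C>"
    using lift[OF E_bi[OF e(1)] n good_subst_bwords[OF s f(1)]] by blast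
  have "\<d> q - subst s f' \<in> \<C>"
    if "f' \<in> supp_in (ewords (edeg e - 1) (ewt e))" "ev P incl f' = bdry P e" for f'
  proof (rule comm_ideal_trans[OF q(3)])
    show "subst s f - subst s f' \<in> \<C>"
      by (rule subst_kernel_diff[OF goodD(1)[OF s]])
         (use f that supp_in_mono[OF _ ewords_lists] in auto)
  qed
  with q show ?thesis by blast
qed

text \<open>The shift by one lets the induction start at \<open>N = - 1\<close>, below every
  generator, where the zero substitution is good.\<close>

lemma good_exists: "\<exists>s. good (int m - 1) s"
proof (induction m)
  case 0
  have "good (- 1) (\<lambda>_. 0)" unfolding good_def
  proof (intro ballI)
    fix e assume "e \<in> E"
    then have "0 \<le> edeg e" by (rule edeg_nonneg)
    then show "0 \<in> supp_in (bwords \<Gamma> (edeg e) (ewt e)) \<and> (edeg e \<le> - 1 \<longrightarrow> \<g> 0 = e \<and>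
        (\<forall>f\<in>supp_in (ewords (edeg e - 1) (ewt e)). ev P incl f = bdry P e \<longrightarrow> \<d> 0 - subst (\<lambda>_. 0) f \<in> \<C>)) \<and>
      (- 1 < edeg e \<longrightarrow> 0 = (0 :: ('v, 'k, 'p) lalg))"
      by simp
  qed
  then show ?case by auto
next
  case (Suc m)
  let ?N = "int m - 1"
  obtain s where s: "good ?N s" using Suc by blast
  have "\<forall>e. \<exists>q. e \<in> E \<and> edeg e = ?N + 1 \<longrightarrow> q \<in> supp_in (bwords \<Gamma> (edeg e) (ewt e)) \<and> \<g> q = e \<and>
    (\<forall>f\<in>supp_in (ewords (edeg e - 1) (ewt e)). ev P incl f = bdry P e \<longrightarrow> \<d> q - subst s f \<in> \<C>)"
    using section_step[OF s] by blast
  then obtain q where q: "\<And>e. e \<in> E \<Longrightarrow> edeg e = ?N + 1 \<Longrightarrow>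
      q e \<in> supp_in (bwords \<Gamma> (edeg e) (ewt e)) \<and> \<g> (q e) = e \<and>
    (\<forall>f\<in>supp_in (ewords (edeg e - 1) (ewt e)). ev P incl f = bdry P e \<longrightarrow> \<d> (q e) - subst s f \<in> \<C>)"
    using choice by metis
  define s' where "s' = (\<lambda>e. if e \<in> E \<and> edeg e = ?N + 1 then q e else s e)"
  \<comment> \<open>A boundary of degree at most \<open>?N\<close> involves only generators of
    degree at most \<open>?N\<close>, where \<open>s'\<close> and \<open>s\<close> agree.\<close>
  have same: "subst s' f = subst s f" if "f \<in> supp_in (ewords (edeg e - 1) (ewt e))" "edeg e \<le> ?N + 1" for f e
  proof (rule subst_cong)
    show "f \<in> supp_in (lists {e \<in> E. edeg e \<le> ?N})"
      using that(1) by (rule supp_in_mono) (use ewords_low[of "edeg e - 1"] that(2) in fastforce)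
  qed (auto simp: s'_def)
  have "good (?N + 1) s'"
    unfolding good_def
  proof (intro ballI)
    fix e assume e: "e \<in> E"
    show "s' e \<in> supp_in (bwords \<Gamma> (edeg e) (ewt e)) \<and>
     (edeg e \<le> ?N + 1 \<longrightarrow> \<g> (s' e) = e \<and>
        (\<forall>f\<in>supp_in (ewords (edeg e - 1) (ewt e)). ev P incl f = bdry P e \<longrightarrow> \<d> (s' e) - subst s' f \<in> \<C>)) \<and>
     (?N + 1 < edeg e \<longrightarrow> s' e = 0)"
    proof (cases "edeg e = ?N + 1")
      case True
      then have "s' e = q e" using e by (simp add: s'_def)
      then show ?thesis using q[OF e True] same[of _ e] True by simp
    next
      case False
      then have "s' e = s e" by (simp add: s'_def)
      then show ?thesis using goodD[OF s e] same[of _ e] False by simp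
    qed
  qed
  then show ?case by (auto simp: algebra_simps)
qed

end

section \<open>Primitives of cocycles of small weight\<close>

text \<open>The weight of the cocycle enters only through \<open>phi_small\<close>; the other
  assumptions say that \<open>\<epsilon>\<close> is an augmentation and \<open>\<phi>\<close> a
  cocycle of degree \<open>i\<close>.\<close>

locale small_weight_cocycle = free_weighted_cdga P W v0 xx E + S: kalgebra S
  for P :: "('k::field_char_0, 'p) dga" (structure) and W :: "('v \<Rightarrow> int) \<Rightarrow> 'p set"
    and v0 :: 'v and xx :: "'v \<Rightarrow> 'p" and E :: "'p set" and S :: "('k, 's) module" +
  fixes \<epsilon> :: "'p \<Rightarrow> 's" and i :: int and \<phi> :: "'p \<Rightarrow> 's"
  assumes eps_closed: "x \<in> carrier P \<Longrightarrow> \<epsilon> x \<in> carrier S"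
    and eps_add: "x \<in> carrier P \<Longrightarrow> y \<in> carrier P \<Longrightarrow> \<epsilon> (x \<oplus> y) = \<epsilon> x \<oplus>\<^bsub>S\<^esub> \<epsilon> y"
    and eps_mult: "x \<in> carrier P \<Longrightarrow> y \<in> carrier P \<Longrightarrow> \<epsilon> (x \<otimes> y) = \<epsilon> x \<otimes>\<^bsub>S\<^esub> \<epsilon> y"
    and eps_smult: "x \<in> carrier P \<Longrightarrow> \<epsilon> (c \<odot> x) = c \<odot>\<^bsub>S\<^esub> \<epsilon> x"
    and eps_degree: "x \<in> hpart P n \<Longrightarrow> n \<noteq> 0 \<Longrightarrow> \<epsilon> x = \<zero>\<^bsub>S\<^esub>"
    and eps_bdry: "x \<in> carrier P \<Longrightarrow> \<epsilon> (bdry P x) = \<zero>\<^bsub>S\<^esub>"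
    and i2: "2 \<le> i"
    and phi: "\<phi> \<in> derivations P S \<epsilon> i"
    and phi_bdry: "x \<in> carrier P \<Longrightarrow> \<phi> (bdry P x) = \<zero>\<^bsub>S\<^esub>"
    and phi_small: "x \<in> hpart P i \<Longrightarrow> x \<in> W w \<Longrightarrow> w v0 \<le> i - 1 \<Longrightarrow> \<phi> x = \<zero>\<^bsub>S\<^esub>"
begin

section \<open>Values of the cocycle on words\<close>

lemma sg_pred_mult_cancel: "sg m * sg ((i - 1) * m) = (sg (i * m) :: 'a::comm_ring_1)"
  and sg_mult_pred: "sg m * sg (i * m) = (sg ((i - 1) * m) :: 'a::comm_ring_1)"
  by (auto simp: sg_def)

lemma phi_closed: "x \<in> carrier P \<Longrightarrow> \<phi> x \<in> carrier S"
  and phi_add: "x \<in> carrier P \<Longrightarrow> y \<in> carrier P \<Longrightarrow> \<phi> (x \<oplus> y) = \<phi> x \<oplus>\<^bsub>S\<^esub> \<phi> y"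
  and phi_smult: "x \<in> carrier P \<Longrightarrow> \<phi> (c \<odot> x) = c \<odot>\<^bsub>S\<^esub> \<phi> x"
  and phi_degree: "x \<in> hpart P j \<Longrightarrow> j \<noteq> i \<Longrightarrow> \<phi> x = \<zero>\<^bsub>S\<^esub>"
  and phi_mult: "x \<in> hpart P m \<Longrightarrow> y \<in> hpart P n \<Longrightarrow>
    \<phi> (x \<otimes> y) = \<phi> x \<otimes>\<^bsub>S\<^esub> \<epsilon> y \<oplus>\<^bsub>S\<^esub> sg (i * m) \<odot>\<^bsub>S\<^esub> (\<epsilon> x \<otimes>\<^bsub>S\<^esub> \<phi> y)"
  using phi unfolding derivations_def powi_minus_one by (blast dest: PiE_mem)+

lemma eps_zero: "\<epsilon> \<zero> = \<zero>\<^bsub>S\<^esub>"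
  using eps_bdry[of \<zero>] by (simp add: bdry_zero)

lemma phi_zero: "\<phi> \<zero> = \<zero>\<^bsub>S\<^esub>"
  using phi_bdry[of \<zero>] by (simp add: bdry_zero)

abbreviation cone where "cone \<equiv> der ldeg (lcone :: _ \<Rightarrow> ('v, 'k, 'p) lalg)"

lemma eps_lval_cone:
  assumes "valid l" "\<not> core l" shows "\<epsilon> (lval l) = \<zero>\<^bsub>S\<^esub>"
  using assms
proof cases
  case (Cone n p w)
  then show ?thesis using eps_degree[of p n] by simp
next
  case (Base n p w)
  then show ?thesis using eps_bdry hpartD(6) by simp
qed simp_all

lemma eps_word_cone:
  "u \<in> lists \<Gamma> \<Longrightarrow> ncone u \<noteq> 0 \<Longrightarrow> \<epsilon> (wordval P lval u) = \<zero>\<^bsub>S\<^esub>"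
proof (induction u rule: lists.induct)
  case (Cons l u)
  then have l: "valid l" by simp
  have c: "lval l \<in> carrier P" "wordval P lval u \<in> carrier P"
    using lval_bi[OF l] hpartD(6) wordval_closed[OF lval_closed Cons.hyps(2)] by blast+
  have "\<epsilon> (lval l) = \<zero>\<^bsub>S\<^esub> \<or> \<epsilon> (wordval P lval u) = \<zero>\<^bsub>S\<^esub>"
  proof (cases "core l")
    case True
    with Cons.prems have "ncone u \<noteq> 0" by simp
    with Cons.IH show ?thesis by blast
  next
    case False
    with l show ?thesis using eps_lval_cone by blast
  qed
  then show ?case using c eps_closed[OF c(1)] eps_closed[OF c(2)] by (auto simp: eps_mult)
qed simp

text \<open>The point of the weight bound: a \<open>Kill\<close> letter of degree \<open>i\<close>
  has \<open>v0\<close>-weight at most \<open>max (i - 1) 1\<close>, which is \<open>i - 1\<close>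
  because \<open>i \<ge> 2\<close>. Letters of other degrees are killed for degree reasons.\<close>

lemma phi_lval_core:
  assumes "valid l" "core l" shows "\<phi> (lval l) = \<zero>\<^bsub>S\<^esub>"
  using assms
proof cases
  case (Var u)
  have "xx u \<in> hpart P 0" using xx by blast
  then show ?thesis using Var phi_degree[of "xx u" 0] i2 by simp
next
  case (Kill n w p L)
  then show ?thesis using phi_degree[of p n] phi_small[of p w] i2 by (cases "n = i") simp_all
qed simp_all

text \<open>Each Leibniz term applies \<open>\<phi>\<close> to one letter and
  \<open>\<epsilon>\<close> to the others. Without a letter of a pair \<open>\<phi>\<close> meets a
  core letter; with two or more, one of them remains under \<open>\<epsilon>\<close>. Both give
  0.\<close>

lemma phi_word_cone:
  "u \<in> lists \<Gamma> \<Longrightarrow> ncone u \<noteq> 1 \<Longrightarrow> \<phi> (wordval P lval u) = \<zero>\<^bsub>S\<^esub>"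
proof (induction u rule: lists.induct)
  case Nil
  show ?case using phi_degree[OF degree_one] i2 by simp
next
  case (Cons l u)
  then have l: "valid l" by simp
  have h: "lval l \<in> hpart P (ldeg l)" "wordval P lval u \<in> hpart P (wdeg ldeg u)"
    using lval_bi[OF l] wordval_bi[OF Cons.hyps(2)] by blast+
  have c: "lval l \<in> carrier P" "wordval P lval u \<in> carrier P" using h hpartD(6) by blast+
  note cS = eps_closed[OF c(1)] eps_closed[OF c(2)] phi_closed[OF c(1)] phi_closed[OF c(2)]
  show ?case
  proof (cases "core l")
    case True
    with Cons.prems have "ncone u \<noteq> 1" by simp
    then have "\<phi> (wordval P lval u) = \<zero>\<^bsub>S\<^esub>" by (rule Cons.IH)
    then show ?thesis using phi_mult[OF h] phi_lval_core[OF l True] cS by simp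
  next
    case False
    with Cons.prems have "\<epsilon> (wordval P lval u) = \<zero>\<^bsub>S\<^esub>" using Cons.hyps by (intro eps_word_cone) simp_all
    then show ?thesis using phi_mult[OF h] eps_lval_cone[OF l False] cS by simp
  qed
qed

text \<open>Apply the cocycle to the anticommutator formula: the term that ends with the
  differential vanishes, and the factor \<open>ncone u\<close> is 1 wherever the cocycle is
  non-zero.\<close>

lemma phi_cone_d_word:
  assumes u: "u \<in> lists \<Gamma>"
  shows "\<phi> (\<g> (cone (derw ldeg lbd u))) = \<phi> (wordval P lval u)"
proof -
  have wl: "word u \<in> \<T>" using u by (rule supp_in_single)
  have hl: "derw ldeg lcone u \<in> \<T>" using cone.der_in_lists[OF wl] by simp
  have dhl: "\<d> (derw ldeg lcone u) \<in> \<T>" using hl by (rule bd.der_in_lists)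
  have hdl: "cone (derw ldeg lbd u) \<in> \<T>" using derw_lists[OF u] by (rule cone.der_in_lists)
  have c: "wordval P lval u \<in> carrier P" using u by (rule wordval_closed[OF lval_closed])
  have "\<g> (\<d> (derw ldeg lcone u) + cone (derw ldeg lbd u)) = of_nat (ncone u) \<odot> wordval P lval u"
    using anticommutator_word[OF u] g_single[OF u] by simp
  then have "bdry P (\<g> (derw ldeg lcone u)) \<oplus> \<g> (cone (derw ldeg lbd u)) = of_nat (ncone u) \<odot> wordval P lval u"
    using g_add[OF dhl hdl] g_bd[OF hl] by simp
  then have "\<phi> (bdry P (\<g> (derw ldeg lcone u)) \<oplus> \<g> (cone (derw ldeg lbd u))) = \<phi> (of_nat (ncone u) \<odot> wordval P lval u)"
    by (rule arg_cong)
  moreover have "bdry P (\<g> (derw ldeg lcone u)) \<in> carrier P"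
    using g_closed[OF dhl] g_bd[OF hl] by simp
  ultimately have "\<phi> (\<g> (cone (derw ldeg lbd u))) = of_nat (ncone u) \<odot>\<^bsub>S\<^esub> \<phi> (wordval P lval u)"
    using phi_bdry[OF g_closed[OF hl]] phi_closed g_closed[OF hdl] c by (simp add: phi_add phi_smult)
  also have "\<dots> = \<phi> (wordval P lval u)"
    using phi_word_cone[OF u] phi_closed[OF c] by (cases "ncone u = 1") simp_all
  finally show ?thesis .
qed

lemma phi_cone_d:
  "t \<in> \<T> \<Longrightarrow> \<phi> (\<g> (cone (\<d> t))) = \<phi> (\<g> t)"
proof (induction t rule: supp_in_induct)
  case (single u c)
  have l: "cone (derw ldeg lbd u) \<in> \<T>"
    by (rule cone.der_in_lists[OF derw_lists[OF single]])
  have "wordval P lval u \<in> carrier P" using single by (rule wordval_closed[OF lval_closed])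
  then show ?case using phi_cone_d_word[OF single] g_closed[OF l]
    by (simp add: der_single der_scal g_scal[OF l] g_single[OF single] phi_smult)
next
  case (add s t)
  have l: "cone (\<d> s) \<in> \<T>" "cone (\<d> t) \<in> \<T>"
    using add.hyps bd.der_in_lists cone.der_in_lists by blast+
  show ?case using add.IH g_closed[OF l(1)] g_closed[OF l(2)] g_closed[OF add.hyps(1)] g_closed[OF add.hyps(2)]
    by (simp add: der_add g_add l add.hyps phi_add)
qed simp

text \<open>The contraction raises degrees, which are non-negative, so its image has positive
  degree, where \<open>\<epsilon>\<close> vanishes.\<close>

lemma eps_cone: "t \<in> \<T> \<Longrightarrow> \<epsilon> (\<g> (cone t)) = \<zero>\<^bsub>S\<^esub>"
proof (induction t rule: supp_in_induct)
  case (single u c)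
  have "u \<in> hwords ldeg \<Gamma> (wdeg ldeg u)" using single by (simp add: hwords_def)
  then have "cone (single u c) \<in> supp_in (hwords ldeg \<Gamma> (wdeg ldeg u + 1))"
    by (intro cone.der_in supp_in_single)
  from g_hpart[OF this] show ?case
    by (rule eps_degree) (use wdeg_ldeg_nonneg[OF single] in simp)
next
  case (add s t)
  then show ?case by (simp add: der_add g_add cone.der_in_lists eps_add g_closed)
qed (simp add: eps_zero)

section \<open>The primitive obtained from a section\<close>

context
  fixes s :: "'p \<Rightarrow> ('v, 'k, 'p) lalg"
  assumes s: "good i s"
begin

lemma eps_section_word: "u \<in> lists E \<Longrightarrow> \<epsilon> (\<g> (prod_list (map s u))) = \<epsilon> (wordval P incl u)"
proof (induction u rule: lists.induct)
  case Nil
  show ?case using g_single[of "[]" 1] by simp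
next
  case (Cons e u)
  have se: "s e \<in> \<T>" by (rule supp_in_bwords_lists[OF goodD(1)[OF s Cons.hyps(1)]])
  have pl: "prod_list (map s u) \<in> \<T>" by (rule good_prod_list_lists[OF s Cons.hyps(2)])
  have c: "e \<in> carrier P" "wordval P incl u \<in> carrier P"
    using hpartD(6)[OF E_bi(1)[OF Cons.hyps(1)]] wordval_closed[OF E_carrier Cons.hyps(2)] by blast+
  have "\<epsilon> (\<g> (s e)) = \<epsilon> e"
  proof (cases "edeg e \<le> i")
    case True
    then show ?thesis using goodD(2)[OF s Cons.hyps(1)] by simp
  next
    case False
    then show ?thesis
      using goodD(4)[OF s Cons.hyps(1)] eps_degree[OF E_bi(1)[OF Cons.hyps(1)]] i2 by (simp add: eps_zero)
  qed
  then show ?case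
    using Cons.IH c g_closed[OF se] g_closed[OF pl]
    by (simp del: wordval_Cons add: g_mult[OF se pl] eps_mult)
qed

lemma eps_section: "t \<in> \<E> \<Longrightarrow> \<epsilon> (\<g> (subst s t)) = \<epsilon> (ev P incl t)"
proof (induction t rule: supp_in_induct)
  case (single u c)
  have l: "prod_list (map s u) \<in> \<T>" by (rule good_prod_list_lists[OF s single])
  show ?case
    using eps_section_word[OF single] wordval_closed[OF E_carrier single] g_closed[OF l]
    by (simp add: subst_single g_scal[OF l] ev_single'[OF E_carrier single] eps_smult)
next
  case (add a b)
  have l: "subst s a \<in> \<T>" "subst s b \<in> \<T>"
    using good_subst_lists[OF s] add.hyps by blast+
  show ?case
    using add.IH g_closed[OF l(1)] g_closed[OF l(2)] ev_closed[OF E_carrier add.hyps(1)] ev_closed[OF E_carrier add.hyps(2)]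
    by (simp add: subst_add g_add l ev_add[OF E_carrier add.hyps] eps_add)
qed (simp add: eps_zero)

text \<open>Pull \<open>\<phi>\<close> back to the enlarged algebra, compose it with the
  contraction, and restrict along the section. Descent to \<open>P\<close> is
  \<open>primitive_word_eq\<close>.\<close>

definition primitive_word :: "('p, 'k) falg \<Rightarrow> 's" where
  "primitive_word t = \<phi> (\<g> (cone (subst s t)))"

definition primitive :: "'p \<Rightarrow> 's" where
  "primitive = (\<lambda>x\<in>carrier P. primitive_word (SOME t. t \<in> \<E> \<and> ev P incl t = x))"

lemma cone_subst_lists: "t \<in> \<E> \<Longrightarrow> cone (subst s t) \<in> \<T>"
  by (rule cone.der_in_lists[OF good_subst_lists[OF s]])

lemma primitive_word_closed: "t \<in> \<E> \<Longrightarrow> primitive_word t \<in> carrier S"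
  unfolding primitive_word_def by (rule phi_closed[OF g_closed[OF cone_subst_lists]])

lemma primitive_word_add:
  "t \<in> \<E> \<Longrightarrow> t' \<in> \<E> \<Longrightarrow>
    primitive_word (t + t') = primitive_word t \<oplus>\<^bsub>S\<^esub> primitive_word t'"
  using cone_subst_lists[of t] cone_subst_lists[of t'] g_closed[OF cone_subst_lists]
  unfolding primitive_word_def by (simp add: subst_add der_add g_add phi_add)

lemma primitive_word_scal:
  "t \<in> \<E> \<Longrightarrow> primitive_word (scal c t) = c \<odot>\<^bsub>S\<^esub> primitive_word t"
  using cone_subst_lists[of t] g_closed[OF cone_subst_lists]
  unfolding primitive_word_def by (simp add: subst_scal der_scal g_scal phi_smult)

lemma primitive_word_kernel:
  assumes "t \<in> \<E>" "ev P incl t = \<zero>" shows "primitive_word t = \<zero>\<^bsub>S\<^esub>"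
proof -
  have "cone (subst s t) \<in> \<C>"
    by (rule cone.der_comm_ideal[OF subst_kernel[OF goodD(1)[OF s] assms]])
  then show ?thesis unfolding primitive_word_def using g_comm_ideal phi_zero by simp
qed

lemma primitive_word_eq:
  assumes t: "t \<in> \<E>" "t' \<in> \<E>" "ev P incl t = ev P incl t'"
  shows "primitive_word t = primitive_word t'"
proof -
  have d: "t - t' \<in> \<E>" using t by (intro supp_in_diff)
  have "ev P incl (t - t') = \<zero>"
    using t ev_closed[OF E_carrier t(2)] by (simp add: ev_diff[OF E_carrier])
  with d have "primitive_word (t - t') = \<zero>\<^bsub>S\<^esub>" by (rule primitive_word_kernel)
  then show ?thesis
    using primitive_word_add[OF d t(2)] primitive_word_closed[OF t(2)] by simp
qed

lemma primitive_ev: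
  assumes t: "t \<in> \<E>" shows "primitive (ev P incl t) = primitive_word t"
proof -
  let ?t = "SOME t'. t' \<in> \<E> \<and> ev P incl t' = ev P incl t"
  have "?t \<in> \<E> \<and> ev P incl ?t = ev P incl t"
    by (rule someI[of _ t]) (simp add: t)
  then have "primitive_word ?t = primitive_word t" using t by (intro primitive_word_eq) simp_all
  then show ?thesis unfolding primitive_def using ev_closed[OF E_carrier t] by simp
qed

lemma primitive_closed: "x \<in> carrier P \<Longrightarrow> primitive x \<in> carrier S"
proof -
  assume "x \<in> carrier P"
  then obtain t where "t \<in> \<E>" "ev P incl t = x" using tv_surj by blast
  then show ?thesis using primitive_ev primitive_word_closed by metis
qed

lemma primitive_add:
  assumes "x \<in> carrier P" "y \<in> carrier P"
  shows "primitive (x \<oplus> y) = primitive x \<oplus>\<^bsub>S\<^esub> primitive y"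
proof -
  obtain t t' where t: "t \<in> \<E>" "ev P incl t = x" "t' \<in> \<E>" "ev P incl t' = y"
    using tv_surj[OF assms(1)] tv_surj[OF assms(2)] by blast
  have "x \<oplus> y = ev P incl (t + t')" using t by (simp add: ev_add[OF E_carrier])
  then show ?thesis
    using primitive_ev[OF supp_in_add[OF t(1,3)]] primitive_ev[OF t(1)] primitive_ev[OF t(3)] t
    by (simp add: primitive_word_add)
qed

lemma primitive_smult:
  assumes "x \<in> carrier P" shows "primitive (c \<odot> x) = c \<odot>\<^bsub>S\<^esub> primitive x"
proof -
  obtain t where t: "t \<in> \<E>" "ev P incl t = x" using tv_surj[OF assms] by blast
  have "c \<odot> x = ev P incl (scal c t)" using t by (simp add: ev_scal[OF E_carrier])
  then show ?thesis
    using primitive_ev[OF supp_in_scal[OF t(1)]] primitive_ev[OF t(1)] t by (simp add: primitive_word_scal)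
qed

lemma hwords_E_lists: "t \<in> supp_in (hwords edeg E n) \<Longrightarrow> t \<in> \<E>"
  by (rule supp_in_mono[OF _ hwords_lists])

lemma cone_subst_hpart:
  "t \<in> supp_in (hwords edeg E n) \<Longrightarrow> \<g> (cone (subst s t)) \<in> hpart P (n + 1)"
  by (rule g_hpart[OF cone.der_in[OF good_subst_hwords[OF s]]])

lemma primitive_degree:
  assumes "x \<in> hpart P j" "j \<noteq> i - 1" shows "primitive x = \<zero>\<^bsub>S\<^esub>"
proof -
  obtain t where t: "t \<in> supp_in (hwords edeg E j)" "ev P incl t = x"
    using represent_degree[OF assms(1)] by blast
  have "primitive x = primitive_word t" using primitive_ev[OF hwords_E_lists[OF t(1)]] t(2) by simp
  also have "\<dots> = \<zero>\<^bsub>S\<^esub>"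
    unfolding primitive_word_def by (rule phi_degree[OF cone_subst_hpart[OF t(1)]]) (use assms(2) in simp)
  finally show ?thesis .
qed

text \<open>In the Leibniz expansion of \<open>cone\<close> on a product, the terms in which
  \<open>\<epsilon>\<close> falls on a contracted factor vanish by \<open>eps_cone\<close>. The
  surviving signs combine as \<open>sg m * sg (i * m) = sg ((i - 1) * m)\<close>, the sign of a
  derivation of degree \<open>i - 1\<close>.\<close>

lemma primitive_mult:
  assumes x: "x \<in> hpart P m" and y: "y \<in> hpart P n"
  shows "primitive (x \<otimes> y) = primitive x \<otimes>\<^bsub>S\<^esub> \<epsilon> y \<oplus>\<^bsub>S\<^esub> sg ((i - 1) * m) \<odot>\<^bsub>S\<^esub> (\<epsilon> x \<otimes>\<^bsub>S\<^esub> primitive y)"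
proof -
  obtain t where t: "t \<in> supp_in (hwords edeg E m)" "ev P incl t = x" using represent_degree[OF x] by blast
  obtain r where r: "r \<in> supp_in (hwords edeg E n)" "ev P incl r = y" using represent_degree[OF y] by blast
  note tl = hwords_E_lists[OF t(1)] and rl = hwords_E_lists[OF r(1)]
  define a where "a = \<g> (subst s t)"
  define b where "b = \<g> (subst s r)"
  define a' where "a' = \<g> (cone (subst s t))"
  define b' where "b' = \<g> (cone (subst s r))"
  have h: "a \<in> hpart P m" "b \<in> hpart P n" "a' \<in> hpart P (m + 1)" "b' \<in> hpart P (n + 1)"
    unfolding a_def b_def a'_def b'_def
    using g_hpart[OF good_subst_hwords[OF s t(1)]] g_hpart[OF good_subst_hwords[OF s r(1)]]
      cone_subst_hpart[OF t(1)] cone_subst_hpart[OF r(1)] by simp_all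
  have c: "a \<in> carrier P" "b \<in> carrier P" "a' \<in> carrier P" "b' \<in> carrier P" using h hpartD(6) by blast+
  note cS = eps_closed[OF c(1)] eps_closed[OF c(2)] phi_closed[OF c(1)] phi_closed[OF c(2)]
    phi_closed[OF c(3)] phi_closed[OF c(4)]
  have e: "\<epsilon> a = \<epsilon> x" "\<epsilon> b = \<epsilon> y" "\<epsilon> a' = \<zero>\<^bsub>S\<^esub>" "\<epsilon> b' = \<zero>\<^bsub>S\<^esub>"
    unfolding a_def b_def a'_def b'_def
    using eps_section[OF tl] eps_section[OF rl] t(2) r(2)
      eps_cone[OF good_subst_lists[OF s tl]] eps_cone[OF good_subst_lists[OF s rl]] by simp_all
  have p: "primitive x = \<phi> a'" "primitive y = \<phi> b'"
    unfolding a'_def b'_def using primitive_ev[OF tl] primitive_ev[OF rl] t(2) r(2)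
    by (simp_all add: primitive_word_def)
  note L = good_subst_lists[OF s tl] good_subst_lists[OF s rl] cone_subst_lists[OF tl] cone_subst_lists[OF rl]
  have "\<g> (cone (subst s (t * r))) = \<g> (cone (subst s t) * subst s r + sg m * (subst s t * cone (subst s r)))"
    unfolding subst_mult der_mult'[OF good_subst_hwords[OF s t(1)]] ..
  also have "\<dots> = a' \<otimes> b \<oplus> sg m \<odot> (a \<otimes> b')"
    unfolding a_def b_def a'_def b'_def
    by (simp only: g_add g_sg g_mult supp_in_lists_mult supp_in_sg L)
  finally have "primitive_word (t * r) = \<phi> (a' \<otimes> b) \<oplus>\<^bsub>S\<^esub> sg m \<odot>\<^bsub>S\<^esub> \<phi> (a \<otimes> b')"
    unfolding primitive_word_def using c by (simp add: phi_add phi_smult)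
  also have "\<phi> (a' \<otimes> b) = \<phi> a' \<otimes>\<^bsub>S\<^esub> \<epsilon> y"
    using phi_mult[OF h(3,2)] e cS by simp
  also have "\<phi> (a \<otimes> b') = sg (i * m) \<odot>\<^bsub>S\<^esub> (\<epsilon> x \<otimes>\<^bsub>S\<^esub> \<phi> b')"
    using phi_mult[OF h(1,4)] e cS by simp
  also have "sg m \<odot>\<^bsub>S\<^esub> (sg (i * m) \<odot>\<^bsub>S\<^esub> (\<epsilon> x \<otimes>\<^bsub>S\<^esub> \<phi> b')) = sg ((i - 1) * m) \<odot>\<^bsub>S\<^esub> (\<epsilon> x \<otimes>\<^bsub>S\<^esub> \<phi> b')"
    using cS e by (simp add: S.k_assoc sg_mult_pred)
  finally show ?thesis
    using primitive_ev[OF supp_in_lists_mult[OF tl rl]] t(2) r(2) p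
    by (simp add: ev_mult[OF E_carrier tl rl])
qed

lemma primitive_derivation: "primitive \<in> derivations P S \<epsilon> (i - 1)"
  unfolding derivations_def powi_minus_one mem_Collect_eq
proof (intro conjI allI ballI impI)
  show "primitive \<in> carrier P \<rightarrow>\<^sub>E carrier S"
    by (rule PiE_I) (simp_all add: primitive_closed, simp add: primitive_def)
qed (simp_all only: primitive_add primitive_smult primitive_mult primitive_degree[rotated])

text \<open>Up to degree \<open>i\<close> the section turns the boundary of \<open>e\<close> into
  \<open>\<d> (s e)\<close> modulo relations, and \<open>phi_cone_d\<close> returns the value of
  \<open>\<phi>\<close> on \<open>\<g> (s e) = e\<close>. Above degree \<open>i\<close> both sides
  vanish by degree.\<close>

lemma primitive_bdry_letter:
  assumes e: "e \<in> E" shows "primitive (bdry P e) = \<phi> e"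
proof (cases "edeg e \<le> i")
  case False
  have "primitive (bdry P e) = \<zero>\<^bsub>S\<^esub>"
    by (rule primitive_degree[OF bdry_degree[OF E_bi(1)[OF e]]]) (use False in simp)
  moreover have "\<phi> e = \<zero>\<^bsub>S\<^esub>" by (rule phi_degree[OF E_bi(1)[OF e]]) (use False in simp)
  ultimately show ?thesis by simp
next
  case True
  obtain f where f: "f \<in> supp_in (ewords (edeg e - 1) (ewt e))" "ev P incl f = bdry P e"
    using represent[OF bdry_degree[OF E_bi(1)[OF e]] W_bdry[OF E_bi(2)[OF e]]] by blast
  have fl: "f \<in> \<E>" using f(1) ewords_lists by (rule supp_in_mono)
  have sl: "s e \<in> \<T>" by (rule supp_in_bwords_lists[OF goodD(1)[OF s e]])
  have cl: "cone (\<d> (s e)) \<in> \<T>" using sl by (intro cone.der_in_lists bd.der_in_lists)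
  have "cone (\<d> (s e) - subst s f) \<in> \<C>"
    by (rule cone.der_comm_ideal[OF goodD(3)[OF s e True f]])
  then have "\<g> (cone (\<d> (s e)) - cone (subst s f)) = \<zero>"
    using g_comm_ideal unfolding der_diff by blast
  then have "\<g> (cone (subst s f)) = \<g> (cone (\<d> (s e)))"
    using g_closed[OF cl] g_closed[OF cone_subst_lists[OF fl]] by (simp add: g_diff[OF cl cone_subst_lists[OF fl]])
  then have "primitive_word f = \<phi> (\<g> (s e))"
    unfolding primitive_word_def using phi_cone_d[OF sl] by simp
  then show ?thesis using primitive_ev[OF fl] f(2) goodD(2)[OF s e True] by simp
qed

lemma primitive_zero: "primitive \<zero> = \<zero>\<^bsub>S\<^esub>"
  using primitive_ev[OF supp_in_zero] primitive_word_kernel[OF supp_in_zero] by simp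

text \<open>The primitive composed with the boundary obeys the same Leibniz rule as
  \<open>\<phi>\<close>, since \<open>\<epsilon>\<close> vanishes on boundaries; agreement on
  generators therefore passes to words.\<close>

lemma primitive_bdry_word: "u \<in> lists E \<Longrightarrow> primitive (bdry P (wordval P incl u)) = \<phi> (wordval P incl u)"
proof (induction u rule: lists.induct)
  case Nil
  have "bdry P \<one> = \<zero>" by (rule bdry_of_degree_0[OF degree_one])
  then show ?case using phi_degree[OF degree_one] i2 by (simp add: primitive_zero)
next
  case (Cons e u)
  let ?w = "wordval P incl u"
  have h: "e \<in> hpart P (edeg e)" "?w \<in> hpart P (wdeg edeg u)"
    using E_bi(1)[OF Cons.hyps(1)] e_word_bi[OF Cons.hyps(2)] by blast+
  note bh = bdry_degree[OF h(1)] bdry_degree[OF h(2)]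
  have c: "e \<in> carrier P" "?w \<in> carrier P" "bdry P e \<in> carrier P" "bdry P ?w \<in> carrier P"
    using h bh hpartD(6) by blast+
  note cS = eps_closed[OF c(1)] eps_closed[OF c(2)] phi_closed[OF c(1)] phi_closed[OF c(2)]
    primitive_closed[OF c(1)] primitive_closed[OF c(2)]
  have "bdry P (e \<otimes> ?w) = bdry P e \<otimes> ?w \<oplus> sg (edeg e) \<odot> (e \<otimes> bdry P ?w)"
    using bdry_Leibniz[OF h] by (simp only: powi_minus_one)
  then have "primitive (bdry P (e \<otimes> ?w)) =
      primitive (bdry P e \<otimes> ?w) \<oplus>\<^bsub>S\<^esub> sg (edeg e) \<odot>\<^bsub>S\<^esub> primitive (e \<otimes> bdry P ?w)"
    using c by (simp add: primitive_add primitive_smult)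
  also have "primitive (bdry P e \<otimes> ?w) = \<phi> e \<otimes>\<^bsub>S\<^esub> \<epsilon> ?w"
    using primitive_mult[OF bh(1) h(2)] primitive_bdry_letter[OF Cons.hyps(1)] eps_bdry[OF c(1)] cS by simp
  also have "primitive (e \<otimes> bdry P ?w) = sg ((i - 1) * edeg e) \<odot>\<^bsub>S\<^esub> (\<epsilon> e \<otimes>\<^bsub>S\<^esub> \<phi> ?w)"
    using primitive_mult[OF h(1) bh(2)] Cons.IH eps_bdry[OF c(2)] cS by simp
  also have "sg (edeg e) \<odot>\<^bsub>S\<^esub> (sg ((i - 1) * edeg e) \<odot>\<^bsub>S\<^esub> (\<epsilon> e \<otimes>\<^bsub>S\<^esub> \<phi> ?w)) =
      sg (i * edeg e) \<odot>\<^bsub>S\<^esub> (\<epsilon> e \<otimes>\<^bsub>S\<^esub> \<phi> ?w)"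
    using cS by (simp add: S.k_assoc sg_pred_mult_cancel)
  finally show ?case using phi_mult[OF h] by (simp del: wordval_Cons)
qed

lemma primitive_bdry:
  assumes "x \<in> carrier P" shows "primitive (bdry P x) = \<phi> x"
proof -
  \<comment> \<open>Closure is carried through the induction because \<open>bdry_degree\<close>
    provides it for homogeneous elements.\<close>
  have "bdry P (ev P incl t) \<in> carrier P \<and> primitive (bdry P (ev P incl t)) = \<phi> (ev P incl t)"
    if "t \<in> \<E>" for t
    using that
  proof (induction t rule: supp_in_induct)
    case zero
    show ?case by (simp add: bdry_zero primitive_zero phi_zero)
  next
    case (single u c)
    have w: "wordval P incl u \<in> carrier P" using single by (rule wordval_closed[OF E_carrier])
    have "bdry P (wordval P incl u) \<in> hpart P (wdeg edeg u - 1)"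
      using e_word_bi[OF single] by (intro bdry_degree) blast
    then have "bdry P (wordval P incl u) \<in> carrier P" by (rule hpartD(6))
    then show ?case using w primitive_bdry_word[OF single]
      by (simp add: ev_single'[OF E_carrier single] bdry_smult primitive_smult phi_smult)
  next
    case (add a b)
    then show ?case
      using ev_closed[OF E_carrier add.hyps(1)] ev_closed[OF E_carrier add.hyps(2)]
      by (simp add: ev_add[OF E_carrier] bdry_add primitive_add phi_add)
  qed
  moreover obtain t where "t \<in> \<E>" "ev P incl t = x" using tv_surj[OF assms] by blast
  ultimately show ?thesis by blast
qed

end

theorem primitive_exists:
  "\<exists>\<psi>\<in>derivations P S \<epsilon> (i - 1). \<forall>x\<in>carrier P. \<psi> (bdry P x) = \<phi> x"
proof -
  obtain s where s: "good (int (nat (i + 1)) - 1) s" using good_exists by blast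
  have "int (nat (i + 1)) - 1 = i" using i2 by simp
  with s have "good i s" by simp
  then show ?thesis using primitive_derivation primitive_bdry by blast
qed

end

section \<open>Stanley-Reisner rings\<close>

context
  fixes \<K> :: "'v::finite set set"
  assumes complex: "simplicial_complex \<K>"
begin

section \<open>Computing with residue classes of polynomials\<close>

definition cls :: "('v, 'k::field) mvpoly \<Rightarrow> ('v, 'k) mvpoly set" where
  "cls p = stanley_reisner_ideal \<K> +>\<^bsub>mvpoly_ring\<^esub> p"

lemma ideal_SR: "ideal (stanley_reisner_ideal \<K>) (mvpoly_ring :: ('v, 'k::field) mvpoly ring)"
proof -
  interpret ring "mvpoly_ring :: ('v, 'k) mvpoly ring" by (rule ring_from_type_algebra)
  show ?thesis unfolding stanley_reisner_ideal_def by (rule genideal_ideal) simp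
qed

lemma SR_ideal_closed:
  shows "(0 :: ('v, 'k::field) mvpoly) \<in> stanley_reisner_ideal \<K>"
    and "p \<in> stanley_reisner_ideal \<K> \<Longrightarrow> q \<in> stanley_reisner_ideal \<K> \<Longrightarrow>
      p + q \<in> (stanley_reisner_ideal \<K> :: ('v, 'k) mvpoly set)"
    and "p \<in> stanley_reisner_ideal \<K> \<Longrightarrow> r * p \<in> (stanley_reisner_ideal \<K> :: ('v, 'k) mvpoly set)"
    and "p \<in> stanley_reisner_ideal \<K> \<Longrightarrow> - p \<in> (stanley_reisner_ideal \<K> :: ('v, 'k) mvpoly set)"
    and "p \<in> stanley_reisner_ideal \<K> \<Longrightarrow> q \<in> stanley_reisner_ideal \<K> \<Longrightarrow>
      p - q \<in> (stanley_reisner_ideal \<K> :: ('v, 'k) mvpoly set)"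
proof -
  interpret ideal "stanley_reisner_ideal \<K>" "mvpoly_ring :: ('v, 'k) mvpoly ring" by (rule ideal_SR)
  show "(0 :: ('v, 'k) mvpoly) \<in> stanley_reisner_ideal \<K>" 
    using additive_subgroup.zero_closed[OF is_additive_subgroup] by simp
  show add: "p \<in> stanley_reisner_ideal \<K> \<Longrightarrow> q \<in> stanley_reisner_ideal \<K> \<Longrightarrow>
      p + q \<in> (stanley_reisner_ideal \<K> :: ('v, 'k) mvpoly set)" for p q using additive_subgroup.a_closed[OF is_additive_subgroup, of p q] by simp
  show mult: "p \<in> stanley_reisner_ideal \<K> \<Longrightarrow> r * p \<in> (stanley_reisner_ideal \<K> :: ('v, 'k) mvpoly set)" for p r
    using I_l_closed[of p r] by simp
  show neg: "p \<in> stanley_reisner_ideal \<K> \<Longrightarrow> - p \<in> (stanley_reisner_ideal \<K> :: ('v, 'k) mvpoly set)" for p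
    using mult[of p "- 1"] by simp
  show "p \<in> stanley_reisner_ideal \<K> \<Longrightarrow> q \<in> stanley_reisner_ideal \<K> \<Longrightarrow>
      p - q \<in> (stanley_reisner_ideal \<K> :: ('v, 'k) mvpoly set)"
    using add[of p "- q"] neg[of q] by simp
qed

lemma cls_eq_iff: "cls p = cls q \<longleftrightarrow> p - q \<in> (stanley_reisner_ideal \<K> :: ('v, 'k::field) mvpoly set)"
proof -
  have mem: "r \<in> cls p \<longleftrightarrow> r - p \<in> stanley_reisner_ideal \<K>" for r p :: "('v, 'k) mvpoly"
    unfolding cls_def a_r_coset_def r_coset_def by (force simp: algebra_simps)
  show ?thesis
  proof
    assume "cls p = cls q"
    moreover have "p \<in> cls p" unfolding mem using SR_ideal_closed(1) by simp
    ultimately show "p - q \<in> stanley_reisner_ideal \<K>" unfolding mem[symmetric] by simp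
  next
    assume pq: "p - q \<in> stanley_reisner_ideal \<K>"
    show "cls p = cls q"
    proof (rule Set.set_eqI)
      fix r
      show "r \<in> cls p \<longleftrightarrow> r \<in> cls q"
        unfolding mem using SR_ideal_closed(2)[OF _ pq, of "r - p"] SR_ideal_closed(5)[OF _ pq, of "r - q"] by auto
    qed
  qed
qed

lemma SR_carrier: "carrier (stanley_reisner_ring \<K>) = range (cls :: ('v, 'k::field) mvpoly \<Rightarrow> _)"
  by (auto simp: stanley_reisner_ring_def Let_def FactRing_def A_RCOSETS_def' cls_def)

lemma SR_add: "cls p \<oplus>\<^bsub>stanley_reisner_ring \<K>\<^esub> cls q = cls (p + q :: ('v, 'k::field) mvpoly)"
proof -
  interpret ideal "stanley_reisner_ideal \<K>" "mvpoly_ring :: ('v, 'k) mvpoly ring" by (rule ideal_SR)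
  show ?thesis using a_rcos_sum[of p q] by (simp add: stanley_reisner_ring_def Let_def FactRing_def cls_def)
qed

lemma SR_mult: "cls p \<otimes>\<^bsub>stanley_reisner_ring \<K>\<^esub> cls q = cls (p * q :: ('v, 'k::field) mvpoly)"
proof -
  interpret ideal "stanley_reisner_ideal \<K>" "mvpoly_ring :: ('v, 'k) mvpoly ring" by (rule ideal_SR)
  show ?thesis using rcoset_mult_add[of p q] by (simp add: stanley_reisner_ring_def Let_def FactRing_def cls_def)
qed

lemma SR_smult: "c \<odot>\<^bsub>stanley_reisner_ring \<K>\<^esub> cls p = cls (mvconst c * p :: ('v, 'k::field) mvpoly)"
proof -
  interpret ideal "stanley_reisner_ideal \<K>" "mvpoly_ring :: ('v, 'k) mvpoly ring" by (rule ideal_SR)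
  show ?thesis using rcoset_mult_add[of "mvconst c" p]
    by (simp add: stanley_reisner_ring_def Let_def FactRing_def cls_def)
qed

lemma SR_one: "\<one>\<^bsub>stanley_reisner_ring \<K>\<^esub> = cls (1 :: ('v, 'k::field) mvpoly)"
  by (simp add: stanley_reisner_ring_def Let_def FactRing_def cls_def)

lemma SR_zero: "\<zero>\<^bsub>stanley_reisner_ring \<K>\<^esub> = cls (0 :: ('v, 'k::field) mvpoly)"
  by (auto simp: stanley_reisner_ring_def Let_def FactRing_def cls_def a_r_coset_def r_coset_def)

lemmas SR_simps = SR_carrier SR_add SR_mult SR_smult SR_one SR_zero

lemma mvconst_simps: "mvconst (a + b) = mvconst a + mvconst b" "mvconst (a * b) = mvconst a * mvconst b"
  "mvconst 1 = 1"
  by (simp_all add: mvconst_def single_add mult_single)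

lemma kalgebra_SR: "kalgebra (stanley_reisner_ring \<K> :: ('k::field, ('v, 'k) mvpoly set) module)"
proof -
  let ?S = "stanley_reisner_ring \<K> :: ('k, ('v, 'k) mvpoly set) module"
  have E: "\<exists>p. x = cls p" if "x \<in> carrier ?S" for x using that by (auto simp: SR_carrier)
  have cl: "cls p \<in> carrier ?S" for p by (simp add: SR_carrier)
  note ops = SR_add SR_mult SR_smult SR_one SR_zero
  have ab: "abelian_group ?S"
  proof (rule abelian_groupI)
    show "\<exists>y\<in>carrier ?S. y \<oplus>\<^bsub>?S\<^esub> x = \<zero>\<^bsub>?S\<^esub>" if x: "x \<in> carrier ?S" for x
    proof -
      obtain p where p: "x = cls p" using E[OF x] ..
      have "cls (- p) \<oplus>\<^bsub>?S\<^esub> x = \<zero>\<^bsub>?S\<^esub>" by (simp add: p ops)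
      then show ?thesis using cl[of "- p"] by (rule bexI)
    qed
  qed (drule E | (erule exE) | (simp only: ops cl ac_simps add_0 add_0_right))+
  have mon: "monoid ?S"
    by (rule monoidI) (drule E | (erule exE) | (simp only: ops cl mult.assoc mult_1_left mult_1_right))+
  have rng: "ring ?S"
    by (rule ringI[OF ab mon]) (drule E | (erule exE) | (simp only: ops distrib_left distrib_right))+
  have md: "module (ring_of_type_algebra :: 'k ring) ?S"
    by (rule moduleI[OF cring_from_type_algebra ab])
       (drule E | (erule exE) |
        (simp only: ops cl ring_of_type_algebra_sel mvconst_simps distrib_left distrib_right mult.assoc mult_1_left))+
  show ?thesis
    by (rule kalgebra.intro[OF md rng], unfold_locales)
       (drule E | (erule exE) | (simp only: ops mult.assoc mult.left_commute))+
qed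

section \<open>The Stanley-Reisner ideal as a span of monomials\<close>

definition nonface_polys :: "('v, 'k::field) mvpoly set" where
  "nonface_polys = supp_in {m. keys m \<notin> \<K>}"

lemma keys_add_nat: "keys (a + b :: 'v \<Rightarrow>\<^sub>0 nat) = keys a \<union> keys b"
  by (auto simp: in_keys_iff lookup_add)

text \<open>Multiplication enlarges the support of a monomial, and a superset of a non-face is a
  non-face.\<close>

lemma nonface_mult:
  fixes p :: "('v, 'k::field) mvpoly"
  shows "p \<in> nonface_polys \<Longrightarrow> r * p \<in> nonface_polys"
proof -
  assume p: "p \<in> nonface_polys"
  have "keys (r * p) \<subseteq> {m. keys m \<notin> \<K>}"
  proof
    fix m assume "m \<in> keys (r * p)"
    then obtain a b where m: "m = a + b" "b \<in> keys p" using keys_mult[of r p] by (fast dest: subsetD)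
    then have "keys b \<notin> \<K>" using p by (auto simp: nonface_polys_def supp_in_def)
    moreover have "keys b \<subseteq> keys m" unfolding m(1) keys_add_nat by (rule Un_upper2)
    ultimately show "m \<in> {m. keys m \<notin> \<K>}"
      using complex[unfolded simplicial_complex_def, rule_format, of "keys m" "keys b"]
      by fast
  qed
  then show ?thesis by (simp add: nonface_polys_def supp_in_def)
qed

lemma nonface_mult_right: "p \<in> nonface_polys \<Longrightarrow> p * r \<in> (nonface_polys :: ('v, 'k::field) mvpoly set)"
  using nonface_mult[of p r] by (simp only: mult.commute)

lemma prod_mvvar: "(\<Prod>v\<in>f. mvvar v) = (single (\<Sum>v\<in>f. single v 1) 1 :: ('v, 'k::field) mvpoly)"
proof -
  have "finite f" by simp
  then show ?thesis by (induction f rule: finite_induct) (simp_all add: mvvar_def mult_single)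
qed

lemma keys_sum_single: "keys (\<Sum>v\<in>f. single v (1::nat)) = (f :: 'v set)"
proof -
  have "finite f" by simp
  then show ?thesis by (induction f rule: finite_induct) (simp_all add: keys_add_nat)
qed

text \<open>A monomial whose support is a non-face is a multiple of the squarefree generator of that
  support. So membership is decided monomial by monomial and depends on supports only.\<close>

lemma SR_ideal_eq: "stanley_reisner_ideal \<K> = (nonface_polys :: ('v, 'k::field) mvpoly set)"
proof
  interpret ring "mvpoly_ring :: ('v, 'k) mvpoly ring" by (rule ring_from_type_algebra)
  let ?B = "{\<Prod>v\<in>f. mvvar v | f. f \<notin> \<K>} :: ('v, 'k) mvpoly set"
  have "subgroup (nonface_polys :: ('v, 'k) mvpoly set) (add_monoid mvpoly_ring)"
  proof (rule add.subgroupI)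
    show "(nonface_polys :: ('v, 'k) mvpoly set) \<noteq> {}" by (auto simp: nonface_polys_def)
    fix p q :: "('v, 'k) mvpoly" assume p: "p \<in> nonface_polys" "q \<in> nonface_polys"
    then show "p \<oplus>\<^bsub>mvpoly_ring\<^esub> q \<in> nonface_polys" by (auto simp: nonface_polys_def)
  next
    fix p :: "('v, 'k) mvpoly" assume p: "p \<in> nonface_polys"
    have "\<ominus>\<^bsub>mvpoly_ring\<^esub> p = - p"
      by (rule minus_equality) simp_all
    then show "\<ominus>\<^bsub>mvpoly_ring\<^esub> p \<in> nonface_polys" using p by (auto simp: nonface_polys_def)
  qed simp
  then have "ideal (nonface_polys :: ('v, 'k) mvpoly set) mvpoly_ring"
    by (rule idealI[OF ring_from_type_algebra]) (simp_all add: nonface_mult nonface_mult_right)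
  then show "stanley_reisner_ideal \<K> \<subseteq> (nonface_polys :: ('v, 'k) mvpoly set)"
    unfolding stanley_reisner_ideal_def
  proof (rule genideal_minimal)
    show "?B \<subseteq> nonface_polys"
      by (auto simp: prod_mvvar nonface_polys_def keys_sum_single simp del: One_nat_def intro!: supp_in_single)
  qed
  show "(nonface_polys :: ('v, 'k) mvpoly set) \<subseteq> stanley_reisner_ideal \<K>"
  proof
    fix p :: "('v, 'k) mvpoly" assume "p \<in> nonface_polys"
    then show "p \<in> stanley_reisner_ideal \<K>" unfolding nonface_polys_def
    proof (induction p rule: supp_in_induct)
      case zero
      show ?case by (rule SR_ideal_closed(1))
    next
      case (add p q)
      then show ?case by (intro SR_ideal_closed(2))
    next
      case (single m c)
      let ?f = "keys m" and ?x = "\<Sum>v\<in>keys m. single v (1::nat)"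
      have lx: "lookup ?x v = (if v \<in> ?f then 1 else 0)" for v
        by (auto simp: lookup_sum lookup_single when_def)
      \<comment> \<open>Subtraction of exponents is truncated, but \<open>m\<close> is at least 1 at
        each vertex of its support.\<close>
      have m: "m - ?x + ?x = m"
        by (rule poly_mapping_eqI) (auto simp: lookup_add lookup_minus lx in_keys_iff simp del: One_nat_def)
      have "(\<Prod>v\<in>?f. mvvar v) \<in> (stanley_reisner_ideal \<K> :: ('v, 'k) mvpoly set)"
        unfolding stanley_reisner_ideal_def using genideal_self[of ?B] single by auto
      then have "single (m - ?x) c * (\<Prod>v\<in>?f. mvvar v) \<in> (stanley_reisner_ideal \<K> :: ('v, 'k) mvpoly set)"
        by (rule SR_ideal_closed(3))
      then show ?case unfolding prod_mvvar mult_single m by simp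
    qed
  qed
qed

lemma cls_zero_iff: "cls (p :: ('v, 'k::field) mvpoly) = \<zero>\<^bsub>stanley_reisner_ring \<K>\<^esub> \<longleftrightarrow> p \<in> nonface_polys"
  unfolding SR_zero cls_eq_iff SR_ideal_eq by simp

text \<open>A set with at most one element, empty as soon as \<open>w\<close> has a negative entry;
  hence every weight piece of the ring has dimension at most 1.\<close>

definition exponents :: "('v \<Rightarrow> int) \<Rightarrow> ('v \<Rightarrow>\<^sub>0 nat) set" where
  "exponents w = {m. \<forall>v. int (lookup m v) = w v}"

lemma SR_weight: "stanley_reisner_weight \<K> w = cls ` supp_in (exponents w)"
  by (auto simp: stanley_reisner_weight_def cls_def supp_in_def exponents_def subset_iff)

lemma exponents_unique: "m \<in> exponents w \<Longrightarrow> m' \<in> exponents w' \<Longrightarrow> m = m' \<longleftrightarrow> w = w'"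
  by (auto simp: exponents_def poly_mapping_eq_iff fun_eq_iff)
     (metis of_nat_eq_iff)

lemma exponents_neg: "w v < 0 \<Longrightarrow> exponents w = {}"
  by (auto simp: exponents_def) (metis of_nat_0_le_iff not_le)

lemma SR_weight_neg:
  "w v < 0 \<Longrightarrow> x \<in> stanley_reisner_weight \<K> w \<Longrightarrow> x = \<zero>\<^bsub>stanley_reisner_ring \<K>\<^esub>"
  by (auto simp: SR_weight exponents_neg supp_in_def SR_zero)

text \<open>Different weights share no monomial, so each monomial of \<open>p w\<close> keeps its
  coefficient in the total. The ideal being spanned by monomials, each summand already lies in
  it.\<close>

lemma SR_graded_indep:
  "graded_indep (stanley_reisner_ring \<K> :: ('k::field, ('v, 'k) mvpoly set) module) (stanley_reisner_weight \<K>)"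
  unfolding graded_indep_def
proof (intro conjI allI impI ballI)
  let ?S = "stanley_reisner_ring \<K> :: ('k, ('v, 'k) mvpoly set) module"
  interpret S: kalgebra ?S by (rule kalgebra_SR)
  have neg: "\<ominus>\<^bsub>?S\<^esub> cls p = cls (- p)" for p
    by (rule S.add.inv_equality) (simp_all add: SR_simps)
  have const: "mvconst c * p \<in> supp_in A" if "p \<in> supp_in A" for c :: 'k and p :: "('v, 'k) mvpoly" and A
    using that keys_mult[of "mvconst c" p] by (fastforce simp: supp_in_def mvconst_def split: if_splits)
  show "submodule (stanley_reisner_weight \<K> w) (ring_of_type_algebra :: 'k ring) ?S" for w
    by (rule S.submoduleI)
       (auto simp: SR_weight SR_simps neg intro!: const)
  fix J :: "('v \<Rightarrow> int) set" and f :: "('v \<Rightarrow> int) \<Rightarrow> ('v, 'k) mvpoly set" and w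
  assume J: "finite J" and f: "\<forall>w\<in>J. f w \<in> stanley_reisner_weight \<K> w"
    and 0: "(\<Oplus>\<^bsub>?S\<^esub>w\<in>J. f w) = \<zero>\<^bsub>?S\<^esub>" and w: "w \<in> J"
  have "\<forall>w\<in>J. \<exists>p. p \<in> supp_in (exponents w) \<and> f w = cls p" using f by (auto simp: SR_weight)
  then obtain p where p: "\<And>w. w \<in> J \<Longrightarrow> p w \<in> supp_in (exponents w)" "\<And>w. w \<in> J \<Longrightarrow> f w = cls (p w)"
    by metis
  have sum: "(\<Oplus>\<^bsub>?S\<^esub>w\<in>K. f w) = cls (\<Sum>w\<in>K. p w)" if "finite K" "K \<subseteq> J" for K
    using that
  proof (induction K rule: finite_induct)
    case (insert v K)
    have "f \<in> K \<rightarrow> carrier ?S" "f v \<in> carrier ?S" using insert.prems p(2) by (auto simp: SR_carrier)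
    then show ?case using insert p(2) by (simp add: SR_add)
  qed (simp add: SR_zero)
  have tot: "(\<Sum>w\<in>J. p w) \<in> nonface_polys" using sum[OF J order.refl] 0 cls_zero_iff by metis
  have "p w \<in> nonface_polys"
    unfolding nonface_polys_def supp_in_def mem_Collect_eq
  proof
    fix m assume m: "m \<in> keys (p w)"
    then have mw: "m \<in> exponents w" using p(1)[OF w] by (auto simp: supp_in_def)
    have "lookup (p w') m = 0" if "w' \<in> J" "w' \<noteq> w" for w'
    proof (rule ccontr)
      assume "lookup (p w') m \<noteq> 0"
      then have "m \<in> exponents w'" using p(1)[OF that(1)] by (auto simp: supp_in_def in_keys_iff)
      then show False using mw that(2) exponents_unique by blast
    qed
    then have "lookup (\<Sum>w\<in>J. p w) m = lookup (p w) m"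
      unfolding lookup_sum using J w by (subst sum.remove[OF J w]) (auto intro!: sum.neutral)
    then have "m \<in> keys (\<Sum>w\<in>J. p w)" using m by (simp add: in_keys_iff)
    then show "m \<in> {m. keys m \<notin> \<K>}" using tot by (auto simp: nonface_polys_def supp_in_def)
  qed
  then show "f w = \<zero>\<^bsub>?S\<^esub>" unfolding p(2)[OF w] by (rule cls_zero_iff[THEN iffD2])
qed

text \<open>Squarefreeness at work: a monomial that already contains \<open>v\<close> keeps its
  support when multiplied by \<open>v\<close>, so it is in the ideal before if and only if it is
  after.\<close>

lemma SR_variable_cancel:
  assumes x: "x \<in> stanley_reisner_weight \<K> w" and w: "1 \<le> w v"
    and 0: "cls (mvvar v) \<otimes>\<^bsub>stanley_reisner_ring \<K>\<^esub> x = \<zero>\<^bsub>stanley_reisner_ring \<K>\<^esub>"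
  shows "x = \<zero>\<^bsub>stanley_reisner_ring \<K> :: ('k::field, ('v, 'k) mvpoly set) module\<^esub>"
proof -
  obtain p where p: "p \<in> supp_in (exponents w)" "x = cls p" using x by (auto simp: SR_weight)
  have vp: "mvvar v * p \<in> nonface_polys" using 0 unfolding p(2) SR_mult cls_zero_iff .
  let ?e = "single v (1::nat)"
  have shift: "lookup (mvvar v * q) (?e + m) = lookup q m" for q :: "('v, 'k) mvpoly" and m
  proof -
    have "q \<in> supp_in UNIV" by (simp add: supp_in_def)
    then show ?thesis
      by (induction q rule: supp_in_induct)
         (auto simp: mvvar_def mult_single lookup_single lookup_add ring_distribs when_def)
  qed
  have "p \<in> nonface_polys"
    unfolding nonface_polys_def supp_in_def mem_Collect_eq
  proof
    fix m assume m: "m \<in> keys p"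
    then have "m \<in> exponents w" using p(1) by (auto simp: supp_in_def)
    then have "int (lookup m v) = w v" by (simp add: exponents_def)
    then have "v \<in> keys m" using w by (auto simp: in_keys_iff)
    then have "keys (?e + m) = keys m" by (auto simp: keys_add_nat)
    moreover have "?e + m \<in> keys (mvvar v * p)" using m shift by (simp add: in_keys_iff)
    ultimately show "m \<in> {m. keys m \<notin> \<K>}" using vp by (auto simp: nonface_polys_def supp_in_def)
  qed
  then show ?thesis unfolding p(2) by (rule cls_zero_iff[THEN iffD2])
qed

lemma monomial_word:
  "\<exists>us. prod_list (map mvvar us) = (single m 1 :: ('v, 'k::field) mvpoly) \<and>
    (\<forall>v. int (lookup m v) = (\<Sum>u\<leftarrow>us. if v = u then 1 else 0))"
proof (induction "\<Sum>v\<in>UNIV. lookup m v" arbitrary: m)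
  case 0
  then have "m = 0" by (intro poly_mapping_eqI) simp
  then show ?case by (intro exI[of _ "[]"]) simp
next
  case (Suc n)
  have "\<exists>v. lookup m v \<noteq> 0"
  proof (rule ccontr)
    assume "\<not> ?thesis"
    then have "(\<Sum>v\<in>UNIV. lookup m v) = 0" by simp
    from trans[OF Suc.hyps(2) this] show False by simp
  qed
  then obtain v where v: "lookup m v \<noteq> 0" ..
  define m' where "m' = m - single v 1"
  have m: "m = single v 1 + m'"
    by (rule poly_mapping_eqI) (use v in \<open>auto simp: m'_def lookup_add lookup_minus lookup_single when_def\<close>)
  have "(\<Sum>u\<in>UNIV. lookup m u) = 1 + (\<Sum>u\<in>UNIV. lookup m' u)"
    unfolding m by (simp add: lookup_add sum.distrib lookup_single when_def)
  then have "n = (\<Sum>u\<in>UNIV. lookup m' u)" using Suc.hyps(2) by simp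
  from Suc.hyps(1)[OF this] obtain us where us:
    "prod_list (map mvvar us) = (single m' 1 :: ('v, 'k) mvpoly)"
    "\<And>v. int (lookup m' v) = (\<Sum>u\<leftarrow>us. if v = u then 1 else 0)" by blast
  have "prod_list (map mvvar (v # us)) = (single m 1 :: ('v, 'k) mvpoly)"
    using us(1) by (simp add: mvvar_def[of v] mult_single m)
  moreover have "int (lookup m u) = (\<Sum>u'\<leftarrow>v # us. if u = u' then 1 else 0)" for u
    unfolding m lookup_add of_nat_add us(2) by (simp add: lookup_single when_def)
  ultimately show ?case by blast
qed

lemma SR_weight_generated:
  assumes "x \<in> stanley_reisner_weight \<K> w"
  shows "\<exists>c us. x = cls (mvconst c * prod_list (map mvvar us) :: ('v, 'k::field) mvpoly) \<and>
    (c = 0 \<or> (\<forall>v. w v = (\<Sum>u\<leftarrow>us. if v = u then 1 else 0)))"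
proof -
  obtain p where p: "p \<in> supp_in (exponents w)" "x = cls (p :: ('v, 'k) mvpoly)" using assms by (auto simp: SR_weight)
  show ?thesis
  proof (cases "exponents w = {}")
    case True
    then have "p = 0" using p(1) by (simp add: supp_in_def)
    then show ?thesis using p(2) by (intro exI[of _ 0] exI[of _ "[]"]) (simp add: mvconst_def)
  next
    case False
    then obtain m where m: "m \<in> exponents w" by blast
    then have "exponents w = {m}" using exponents_unique by blast
    then have keys: "keys p \<subseteq> {m}" using p(1) by (simp add: supp_in_def)
    have pm: "p = single m (lookup p m)"
      by (rule poly_mapping_eqI) (use keys in \<open>auto simp: lookup_single when_def in_keys_iff subset_iff\<close>)
    obtain us where us: "prod_list (map mvvar us) = (single m 1 :: ('v, 'k) mvpoly)"
      "\<And>v. int (lookup m v) = (\<Sum>u\<leftarrow>us. if v = u then 1 else 0)"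
      using monomial_word by blast
    have "mvconst (lookup p m) * prod_list (map mvvar us) = p"
      unfolding us(1) by (subst (2) pm) (simp add: mvconst_def mult_single)
    moreover have "w v = (\<Sum>u\<leftarrow>us. if v = u then 1 else 0)" for v
      using m us(2)[of v] by (simp add: exponents_def)
    ultimately show ?thesis using p(2) by metis
  qed
qed

end

section \<open>Resolutions of Stanley-Reisner rings\<close>

lemma concentrated_simps [simp]:
  "carrier (concentrated_in_degree_0 S) = carrier S"
  "monoid.mult (concentrated_in_degree_0 S) = monoid.mult S"
  "one (concentrated_in_degree_0 S) = one S"
  "ring.zero (concentrated_in_degree_0 S) = ring.zero S"
  "ring.add (concentrated_in_degree_0 S) = ring.add S"
  "module.smult (concentrated_in_degree_0 S) = module.smult S"
  "hpart (concentrated_in_degree_0 S) n = (if n = 0 then carrier S else {\<zero>\<^bsub>S\<^esub>})"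
  "bdry (concentrated_in_degree_0 S) x = \<zero>\<^bsub>S\<^esub>"
  by (simp_all add: concentrated_in_degree_0_def)

lemma carrier_homology:
  "carrier (homology A n) = (\<lambda>z. (\<lambda>h. h \<oplus>\<^bsub>A\<^esub> z) ` boundaries A n) ` cycles A n"
  by (auto simp: homology_def carrier_FactGroup r_coset_def)

locale complex_resolution =
  fixes \<K> :: "'v::finite set set" and P :: "('k::field_char_0, 'p) dga" (structure)
    and W :: "('v \<Rightarrow> int) \<Rightarrow> 'p set" and \<epsilon> :: "'p \<Rightarrow> ('v, 'k) mvpoly set"
  assumes complex: "simplicial_complex \<K>" and resolution: "is_resolution_of_complex \<K> P W \<epsilon>"
begin

abbreviation S :: "('k, ('v, 'k) mvpoly set) module" where "S \<equiv> stanley_reisner_ring \<K>"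
abbreviation U :: "('v \<Rightarrow> int) \<Rightarrow> ('v, 'k) mvpoly set set" where "U \<equiv> stanley_reisner_weight \<K>"

lemma resolution_facts:
  "cdga P" "quasi_isomorphism P (concentrated_in_degree_0 S) \<epsilon>" "weight_grading P W"
  "direct_sum_decomposition P (\<lambda>(n, w). hpart P n \<inter> W w)"
  "\<exists>E. freely_generated_by P E \<and> E \<subseteq> (\<Union>w. W w)"
  "bdry P ` W w \<subseteq> W w" "\<epsilon> ` W w \<subseteq> U w"
  using resolution unfolding weighted_koszul_tate_resolution_def koszul_tate_resolution_def by simp_all

sublocale cdga P by (rule resolution_facts)
sublocale S: kalgebra S by (rule kalgebra_SR[OF complex])

lemma W_submodule: "submodule (W w) (ring_of_type_algebra :: 'k ring) P"
  using resolution_facts(3) by (simp add: weight_grading_def direct_sum_decomposition_def)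

lemma W_mult: "x \<in> W w \<Longrightarrow> y \<in> W w' \<Longrightarrow> x \<otimes> y \<in> W (\<lambda>v. w v + w' v)"
  using resolution_facts(3) by (simp add: weight_grading_def)

lemmas WD = submoduleD[OF W_submodule]

lemma eps_hom: "\<epsilon> \<in> dga_hom P (concentrated_in_degree_0 S)"
  using resolution_facts(2) by (simp add: quasi_isomorphism_def)

lemma eps_closed: "x \<in> carrier P \<Longrightarrow> \<epsilon> x \<in> carrier S"
  and eps_add: "x \<in> carrier P \<Longrightarrow> y \<in> carrier P \<Longrightarrow> \<epsilon> (x \<oplus> y) = \<epsilon> x \<oplus>\<^bsub>S\<^esub> \<epsilon> y"
  and eps_mult: "x \<in> carrier P \<Longrightarrow> y \<in> carrier P \<Longrightarrow> \<epsilon> (x \<otimes> y) = \<epsilon> x \<otimes>\<^bsub>S\<^esub> \<epsilon> y"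
  and eps_one: "\<epsilon> \<one> = \<one>\<^bsub>S\<^esub>"
  using eps_hom by (auto simp: dga_hom_def ring_hom_def)

lemma eps_smult: "x \<in> carrier P \<Longrightarrow> \<epsilon> (c \<odot> x) = c \<odot>\<^bsub>S\<^esub> \<epsilon> x"
  and eps_bdry: "x \<in> carrier P \<Longrightarrow> \<epsilon> (bdry P x) = \<zero>\<^bsub>S\<^esub>"
  using eps_hom by (simp_all add: dga_hom_def)

lemma eps_degree: "x \<in> hpart P n \<Longrightarrow> n \<noteq> 0 \<Longrightarrow> \<epsilon> x = \<zero>\<^bsub>S\<^esub>"
proof -
  assume x: "x \<in> hpart P n" "n \<noteq> 0"
  have "\<epsilon> ` hpart P n \<subseteq> hpart (concentrated_in_degree_0 S) n" using eps_hom by (simp add: dga_hom_def)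
  then show ?thesis using x by auto
qed

lemma eps_zero: "\<epsilon> \<zero> = \<zero>\<^bsub>S\<^esub>"
  using eps_bdry[OF zero_closed] by (simp add: bdry_zero)

section \<open>Exactness and lifting from the quasi-isomorphism\<close>

lemma concentrated_boundaries: "boundaries (concentrated_in_degree_0 S) n = {\<zero>\<^bsub>S\<^esub>}"
  using S.zero_closed by (auto simp: boundaries_def)

lemma boundaries_zero: "\<zero> \<in> boundaries P n"
  unfolding boundaries_def using hpartD(2) bdry_zero by force

lemma boundaries_closed: "h \<in> boundaries P n \<Longrightarrow> h \<in> hpart P n"
  unfolding boundaries_def using bdry_degree by fastforce

lemma induced_map_class:
  assumes z: "z \<in> cycles P n"
  shows "induced_map (concentrated_in_degree_0 S) \<epsilon> n ((\<lambda>h. h \<oplus> z) ` boundaries P n) = {\<epsilon> z}"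
proof -
  have "z \<in> hpart P n" using z by (simp add: cycles_def)
  then have zc: "z \<in> carrier P" by (rule hpartD(6))
  have h: "\<epsilon> (h \<oplus> z) = \<epsilon> z" if hb: "h \<in> boundaries P n" for h
  proof -
    obtain p where p: "p \<in> hpart P (n + 1)" "h = bdry P p" using hb unfolding boundaries_def by blast
    have "h \<in> carrier P" using boundaries_closed[OF hb] by (rule hpartD(6))
    moreover have "\<epsilon> h = \<zero>\<^bsub>S\<^esub>" unfolding p(2) by (rule eps_bdry[OF hpartD(6)[OF p(1)]])
    ultimately show ?thesis using zc eps_closed[OF zc] by (simp add: eps_add)
  qed
  have "boundaries (concentrated_in_degree_0 S) n +>\<^bsub>concentrated_in_degree_0 S\<^esub> s = {s}" if "s \<in> carrier S" for s
    unfolding concentrated_boundaries using that by (simp add: a_r_coset_def r_coset_def)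
  then have "induced_map (concentrated_in_degree_0 S) \<epsilon> n ((\<lambda>h. h \<oplus> z) ` boundaries P n) =
      (\<Union>h\<in>boundaries P n. {\<epsilon> z})"
    unfolding induced_map_def using h eps_closed[OF zc] by simp
  then show ?thesis using boundaries_zero by auto
qed

lemma induced_bij:
  "bij_betw (induced_map (concentrated_in_degree_0 S) \<epsilon> n)
     (carrier (homology P n)) (carrier (homology (concentrated_in_degree_0 S) n))"
  using resolution_facts(2) by (simp add: quasi_isomorphism_def)

text \<open>The classes of \<open>z\<close> and of \<open>\<zero>\<close> have the same image, so
  injectivity on homology makes \<open>z\<close> a boundary.\<close>

lemma exact_unweighted:
  assumes z: "z \<in> hpart P n" "bdry P z = \<zero>" "\<epsilon> z = \<zero>\<^bsub>S\<^esub>"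
  shows "\<exists>p\<in>hpart P (n + 1). bdry P p = z"
proof -
  let ?c = "\<lambda>z. (\<lambda>h. h \<oplus> z) ` boundaries P n"
  have cyc: "z \<in> cycles P n" "\<zero> \<in> cycles P n" using z hpartD(2) bdry_zero by (simp_all add: cycles_def)
  have "inj_on (induced_map (concentrated_in_degree_0 S) \<epsilon> n) (carrier (homology P n))"
    using induced_bij by (rule bij_betw_imp_inj_on)
  moreover have "induced_map (concentrated_in_degree_0 S) \<epsilon> n (?c z) = induced_map (concentrated_in_degree_0 S) \<epsilon> n (?c \<zero>)"
    using z(3) eps_zero by (simp add: induced_map_class cyc)
  moreover have "?c z \<in> carrier (homology P n)" "?c \<zero> \<in> carrier (homology P n)"
    unfolding carrier_homology using cyc by (auto intro!: imageI)
  ultimately have eq: "?c z = ?c \<zero>" by (rule inj_onD)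
  have "z = \<zero> \<oplus> z" using hpartD(6)[OF z(1)] by simp
  then have "z \<in> ?c z" using boundaries_zero by (rule image_eqI)
  then obtain h where h: "h \<in> boundaries P n" "z = h \<oplus> \<zero>" unfolding eq by blast
  then have "z \<in> boundaries P n" using hpartD(6)[OF boundaries_closed[OF h(1)]] by simp
  then show ?thesis unfolding boundaries_def by blast
qed

lemma eps_surj:
  assumes s: "s \<in> carrier S" shows "\<exists>z\<in>hpart P 0. \<epsilon> z = s"
proof -
  have "{s} \<in> carrier (homology (concentrated_in_degree_0 S) 0)"
    unfolding carrier_homology concentrated_boundaries
    by (rule image_eqI[of _ _ s]) (use s in \<open>simp_all add: cycles_def\<close>)
  then have "{s} \<in> induced_map (concentrated_in_degree_0 S) \<epsilon> 0 ` carrier (homology P 0)"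
    using bij_betw_imp_surj_on[OF induced_bij[of 0]] by simp
  then obtain C where C: "C \<in> carrier (homology P 0)" "induced_map (concentrated_in_degree_0 S) \<epsilon> 0 C = {s}" by auto
  then obtain z where z: "z \<in> cycles P 0" "C = (\<lambda>h. h \<oplus> z) ` boundaries P 0" unfolding carrier_homology by auto
  then have "{\<epsilon> z} = {s}" using induced_map_class[OF z(1)] C(2) by simp
  then show ?thesis using z(1) by (auto simp: cycles_def)
qed

lemma bdry_closed: "x \<in> carrier P \<Longrightarrow> bdry P x \<in> carrier P"
proof -
  assume x: "x \<in> carrier P"
  obtain J f where J: "finite J" and f: "\<And>n. f n \<in> hpart P n" and xs: "x = (\<Oplus>n\<in>J. f n)"
    by (rule direct_sum_decomposition_obtain[OF degree_decomposition x]) (rule that)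
  have fc: "f n \<in> carrier P" for n by (rule hpartD(6)[OF f])
  have bc: "bdry P (f n) \<in> carrier P" for n by (rule hpartD(6)[OF bdry_degree[OF f]])
  show ?thesis unfolding xs using J
  proof (induction J rule: finite_induct)
    case empty
    show ?case by (simp add: bdry_zero)
  next
    case (insert n J)
    have "(\<Oplus>n\<in>J. f n) \<in> carrier P" by (rule finsum_closed) (simp add: fc)
    then show ?case using insert fc bc by (simp add: bdry_add)
  qed
qed

text \<open>A quasi-isomorphism ignores weights, but the boundary respects them, so the
  bihomogeneous component of any primitive is a primitive too.\<close>

lemma exact_weighted:
  assumes z: "z \<in> hpart P n" "z \<in> W w" "bdry P z = \<zero>" "\<epsilon> z = \<zero>\<^bsub>S\<^esub>"
  shows "\<exists>p\<in>hpart P (n + 1) \<inter> W w. bdry P p = z"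
proof -
  obtain p where p: "p \<in> hpart P (n + 1)" "bdry P p = z" using exact_unweighted[OF z(1,3,4)] by blast
  let ?N = "\<lambda>(n, w). hpart P n \<inter> W w"
  have "\<exists>x'\<in>?N (n + 1, w). bdry P x' = bdry P p"
  proof (rule linear_component[OF kalgebra_axioms resolution_facts(4)
        direct_sum_decomposition_indep[OF resolution_facts(4)], where F = "bdry P" and I = UNIV
        and \<tau> = "\<lambda>(n, w). (n - 1, w)" and j = "(n + 1, w)" and x = p])
    show "inj (\<lambda>(n :: int, w :: 'v \<Rightarrow> int). (n - 1, w))" by (rule injI) auto
    show "bdry P y \<in> ?N (case i of (n, w) \<Rightarrow> (n - 1, w))" if "y \<in> ?N i" for i y
      using that resolution_facts(6) bdry_degree by (cases i) auto
    show "bdry P p \<in> ?N (case (n + 1, w) of (n, w) \<Rightarrow> (n - 1, w))" using z p(2) by simp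
  qed (use bdry_closed bdry_add hpartD(6)[OF p(1)] in auto)
  then show ?thesis using p(2) by simp
qed

lemma lift_variable: "\<exists>x\<in>hpart P 0 \<inter> W (\<lambda>v. if v = u then 1 else 0). \<epsilon> x = cls \<K> (mvvar u)"
proof -
  let ?e = "\<lambda>v. if v = u then 1 else 0 :: int"
  have cc: "cls \<K> (mvvar u) \<in> carrier S" by (simp add: SR_carrier[OF complex])
  obtain z where z: "z \<in> hpart P 0" "\<epsilon> z = cls \<K> (mvvar u)" using eps_surj[OF cc] by blast
  let ?N = "\<lambda>(n, w). hpart P n \<inter> W w"
  have "single u 1 \<in> exponents ?e"
    by (auto simp: exponents_def[OF complex] lookup_single when_def)
  then have "mvvar u \<in> supp_in (exponents ?e)" unfolding mvvar_def by (rule supp_in_single)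
  then have eu: "\<epsilon> z \<in> U ?e" unfolding z(2) SR_weight[OF complex] by (rule imageI)
  \<comment> \<open>\<open>\<epsilon>\<close> kills the other degrees and keeps the weight, so the
    index map is \<open>snd\<close>, injective on the indices of degree 0.\<close>
  have "\<exists>x'\<in>?N (0, ?e). \<epsilon> x' = \<epsilon> z"
  proof (rule linear_component[OF S.kalgebra_axioms resolution_facts(4)
        SR_graded_indep[OF complex], where F = \<epsilon> and I = "{0} \<times> UNIV"
        and \<tau> = snd and j = "(0, ?e)" and x = z])
    show "inj_on snd ({0 :: int} \<times> (UNIV :: ('v \<Rightarrow> int) set))" by (rule inj_onI) auto
    show "\<epsilon> y \<in> U (snd i)" if "i \<in> {0} \<times> UNIV" "y \<in> ?N i" for i y
      using that resolution_facts(7) by (cases i) auto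
    show "\<epsilon> y = \<zero>\<^bsub>S\<^esub>" if "i \<notin> {0} \<times> UNIV" "y \<in> ?N i" for i y
      using that eps_degree by (cases i) auto
    show "\<epsilon> z \<in> U (snd (0 :: int, ?e))" using eu by simp
  qed (use eps_closed eps_add hpartD(6)[OF z(1)] in auto)
  then show ?thesis using z(2) by simp
qed

lemma prod_variables:
  assumes xx: "\<And>u. xx u \<in> hpart P 0 \<inter> W (\<lambda>v. if v = u then 1 else 0)" "\<And>u. \<epsilon> (xx u) = cls \<K> (mvvar u)"
  shows "foldr (\<otimes>) (map xx us) \<one> \<in> hpart P 0 \<inter> W (\<lambda>v. \<Sum>u\<leftarrow>us. if v = u then 1 else 0)"
    and "\<epsilon> (foldr (\<otimes>) (map xx us) \<one>) = cls \<K> (prod_list (map mvvar us))"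
proof -
  show m: "foldr (\<otimes>) (map xx us) \<one> \<in> hpart P 0 \<inter> W (\<lambda>v. \<Sum>u\<leftarrow>us. if v = u then 1 else 0)" for us
  proof (induction us)
    case Nil
    show ?case using degree_one resolution_facts(3) by (simp add: weight_grading_def)
  next
    case (Cons u us)
    have "xx u \<otimes> foldr (\<otimes>) (map xx us) \<one> \<in> hpart P (0 + 0)"
      using Cons xx(1) by (intro degree_mult) blast+
    moreover have "xx u \<otimes> foldr (\<otimes>) (map xx us) \<one> \<in>
        W (\<lambda>v. (if v = u then 1 else 0) + (\<Sum>u\<leftarrow>us. if v = u then 1 else 0))"
      using Cons xx(1) by (intro W_mult) blast+
    ultimately show ?case by simp
  qed
  show "\<epsilon> (foldr (\<otimes>) (map xx us) \<one>) = cls \<K> (prod_list (map mvvar us))"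
  proof (induction us)
    case Nil
    show ?case by (simp add: eps_one SR_one[OF complex])
  next
    case (Cons u us)
    have "xx u \<in> carrier P" "foldr (\<otimes>) (map xx us) \<one> \<in> carrier P"
      using xx(1)[of u] m[of us] hpartD(6) by blast+
    then show ?case using Cons by (simp add: eps_mult xx(2) SR_mult[OF complex])
  qed
qed

lemma free_weighted_cdga:
  assumes E: "freely_generated_by P E" "E \<subseteq> (\<Union>w. W w)"
    and xx: "\<And>u. xx u \<in> hpart P 0 \<inter> W (\<lambda>v. if v = u then 1 else 0)" "\<And>u. \<epsilon> (xx u) = cls \<K> (mvvar u)"
  shows "free_weighted_cdga P W v0 xx E"
proof (intro free_weighted_cdga.intro weighted_cdga.intro weighted_cdga_axioms.intro free_weighted_cdga_axioms.intro)
  show "cdga P" by (rule cdga_axioms)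
  show "submodule (W w) (ring_of_type_algebra :: 'k ring) P" for w by (rule W_submodule)
  show "\<one> \<in> W (\<lambda>_. 0)" using resolution_facts(3) by (simp add: weight_grading_def)
  show "x \<otimes> y \<in> W (\<lambda>v. w v + w' v)" if "x \<in> W w" "y \<in> W w'" for x y w w'
    using that by (rule W_mult)
  show "bdry P x \<in> W w" if "x \<in> W w" for x w using resolution_facts(6) that by blast
  show "xx u \<in> hpart P 0 \<inter> W (\<lambda>v. if v = u then 1 else 0)" for u by (rule xx(1))
  show "\<exists>p\<in>hpart P (n + 1) \<inter> W w. bdry P p = z"
    if "1 \<le> n" "z \<in> hpart P n \<inter> W w" "bdry P z = \<zero>" for n z w
  proof (rule exact_weighted)
    show "\<epsilon> z = \<zero>\<^bsub>S\<^esub>" using that eps_degree[of z n] by simp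
  qed (use that in simp_all)
  show "z \<in> bdry P ` (hpart P 1 \<inter> W w)"
    if z: "z \<in> hpart P 0 \<inter> W w" and w: "1 \<le> w v0" and b: "xx v0 \<otimes> z \<in> bdry P ` hpart P 1" for z w
  proof -
    obtain p where p: "p \<in> hpart P 1" "xx v0 \<otimes> z = bdry P p" using b by blast
    have c: "xx v0 \<in> carrier P" "z \<in> carrier P" using xx(1)[of v0] z hpartD(6) by blast+
    \<comment> \<open>Under \<open>\<epsilon>\<close> the hypothesis becomes the vanishing of a
      multiple of a variable in \<open>S\<close>; cancelling there and using exactness returns a
      primitive of weight \<open>w\<close>.\<close>
    have "cls \<K> (mvvar v0) \<otimes>\<^bsub>S\<^esub> \<epsilon> z = \<epsilon> (xx v0 \<otimes> z)" using c by (simp add: eps_mult xx(2))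
    also have "\<dots> = \<zero>\<^bsub>S\<^esub>" unfolding p(2) by (rule eps_bdry[OF hpartD(6)[OF p(1)]])
    finally have "cls \<K> (mvvar v0) \<otimes>\<^bsub>S\<^esub> \<epsilon> z = \<zero>\<^bsub>S\<^esub>" .
    moreover have "\<epsilon> z \<in> U w" using z resolution_facts(7) by blast
    ultimately have "\<epsilon> z = \<zero>\<^bsub>S\<^esub>"
      by (rule SR_variable_cancel[OF complex, where w = w and v = v0, rotated 2]) (rule w)
    then have "\<exists>p\<in>hpart P (0 + 1) \<inter> W w. bdry P p = z"
      using z bdry_of_degree_0 by (intro exact_weighted) blast+
    then show ?thesis by auto
  qed
  show "freely_generated_by P E" "E \<subseteq> (\<Union>w. W w)" by (rule E)+
  show "direct_sum_decomposition P (\<lambda>(n, w). hpart P n \<inter> W w)" by (rule resolution_facts(4))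
  show "\<exists>c us p. p \<in> hpart P 1 \<inter> W w \<and> e = c \<odot> foldr (\<otimes>) (map xx us) \<one> \<oplus> bdry P p \<and>
      (c = 0 \<or> (\<forall>v. w v = (\<Sum>u\<leftarrow>us. if v = u then 1 else 0)))"
    if e: "e \<in> hpart P 0 \<inter> W w" for e w
  proof -
    have "\<epsilon> e \<in> U w" using e resolution_facts(7) by blast
    from SR_weight_generated[OF complex this] obtain c us where
      ex: "\<epsilon> e = cls \<K> (mvconst c * prod_list (map mvvar us))" and
      cw: "c = 0 \<or> (\<forall>v. w v = (\<Sum>u\<leftarrow>us. if v = u then 1 else 0))" by blast
    let ?m = "foldr (\<otimes>) (map xx us) \<one>"
    have mh: "?m \<in> hpart P 0" and mW: "?m \<in> W (\<lambda>v. \<Sum>u\<leftarrow>us. if v = u then 1 else 0)"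
      using prod_variables(1)[OF xx] by blast+
    have cc: "e \<in> carrier P" "?m \<in> carrier P" using e mh hpartD(6) by blast+
    have cmW: "c \<odot> ?m \<in> W w"
    proof (cases "c = 0")
      case True
      then show ?thesis using cc WD(2) by simp
    next
      case False
      then have "w = (\<lambda>v. \<Sum>u\<leftarrow>us. if v = u then 1 else 0)" using cw by (simp add: fun_eq_iff)
      then show ?thesis using mW WD(4) by simp
    qed
    \<comment> \<open>Subtracting the lifted monomial leaves an element of degree 0 and weight
      \<open>w\<close> with zero image, hence a boundary.\<close>
    let ?z = "e \<oplus> \<ominus> (c \<odot> ?m)"
    have zh: "?z \<in> hpart P 0" using e mh by (intro hpartD(3) hpartD(5) hpartD(4)) blast+
    have zW: "?z \<in> W w" using e cmW by (intro WD(3) WD(5)) blast+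
    have "\<epsilon> ?z = \<epsilon> (e \<oplus> (- 1) \<odot> (c \<odot> ?m))" using cc by (simp add: k_uminus)
    also have "\<dots> = \<epsilon> e \<oplus>\<^bsub>S\<^esub> (- 1) \<odot>\<^bsub>S\<^esub> (c \<odot>\<^bsub>S\<^esub> \<epsilon> ?m)"
      using cc eps_add[of e "(- 1) \<odot> (c \<odot> ?m)"] by (simp only: eps_smult k_closed)
    also have "c \<odot>\<^bsub>S\<^esub> \<epsilon> ?m = \<epsilon> e" unfolding ex prod_variables(2)[OF xx] SR_smult[OF complex] ..
    also have "\<epsilon> e \<oplus>\<^bsub>S\<^esub> (- 1) \<odot>\<^bsub>S\<^esub> \<epsilon> e = \<zero>\<^bsub>S\<^esub>"
      using eps_closed[OF cc(1)] by (simp add: S.k_uminus S.r_neg)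
    finally have "\<epsilon> ?z = \<zero>\<^bsub>S\<^esub>" .
    from exact_weighted[OF zh zW bdry_of_degree_0[OF zh] this] obtain p where
      p: "p \<in> hpart P 1 \<inter> W w" "bdry P p = ?z" by auto
    have "e = c \<odot> ?m \<oplus> bdry P p"
      unfolding p(2) using cc by (simp add: a_lcomm[of "c \<odot> ?m" e] r_neg)
    then show ?thesis using p(1) cw by blast
  qed
qed

section \<open>Derivations, coboundaries and their cosets\<close>

lemma derivationD:
  assumes "\<psi> \<in> derivations P S \<epsilon> j"
  shows "\<psi> \<in> carrier P \<rightarrow>\<^sub>E carrier S"
    and "x \<in> carrier P \<Longrightarrow> y \<in> carrier P \<Longrightarrow> \<psi> (x \<oplus> y) = \<psi> x \<oplus>\<^bsub>S\<^esub> \<psi> y"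
    and "x \<in> carrier P \<Longrightarrow> \<psi> (r \<odot> x) = r \<odot>\<^bsub>S\<^esub> \<psi> x"
    and "x \<in> hpart P n \<Longrightarrow> n \<noteq> j \<Longrightarrow> \<psi> x = \<zero>\<^bsub>S\<^esub>"
    and "x \<in> hpart P m \<Longrightarrow> y \<in> hpart P n \<Longrightarrow>
      \<psi> (x \<otimes> y) = \<psi> x \<otimes>\<^bsub>S\<^esub> \<epsilon> y \<oplus>\<^bsub>S\<^esub> sg (j * m) \<odot>\<^bsub>S\<^esub> (\<epsilon> x \<otimes>\<^bsub>S\<^esub> \<psi> y)"
proof -
  note D = assms[unfolded derivations_def mem_Collect_eq powi_minus_one]
  show "\<psi> \<in> carrier P \<rightarrow>\<^sub>E carrier S" using D by (rule conjunct1)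
  show "x \<in> carrier P \<Longrightarrow> y \<in> carrier P \<Longrightarrow> \<psi> (x \<oplus> y) = \<psi> x \<oplus>\<^bsub>S\<^esub> \<psi> y"
    using D[THEN conjunct2, THEN conjunct1] by blast
  show "x \<in> carrier P \<Longrightarrow> \<psi> (r \<odot> x) = r \<odot>\<^bsub>S\<^esub> \<psi> x"
    using D[THEN conjunct2, THEN conjunct2, THEN conjunct1] by blast
  show "x \<in> hpart P n \<Longrightarrow> n \<noteq> j \<Longrightarrow> \<psi> x = \<zero>\<^bsub>S\<^esub>"
    using D[THEN conjunct2, THEN conjunct2, THEN conjunct2, THEN conjunct1] by blast
  show "x \<in> hpart P m \<Longrightarrow> y \<in> hpart P n \<Longrightarrow>
      \<psi> (x \<otimes> y) = \<psi> x \<otimes>\<^bsub>S\<^esub> \<epsilon> y \<oplus>\<^bsub>S\<^esub> sg (j * m) \<odot>\<^bsub>S\<^esub> (\<epsilon> x \<otimes>\<^bsub>S\<^esub> \<psi> y)"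
    using D[THEN conjunct2, THEN conjunct2, THEN conjunct2, THEN conjunct2] by blast
qed

lemma derivation_closed: "\<psi> \<in> derivations P S \<epsilon> j \<Longrightarrow> x \<in> carrier P \<Longrightarrow> \<psi> x \<in> carrier S"
  using derivationD(1) by (rule PiE_mem)

text \<open>The scalar \<open>r\<close> makes one closure property serve sums, differences and, with
  \<open>\<psi>\<close> zero, changes of sign.\<close>

lemma derivation_combination:
  assumes \<psi>: "\<psi> \<in> derivations P S \<epsilon> j" and \<theta>: "\<theta> \<in> derivations P S \<epsilon> j"
  shows "(\<lambda>x\<in>carrier P. \<psi> x \<oplus>\<^bsub>S\<^esub> r \<odot>\<^bsub>S\<^esub> \<theta> x) \<in> derivations P S \<epsilon> j"
    (is "?\<phi> \<in> _")
proof -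
  note cl = derivation_closed[OF \<psi>] derivation_closed[OF \<theta>]
  note add = derivationD(2)[OF \<psi>] derivationD(2)[OF \<theta>]
  note smult = derivationD(3)[OF \<psi>] derivationD(3)[OF \<theta>]
  note deg = derivationD(4)[OF \<psi>] derivationD(4)[OF \<theta>]
  note mult = derivationD(5)[OF \<psi>] derivationD(5)[OF \<theta>]
  show ?thesis
    unfolding derivations_def mem_Collect_eq powi_minus_one
  proof (intro conjI allI ballI impI)
    show "?\<phi> \<in> carrier P \<rightarrow>\<^sub>E carrier S" using cl by (intro restrict_PiE_iff[THEN iffD2]) simp
    show "?\<phi> (x \<oplus> y) = ?\<phi> x \<oplus>\<^bsub>S\<^esub> ?\<phi> y" if "x \<in> carrier P" "y \<in> carrier P" for x y
      using that cl by (simp add: add S.k_add_right S.a_ac)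
    show "?\<phi> (c \<odot> x) = c \<odot>\<^bsub>S\<^esub> ?\<phi> x" if "x \<in> carrier P" for c x
      using that cl by (simp add: smult S.k_add_right S.k_assoc mult.commute[of c r])
    show "?\<phi> x = \<zero>\<^bsub>S\<^esub>" if "n \<noteq> j" "x \<in> hpart P n" for n x
      using deg[OF that(2,1)] hpartD(6)[OF that(2)] by simp
    show "?\<phi> (x \<otimes> y) = ?\<phi> x \<otimes>\<^bsub>S\<^esub> \<epsilon> y \<oplus>\<^bsub>S\<^esub> sg (j * m) \<odot>\<^bsub>S\<^esub> (\<epsilon> x \<otimes>\<^bsub>S\<^esub> ?\<phi> y)"
      if h: "x \<in> hpart P m" "y \<in> hpart P n" for m n x y
    proof -
      have c: "x \<in> carrier P" "y \<in> carrier P" using h hpartD(6) by blast+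
      note cS = cl[OF c(1)] cl[OF c(2)] eps_closed[OF c(1)] eps_closed[OF c(2)]
      show ?thesis
        using c cS by (simp add: mult[OF h] S.k_add_right S.k_assoc S.l_distr S.r_distr S.smult_times_left
            S.smult_times_right S.a_ac mult.commute[of r])
    qed
  qed
qed

lemma zero_derivation: "(\<lambda>x\<in>carrier P. \<zero>\<^bsub>S\<^esub>) \<in> derivations P S \<epsilon> j"
  unfolding derivations_def mem_Collect_eq
proof (intro conjI allI ballI impI)
  fix m n x y assume h: "x \<in> hpart P m" "y \<in> hpart P n"
  then have c: "x \<in> carrier P" "y \<in> carrier P" using hpartD(6) by blast+
  show "(\<lambda>x\<in>carrier P. \<zero>\<^bsub>S\<^esub>) (x \<otimes> y) = (\<lambda>x\<in>carrier P. \<zero>\<^bsub>S\<^esub>) x \<otimes>\<^bsub>S\<^esub> \<epsilon> y \<oplus>\<^bsub>S\<^esub>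
      ((- 1) powi (j * m)) \<odot>\<^bsub>S\<^esub> (\<epsilon> x \<otimes>\<^bsub>S\<^esub> (\<lambda>x\<in>carrier P. \<zero>\<^bsub>S\<^esub>) y)"
    using c eps_closed[OF c(1)] eps_closed[OF c(2)] by simp
qed (simp_all add: hpartD(6))

lemma differential_combination:
  assumes "\<psi> \<in> derivations P S \<epsilon> j" "\<theta> \<in> derivations P S \<epsilon> j"
  shows "derivation_differential P S j (\<lambda>x\<in>carrier P. \<psi> x \<oplus>\<^bsub>S\<^esub> r \<odot>\<^bsub>S\<^esub> \<theta> x) =
    (\<lambda>x\<in>carrier P. derivation_differential P S j \<psi> x \<oplus>\<^bsub>S\<^esub> r \<odot>\<^bsub>S\<^esub> derivation_differential P S j \<theta> x)"
  unfolding derivation_differential_def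
proof (rule restrict_ext)
  fix x assume x: "x \<in> carrier P"
  have b: "bdry P x \<in> carrier P" using x by (rule bdry_closed)
  note c = derivation_closed[OF assms(1) b] derivation_closed[OF assms(2) b]
  show "((- 1) powi (j + 1)) \<odot>\<^bsub>S\<^esub> (\<lambda>x\<in>carrier P. \<psi> x \<oplus>\<^bsub>S\<^esub> r \<odot>\<^bsub>S\<^esub> \<theta> x) (bdry P x) =
    (\<lambda>x\<in>carrier P. ((- 1) powi (j + 1)) \<odot>\<^bsub>S\<^esub> \<psi> (bdry P x)) x \<oplus>\<^bsub>S\<^esub>
    r \<odot>\<^bsub>S\<^esub> (\<lambda>x\<in>carrier P. ((- 1) powi (j + 1)) \<odot>\<^bsub>S\<^esub> \<theta> (bdry P x)) x"
    using x b c by (simp add: S.k_add_right S.k_assoc mult.commute[of r])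
qed

lemma coboundary_combination:
  assumes "\<phi> \<in> derivation_coboundaries P S \<epsilon> j" "\<theta> \<in> derivation_coboundaries P S \<epsilon> j"
  shows "(\<lambda>x\<in>carrier P. \<phi> x \<oplus>\<^bsub>S\<^esub> r \<odot>\<^bsub>S\<^esub> \<theta> x) \<in> derivation_coboundaries P S \<epsilon> j"
proof -
  obtain \<phi>' \<theta>' where 1: "\<phi>' \<in> derivations P S \<epsilon> (j - 1)" "\<phi> = derivation_differential P S (j - 1) \<phi>'"
    and 2: "\<theta>' \<in> derivations P S \<epsilon> (j - 1)" "\<theta> = derivation_differential P S (j - 1) \<theta>'"
    using assms unfolding derivation_coboundaries_def by blast
  show ?thesis
    unfolding derivation_coboundaries_def 1(2) 2(2) differential_combination[OF 1(1) 2(1), symmetric]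
    by (rule imageI[OF derivation_combination[OF 1(1) 2(1)]])
qed

lemma coset_of_coboundary:
  assumes \<phi>: "\<phi> \<in> derivation_coboundaries P S \<epsilon> j"
  shows "derivation_coboundaries P S \<epsilon> j #>\<^bsub>derivation_group P S \<epsilon> j\<^esub> \<phi> = derivation_coboundaries P S \<epsilon> j"
    (is "?H #>\<^bsub>_\<^esub> \<phi> = ?H")
proof -
  have cl: "\<theta> x \<in> carrier S" if \<theta>: "\<theta> \<in> ?H" and x: "x \<in> carrier P" for \<theta> x
  proof -
    obtain \<psi> where \<psi>: "\<psi> \<in> derivations P S \<epsilon> (j - 1)" "\<theta> = derivation_differential P S (j - 1) \<psi>"
      using \<theta> unfolding derivation_coboundaries_def by blast
    show ?thesis unfolding \<psi>(2) derivation_differential_def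
      using x derivation_closed[OF \<psi>(1) bdry_closed[OF x]] by simp
  qed
  have ext: "\<theta> = (\<lambda>x\<in>carrier P. \<theta> x)" if "\<theta> \<in> ?H" for \<theta>
  proof -
    obtain \<psi> where \<psi>: "\<theta> = derivation_differential P S (j - 1) \<psi>"
      using \<open>\<theta> \<in> ?H\<close> unfolding derivation_coboundaries_def by blast
    show ?thesis unfolding \<psi> derivation_differential_def by (rule restrict_ext) simp
  qed
  have eq: "?H #>\<^bsub>derivation_group P S \<epsilon> j\<^esub> \<phi> = (\<lambda>\<theta>. \<lambda>x\<in>carrier P. \<theta> x \<oplus>\<^bsub>S\<^esub> \<phi> x) ` ?H"
    by (auto simp: r_coset_def derivation_group_def)
  show ?thesis unfolding eq
  proof (intro subset_antisym subsetI)
    fix \<theta> assume "\<theta> \<in> (\<lambda>\<theta>. \<lambda>x\<in>carrier P. \<theta> x \<oplus>\<^bsub>S\<^esub> \<phi> x) ` ?H"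
    then obtain \<theta>' where \<theta>': "\<theta>' \<in> ?H" "\<theta> = (\<lambda>x\<in>carrier P. \<theta>' x \<oplus>\<^bsub>S\<^esub> \<phi> x)" by blast
    have "\<theta> = (\<lambda>x\<in>carrier P. \<theta>' x \<oplus>\<^bsub>S\<^esub> 1 \<odot>\<^bsub>S\<^esub> \<phi> x)"
      unfolding \<theta>'(2) by (rule restrict_ext) (simp add: cl[OF \<phi>])
    then show "\<theta> \<in> ?H" using coboundary_combination[OF \<theta>'(1) \<phi>] by simp
  next
    fix \<theta> assume \<theta>: "\<theta> \<in> ?H"
    let ?t = "\<lambda>x\<in>carrier P. \<theta> x \<oplus>\<^bsub>S\<^esub> (- 1) \<odot>\<^bsub>S\<^esub> \<phi> x"
    have "(\<lambda>x\<in>carrier P. ?t x \<oplus>\<^bsub>S\<^esub> \<phi> x) = (\<lambda>x\<in>carrier P. \<theta> x)"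
      by (rule restrict_ext) (simp add: cl[OF \<phi>] cl[OF \<theta>] S.k_uminus S.a_assoc S.l_neg)
    then have "\<theta> = (\<lambda>x\<in>carrier P. ?t x \<oplus>\<^bsub>S\<^esub> \<phi> x)" using ext[OF \<theta>] by simp
    then show "\<theta> \<in> (\<lambda>\<theta>. \<lambda>x\<in>carrier P. \<theta> x \<oplus>\<^bsub>S\<^esub> \<phi> x) ` ?H"
      using coboundary_combination[OF \<theta> \<phi>] by (rule image_eqI)
  qed
qed

lemma coboundaryI:
  assumes \<psi>: "\<psi> \<in> derivations P S \<epsilon> (i - 1)" and \<phi>: "\<phi> \<in> derivations P S \<epsilon> i"
    and eq: "\<And>x. x \<in> carrier P \<Longrightarrow> \<psi> (bdry P x) = \<phi> x"
  shows "\<phi> \<in> derivation_coboundaries P S \<epsilon> i"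
proof -
  \<comment> \<open>The differential on derivations of degree \<open>i - 1\<close> carries the sign
    \<open>sg i\<close>; multiplying the primitive by the same sign cancels it.\<close>
  let ?\<psi> = "\<lambda>x\<in>carrier P. (\<lambda>x\<in>carrier P. \<zero>\<^bsub>S\<^esub>) x \<oplus>\<^bsub>S\<^esub> sg i \<odot>\<^bsub>S\<^esub> \<psi> x"
  have d: "?\<psi> \<in> derivations P S \<epsilon> (i - 1)" by (rule derivation_combination[OF zero_derivation \<psi>])
  have ext: "\<phi> = (\<lambda>x\<in>carrier P. \<phi> x)"
    using PiE_restrict[OF derivationD(1)[OF \<phi>]] by (simp only:)
  have "derivation_differential P S (i - 1) ?\<psi> = (\<lambda>x\<in>carrier P. \<phi> x)"
    unfolding derivation_differential_def powi_minus_one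
  proof (rule restrict_ext)
    fix x assume x: "x \<in> carrier P"
    have b: "bdry P x \<in> carrier P" using x by (rule bdry_closed)
    show "sg (i - 1 + 1) \<odot>\<^bsub>S\<^esub> ?\<psi> (bdry P x) = \<phi> x"
      using b derivation_closed[OF \<psi> b] derivation_closed[OF \<phi> x] by (simp add: eq[OF x] S.k_assoc)
  qed
  then have "\<phi> = derivation_differential P S (i - 1) ?\<psi>" using ext by simp
  then show ?thesis unfolding derivation_coboundaries_def using d by (rule image_eqI)
qed

lemma cocycle_bdry:
  assumes "\<phi> \<in> derivation_cocycles P S \<epsilon> i" "x \<in> carrier P" shows "\<phi> (bdry P x) = \<zero>\<^bsub>S\<^esub>"
proof -
  have \<phi>: "\<phi> \<in> derivations P S \<epsilon> i" and
    "derivation_differential P S i \<phi> = (\<lambda>x\<in>carrier P. \<zero>\<^bsub>S\<^esub>)"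
    using assms(1) by (simp_all add: derivation_cocycles_def derivation_group_def)
  from fun_cong[OF this(2), of x] have "sg (i + 1) \<odot>\<^bsub>S\<^esub> \<phi> (bdry P x) = \<zero>\<^bsub>S\<^esub>"
    using assms(2) by (simp add: derivation_differential_def powi_minus_one)
  then have "sg (i + 1) \<odot>\<^bsub>S\<^esub> (sg (i + 1) \<odot>\<^bsub>S\<^esub> \<phi> (bdry P x)) = \<zero>\<^bsub>S\<^esub>" by simp
  then show ?thesis using derivation_closed[OF \<phi> bdry_closed[OF assms(2)]] by (simp add: S.k_assoc)
qed

text \<open>On elements whose \<open>v0\<close>-weight is at most \<open>i - 1\<close> the cocycle
  takes values of negative \<open>v0\<close>-weight, and the Stanley-Reisner ring has none but 0;
  this is the hypothesis \<open>phi_small\<close>.\<close>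

lemma cocycle_is_coboundary:
  assumes i: "2 \<le> i" and \<phi>: "\<phi> \<in> derivation_cocycles P S \<epsilon> i" "\<phi> \<in> weight_derivations W U c"
    and c: "c v0 \<le> - i"
  shows "\<phi> \<in> derivation_coboundaries P S \<epsilon> i"
proof -
  have der: "\<phi> \<in> derivations P S \<epsilon> i" using \<phi>(1) by (simp add: derivation_cocycles_def)
  have "\<forall>u. \<exists>x. x \<in> hpart P 0 \<inter> W (\<lambda>v. if v = u then 1 else 0) \<and> \<epsilon> x = cls \<K> (mvvar u)"
    using lift_variable by blast
  from choice[OF this] obtain xx where
    xx: "\<And>u. xx u \<in> hpart P 0 \<inter> W (\<lambda>v. if v = u then 1 else 0)" "\<And>u. \<epsilon> (xx u) = cls \<K> (mvvar u)"
    by blast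
  obtain E where E: "freely_generated_by P E" "E \<subseteq> (\<Union>w. W w)" using resolution_facts(5) by blast
  interpret free_weighted_cdga P W v0 xx E by (rule free_weighted_cdga[OF E xx])
  interpret small_weight_cocycle P W v0 xx E S \<epsilon> i \<phi>
  proof unfold_locales
    show "\<phi> x = \<zero>\<^bsub>S\<^esub>" if "x \<in> hpart P i" "x \<in> W w" "w v0 \<le> i - 1" for x w
    proof (rule SR_weight_neg[OF complex])
      show "\<phi> x \<in> U (\<lambda>v. w v + c v)" using \<phi>(2) that(2) unfolding weight_derivations_def by blast
      show "w v0 + c v0 < 0" using that(3) c by simp
    qed
  qed (fact eps_closed eps_add eps_mult eps_smult eps_degree eps_bdry i der cocycle_bdry[OF \<phi>(1)])+
  obtain \<psi> where "\<psi> \<in> derivations P S \<epsilon> (i - 1)" "\<And>x. x \<in> carrier P \<Longrightarrow> \<psi> (bdry P x) = \<phi> x"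
    using primitive_exists by blast
  then show ?thesis using der by (intro coboundaryI) blast+
qed

lemma zero_cocycle: "(\<lambda>x\<in>carrier P. \<zero>\<^bsub>S\<^esub>) \<in> derivation_cocycles P S \<epsilon> i"
  and zero_weight: "(\<lambda>x\<in>carrier P. \<zero>\<^bsub>S\<^esub>) \<in> weight_derivations W U c"
proof -
  have "derivation_differential P S i (\<lambda>x\<in>carrier P. \<zero>\<^bsub>S\<^esub>) = (\<lambda>x\<in>carrier P. \<zero>\<^bsub>S\<^esub>)"
    unfolding derivation_differential_def by (rule restrict_ext) (simp add: bdry_closed)
  then show "(\<lambda>x\<in>carrier P. \<zero>\<^bsub>S\<^esub>) \<in> derivation_cocycles P S \<epsilon> i"
    using zero_derivation by (simp add: derivation_cocycles_def derivation_group_def)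
  have "\<zero>\<^bsub>S\<^esub> \<in> U w" for w
    using S.submoduleD(2)[OF S.graded_indepD(1)[OF SR_graded_indep[OF complex]]] .
  then show "(\<lambda>x\<in>carrier P. \<zero>\<^bsub>S\<^esub>) \<in> weight_derivations W U c"
    unfolding weight_derivations_def using WD(6) by auto
qed

end

theorem proposition1p3:
  fixes \<K> :: "'v::finite set set"
    and P :: "('k::field_char_0, 'p) dga"
    and W :: "('v \<Rightarrow> int) \<Rightarrow> 'p set"
    and \<epsilon> :: "'p \<Rightarrow> ('v, 'k) mvpoly set"
    and a b :: "'v \<Rightarrow> nat" and c :: "'v \<Rightarrow> int" and i :: int
  assumes "simplicial_complex \<K>"
    and "is_resolution_of_complex \<K> P W \<epsilon>"
    and "i \<ge> 2"
    and "weight_support a \<inter> weight_support b = {}"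
    and "c = (\<lambda>v. int (a v) - int (b v))"
    and "\<not> (\<forall>v. int (b v) \<in> {0..i - 1})"
  shows "T_complex_weight \<K> P W \<epsilon> i c = {\<one>\<^bsub>T_complex \<K> P \<epsilon> i\<^esub>}"
proof -
  interpret complex_resolution \<K> P W \<epsilon> using assms(1,2) by (rule complex_resolution.intro)
  let ?H = "derivation_coboundaries P S \<epsilon> i" and ?G = "derivation_group P S \<epsilon> i"
  let ?Z = "derivation_cocycles P S \<epsilon> i \<inter> weight_derivations W U c"
  obtain v0 where v0: "\<not> int (b v0) \<le> i - 1" using assms(6) by auto
  \<comment> \<open>\<open>b v0 \<ge> i > 0\<close> puts \<open>v0\<close> in the support of
    \<open>b\<close>, so disjointness gives \<open>a v0 = 0\<close> and
    \<open>c v0 = - b v0 \<le> - i\<close>.\<close>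
  then have "b v0 \<noteq> 0" using assms(3) by (intro notI) simp
  then have "a v0 = 0" using assms(4) by (auto simp: weight_support_def)
  then have "c v0 \<le> - i" using v0 by (simp add: assms(5))
  then have coset: "?H #>\<^bsub>?G\<^esub> \<phi> = ?H" if "\<phi> \<in> ?Z" for \<phi>
    using that assms(3) by (intro coset_of_coboundary cocycle_is_coboundary) blast+
  \<comment> \<open>Guarantees that the set of classes is not empty, so that it is exactly the
    trivial class.\<close>
  have "(\<lambda>x\<in>carrier P. \<zero>\<^bsub>S\<^esub>) \<in> ?Z" using zero_cocycle zero_weight by blast
  then have "{?H #>\<^bsub>?G\<^esub> \<phi> | \<phi>. \<phi> \<in> ?Z} = {?H}" using coset by blast
  then show ?thesis unfolding cotangent_cohomology_weight_def cotangent_cohomology_def by simp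
qed

end
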